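(* There are absolute positive constants $\varepsilon_0,\delta_0$ and $K_0$ with the following property. Let $K\ge K_0$ and let $A\in M_n(\mathbb C)$ be traceless. Assume that (a) $\mu_0(D)\le K\|D\|$ for every traceless $D\in M_m(\mathbb C)$ with $1\le m<n$, and (b) $\mu_0(A)>\tfrac34K\|A\|$. Then $\operatorname{rank}_{\varepsilon_0}(A)>\delta_0n$. Consequently, $\|A\|_2^2\ge c_0n\|A\|^2$, where $c_0=\tfrac12\delta_0\varepsilon_0^2$.
   Context: $\|\cdot\|$ is the operator norm and $\|A\|_2=(\operatorname{Tr}A^*A)^{1/2}$ the (unnormalized) Hilbert--Schmidt norm. For a traceless $A\in M_n(\mathbb C)$, the homogeneous commutator cost is $\mu_0(A)=\inf\{\|B\|\,\|C\|:B,C\in M_n(\mathbb C),\ A=BC-CB\}$. For $A\in M_n(\mathbb C)$ and $\varepsilon>0$, $\operatorname{rank}_\varepsilon(A)=\min\{\operatorname{rank}F:F\in M_n(\mathbb C),\ \|A-F\|\le\varepsilon\|A\|\}$. Absolute constants do not depend on $n$, $A$ or $K$. *)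

theory Defs
  imports
    "Jordan_Normal_Form.Schur_Decomposition"
    "Jordan_Normal_Form.DL_Rank"
    "HOL-Analysis.L2_Norm"
    "HOL-Library.Extended_Real"
begin

definition mat_trace :: "complex mat \<Rightarrow> complex" where
  "mat_trace A = (\<Sum>i<dim_row A. A $$ (i, i))"

definition vec_l2_norm :: "complex vec \<Rightarrow> real" where
  "vec_l2_norm v = L2_set (\<lambda>i. cmod (v $ i)) {..<dim_vec v}"

definition op_norm :: "complex mat \<Rightarrow> real" where
  "op_norm A = (SUP v \<in> {v \<in> carrier_vec (dim_col A). vec_l2_norm v \<le> 1}. vec_l2_norm (A *\<^sub>v v))"

(* The trace of A* A is real and nonnegative, so Re loses nothing. *)
definition hs_norm :: "complex mat \<Rightarrow> real" where
  "hs_norm A = sqrt (Re (mat_trace (mat_adjoint A * A)))"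

(* The infimum is taken in the extended reals, with value \<infinity> if A is not a commutator;
   for square A of trace zero the set of factorizations is nonempty (Shoda). *)
definition commutator_cost :: "complex mat \<Rightarrow> ereal" where
  "commutator_cost A =
     Inf {ereal (op_norm B * op_norm C) | B C.
            B \<in> carrier_mat (dim_row A) (dim_row A) \<and> C \<in> carrier_mat (dim_row A) (dim_row A) \<and>
            A = B * C - C * B}"

abbreviation mat_rank :: "complex mat \<Rightarrow> nat" where
  "mat_rank F \<equiv> vec_space.rank (dim_row F) F"

definition approx_rank :: "real \<Rightarrow> complex mat \<Rightarrow> nat" where
  "approx_rank \<epsilon> A =
     (LEAST r. \<exists>F \<in> carrier_mat (dim_row A) (dim_col A).
        op_norm (A - F) \<le> \<epsilon> * op_norm A \<and> mat_rank F = r)"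

end

theory Submission
  imports Defs "HOL-Analysis.Convex"
begin

text \<open>
  Suppose that \<open>A = F + E\<close> with \<open>rank F \<le> \<delta>n\<close> and \<open>\<parallel>E\<parallel> \<le> \<epsilon>\<parallel>A\<parallel>\<close>. Both \<open>F\<close> and \<open>F\<^sup>*\<close> vanish off the span
  of few vectors. Take an orthonormal basis \<open>h\<close> of that span, choose three vectors \<open>g\<close> for each \<open>h\<close>
  orthogonal to everything chosen so far and to its images under \<open>A\<close> and \<open>A\<^sup>*\<close>, and form the four
  Hadamard combinations \<open>(h \<plusminus> g\<^sub>1 \<plusminus> g\<^sub>2 \<plusminus> g\<^sub>3) / 2\<close>. This yields four blocks to which \<open>F\<close> compresses with a
  quarter of its norm and on which \<open>A\<close> has equal traces. The remaining space is distributed evenly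
  using a basis in which \<open>A\<close> has constant diagonal, and up to three vectors \<open>q\<close> with \<open>\<langle>Aq, q\<rangle> = 0\<close>, split
  off beforehand, make the dimension divisible by four. So all diagonal blocks of \<open>A\<close> are traceless,
  of norm at most \<open>0.27\<parallel>A\<parallel>\<close>, and commutators \<open>[B\<^sub>k, C\<^sub>k]\<close> with \<open>\<parallel>B\<^sub>k\<parallel> \<le> 1\<close> and \<open>\<parallel>C\<^sub>k\<parallel>\<close> about \<open>0.27K\<parallel>A\<parallel>\<close>.
  Shifting the \<open>B\<^sub>k\<close> by scalars that put them in disjoint discs inside the disc of radius \<open>2.56\<close>, the
  off-diagonal blocks of \<open>C\<close> solve Sylvester equations with bounds independent of \<open>K\<close>, and the total
  cost is at most \<open>2.56 \<cdot> 0.27K\<parallel>A\<parallel> + O(\<parallel>A\<parallel>)\<close>, which is below \<open>(3/4)K\<parallel>A\<parallel>\<close> for large \<open>K\<close>.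
\<close>

section \<open>Finitely supported infinite matrices\<close>

text \<open>The obstacle is that a compression of \<open>A\<close> need not be smaller than
  \<open>A\<close>, while putting shifted blocks side by side costs a factor, since disjoint unit
  discs need a larger disc around them. Two discs need radius 2 against a gain of 1/2, so nothing is
  won; four need 1 + sqrt 2 against a gain of 1/4, a ratio of about 0.604, which leaves room below
  3/4 for gaps and for \<open>E\<close>. The gain of 1/4 exists only because the few directions seen
  by \<open>F\<close> can be diluted among many that it kills. Only traceless blocks are
  commutators; orthogonality to images under \<open>A\<close> and its adjoint removes the cross
  terms from the diagonal values, so the four signed combinations share one value. Hypothesis (a)
  enters through the diagonal blocks alone, so \<open>K\<close> multiplies nothing else. For the
  Hilbert-Schmidt bound, a longest orthonormal family on which \<open>A\<close> exceeds a threshold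
  yields an approximation of rank at most its length, and a Bessel inequality bounds that
  length.\<close>

text \<open>Rectangular matrices and vectors of all sizes live in this one non-unital ring; vectors of
  \<open>\<complex>\<^sup>n\<close> are the elements supported in the first \<open>n\<close> rows of column 0. The norm below is the
  Hilbert--Schmidt norm.\<close>

typedef fmat = "{f :: nat \<Rightarrow> nat \<Rightarrow> complex. \<exists>N. \<forall>i j. N \<le> i \<or> N \<le> j \<longrightarrow> f i j = 0}"
  morphisms entry Fmat
  by (rule exI[of _ "\<lambda>_ _. 0"]) auto

definition supported :: "nat \<Rightarrow> nat \<Rightarrow> fmat \<Rightarrow> bool" where
  "supported m n a \<longleftrightarrow> (\<forall>i j. m \<le> i \<or> n \<le> j \<longrightarrow> entry a i j = 0)"

lemma supported_entry: "supported m n a \<Longrightarrow> m \<le> i \<or> n \<le> j \<Longrightarrow> entry a i j = 0"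
  by (auto simp: supported_def)

lemma supported_mono: "supported m n a \<Longrightarrow> m \<le> m' \<Longrightarrow> n \<le> n' \<Longrightarrow> supported m' n' a"
  by (auto simp: supported_def)

lemma ex_supported: "\<exists>N. supported N N a"
  using entry[of a] by (auto simp: supported_def)

lemma obtain_supported2:
  obtains N where "supported N N a" "supported N N b"
proof -
  obtain N1 N2 where "supported N1 N1 a" "supported N2 N2 b" using ex_supported by metis
  then have "supported (max N1 N2) (max N1 N2) a" "supported (max N1 N2) (max N1 N2) b"
    by (auto elim: supported_mono)
  then show ?thesis by (rule that)
qed

lemma obtain_supported3:
  obtains N where "supported N N a" "supported N N b" "supported N N c"
proof -
  obtain N1 N2 where "supported N1 N1 a" "supported N1 N1 b" "supported N2 N2 c"
    using ex_supported obtain_supported2 by metis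
  then have "supported (max N1 N2) (max N1 N2) a" "supported (max N1 N2) (max N1 N2) b"
     "supported (max N1 N2) (max N1 N2) c"
    by (auto elim: supported_mono)
  then show ?thesis by (rule that)
qed

lemma fmat_eqI: "(\<And>i j. entry a i j = entry b i j) \<Longrightarrow> a = b"
  by (metis ext entry_inject)

lemma entry_Fmat: "(\<And>i j. N \<le> i \<or> N \<le> j \<Longrightarrow> f i j = 0) \<Longrightarrow> entry (Fmat f) = f"
  by (rule Fmat_inverse) auto

instantiation fmat :: "{zero, plus, minus, uminus, times, scaleR}"
begin
definition "0 = Fmat (\<lambda>i j. 0)"
definition "a + b = Fmat (\<lambda>i j. entry a i j + entry b i j)"
definition "a - b = Fmat (\<lambda>i j. entry a i j - entry b i j)"
definition "- a = Fmat (\<lambda>i j. - entry a i j)"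
text \<open>Summing over the support of row \<open>i\<close> of \<open>a\<close> keeps the sum
  finite without choosing a size for the factors; \<open>entry_times\<close> replaces it by any
  sufficient bound.\<close>

definition "a * b = Fmat (\<lambda>i j. \<Sum>k | entry a i k \<noteq> 0. entry a i k * entry b k j)"
definition "scaleR r a = Fmat (\<lambda>i j. complex_of_real r * entry a i j)"
instance ..
end

definition cscale :: "complex \<Rightarrow> fmat \<Rightarrow> fmat" (infixr "*\<^sub>c" 75) where
  "c *\<^sub>c a = Fmat (\<lambda>i j. c * entry a i j)"

definition adj :: "fmat \<Rightarrow> fmat" where
  "adj a = Fmat (\<lambda>i j. cnj (entry a j i))"

lemma entry_zero [simp]: "entry 0 i j = 0"
  unfolding zero_fmat_def by (subst entry_Fmat[of 0]) auto

lemma entry_plus [simp]: "entry (a + b) i j = entry a i j + entry b i j"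
proof -
  obtain N where "supported N N a" "supported N N b" by (rule obtain_supported2)
  then show ?thesis unfolding plus_fmat_def by (subst entry_Fmat[of N]) (auto simp: supported_entry)
qed

lemma entry_minus [simp]: "entry (a - b) i j = entry a i j - entry b i j"
proof -
  obtain N where "supported N N a" "supported N N b" by (rule obtain_supported2)
  then show ?thesis unfolding minus_fmat_def by (subst entry_Fmat[of N]) (auto simp: supported_entry)
qed

lemma entry_uminus [simp]: "entry (- a) i j = - entry a i j"
proof -
  obtain N where "supported N N a" using ex_supported by blast
  then show ?thesis unfolding uminus_fmat_def by (subst entry_Fmat[of N]) (auto simp: supported_entry)
qed

lemma entry_cscale [simp]: "entry (c *\<^sub>c a) i j = c * entry a i j"
proof -
  obtain N where "supported N N a" using ex_supported by blast
  then show ?thesis unfolding cscale_def by (subst entry_Fmat[of N]) (auto simp: supported_entry)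
qed

lemma entry_scaleR [simp]: "entry (r *\<^sub>R a) i j = complex_of_real r * entry a i j"
proof -
  obtain N where "supported N N a" using ex_supported by blast
  then show ?thesis unfolding scaleR_fmat_def by (subst entry_Fmat[of N]) (auto simp: supported_entry)
qed

lemma entry_adj [simp]: "entry (adj a) i j = cnj (entry a j i)"
proof -
  obtain N where "supported N N a" using ex_supported by blast
  then show ?thesis unfolding adj_def by (subst entry_Fmat[of N]) (auto simp: supported_entry)
qed

lemma entry_times_raw:
  "entry (a * b) i j = (\<Sum>k | entry a i k \<noteq> 0. entry a i k * entry b k j)"
proof -
  obtain N where "supported N N a" "supported N N b" by (rule obtain_supported2)
  then show ?thesis unfolding times_fmat_def by (subst entry_Fmat[of N]) (auto simp: supported_entry)
qed

lemma entry_times: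
  assumes "supported m N a \<or> supported N m b"
  shows "entry (a * b) i j = (\<Sum>k<N. entry a i k * entry b k j)"
proof -
  obtain M where M: "supported M M a" using ex_supported by blast
  have "finite {k. entry a i k \<noteq> 0}"
    by (rule finite_subset[of _ "{..<M}"]) (use M in \<open>auto simp: supported_def not_less[symmetric]\<close>)
  moreover have "entry a i k * entry b k j = 0" if "k \<ge> N" for k
    using assms that by (auto simp: supported_def)
  ultimately show ?thesis
    unfolding entry_times_raw by (intro sum.mono_neutral_cong) (auto simp: not_less)
qed

lemma supported_zero [simp]: "supported m n 0"
  and supported_plus: "supported m n a \<Longrightarrow> supported m n b \<Longrightarrow> supported m n (a + b)"
  and supported_minus: "supported m n a \<Longrightarrow> supported m n b \<Longrightarrow> supported m n (a - b)"
  and supported_uminus: "supported m n a \<Longrightarrow> supported m n (- a)"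
  and supported_cscale: "supported m n a \<Longrightarrow> supported m n (c *\<^sub>c a)"
  and supported_adj: "supported m n a \<Longrightarrow> supported n m (adj a)"
  by (auto simp: supported_def)

lemma supported_times: "supported m k a \<Longrightarrow> supported k' n b \<Longrightarrow> supported m n (a * b)"
  by (auto simp: supported_def entry_times_raw)

instance fmat :: ring
proof
  fix a b c :: fmat
  show "a * b * c = a * (b * c)"
  proof (rule fmat_eqI)
    fix i j
    obtain N where N: "supported N N a" "supported N N b" "supported N N c" by (rule obtain_supported3)
    have ab: "supported N N (a * b)" using N supported_times by blast
    have "entry (a * b * c) i j = (\<Sum>k<N. \<Sum>l<N. entry a i l * entry b l k * entry c k j)"
      using N ab by (simp add: entry_times[of N N] sum_distrib_right)
    also have "\<dots> = (\<Sum>l<N. \<Sum>k<N. entry a i l * entry b l k * entry c k j)"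
      by (rule sum.swap)
    also have "\<dots> = entry (a * (b * c)) i j"
      using N by (simp add: entry_times[of N N] sum_distrib_left mult.assoc)
    finally show "entry (a * b * c) i j = entry (a * (b * c)) i j" .
  qed
  show "(a + b) * c = a * c + b * c"
  proof (rule fmat_eqI)
    fix i j
    obtain N where N: "supported N N a" "supported N N b" "supported N N c" by (rule obtain_supported3)
    then have "supported N N (a + b)" by (simp add: supported_plus)
    then show "entry ((a + b) * c) i j = entry (a * c + b * c) i j"
      using N by (simp add: entry_times[of N N] sum.distrib distrib_right)
  qed
  show "a * (b + c) = a * b + a * c"
  proof (rule fmat_eqI)
    fix i j
    obtain N where N: "supported N N a" "supported N N b" "supported N N c" by (rule obtain_supported3)
    then show "entry (a * (b + c)) i j = entry (a * b + a * c) i j"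
      by (simp add: entry_times[of N N] sum.distrib distrib_left)
  qed
qed (auto intro!: fmat_eqI)

lemma cscale_simps:
  "c *\<^sub>c (a + b) = c *\<^sub>c a + c *\<^sub>c b" "(c + d) *\<^sub>c a = c *\<^sub>c a + d *\<^sub>c a"
  "c *\<^sub>c (a - b) = c *\<^sub>c a - c *\<^sub>c b" "(c - d) *\<^sub>c a = c *\<^sub>c a - d *\<^sub>c a"
  "c *\<^sub>c (d *\<^sub>c a) = (c * d) *\<^sub>c a" "1 *\<^sub>c a = a" "0 *\<^sub>c a = 0" "c *\<^sub>c 0 = 0"
  "(- c) *\<^sub>c a = - (c *\<^sub>c a)" "c *\<^sub>c (- a) = - (c *\<^sub>c a)"
  by (auto intro!: fmat_eqI simp: algebra_simps)

lemma cscale_times_left: "(c *\<^sub>c a) * b = c *\<^sub>c (a * b)"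
proof (rule fmat_eqI)
  fix i j
  obtain N where N: "supported N N a" "supported N N b" by (rule obtain_supported2)
  then show "entry ((c *\<^sub>c a) * b) i j = entry (c *\<^sub>c (a * b)) i j"
    by (simp add: entry_times[of N N] supported_cscale sum_distrib_left mult.assoc)
qed

lemma cscale_times_right: "a * (c *\<^sub>c b) = c *\<^sub>c (a * b)"
proof (rule fmat_eqI)
  fix i j
  obtain N where N: "supported N N a" "supported N N b" by (rule obtain_supported2)
  then show "entry (a * (c *\<^sub>c b)) i j = entry (c *\<^sub>c (a * b)) i j"
    by (simp add: entry_times[of N N] sum_distrib_left mult.left_commute)
qed

lemma cscale_sum: "c *\<^sub>c (\<Sum>i\<in>I. f i) = (\<Sum>i\<in>I. c *\<^sub>c f i)"
  by (induction I rule: infinite_finite_induct) (auto simp: cscale_simps)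

lemma scaleR_eq_cscale: "r *\<^sub>R a = complex_of_real r *\<^sub>c a"
  by (auto intro!: fmat_eqI)

lemma entry_sum: "entry (\<Sum>k\<in>K. f k) i j = (\<Sum>k\<in>K. entry (f k) i j)"
  by (induction K rule: infinite_finite_induct) auto

lemma supported_sum: "(\<And>k. k \<in> K \<Longrightarrow> supported m n (f k)) \<Longrightarrow> supported m n (\<Sum>k\<in>K. f k)"
  by (induction K rule: infinite_finite_induct) (auto intro: supported_plus)

lemma adj_simps [simp]:
  "adj (a + b) = adj a + adj b" "adj (a - b) = adj a - adj b" "adj (- a) = - adj a"
  "adj (c *\<^sub>c a) = cnj c *\<^sub>c adj a" "adj (adj a) = a" "adj 0 = 0"
  by (auto intro!: fmat_eqI)

lemma adj_sum: "adj (\<Sum>i\<in>I. f i) = (\<Sum>i\<in>I. adj (f i))"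
  by (induction I rule: infinite_finite_induct) auto

lemma adj_times [simp]: "adj (a * b) = adj b * adj a"
proof (rule fmat_eqI)
  fix i j
  obtain N where N: "supported N N a" "supported N N b" by (rule obtain_supported2)
  then show "entry (adj (a * b)) i j = entry (adj b * adj a) i j"
    by (simp add: entry_times[of N N] supported_adj mult.commute)
qed

section \<open>Trace and Hilbert-Schmidt inner product\<close>

definition tr :: "fmat \<Rightarrow> complex" where
  "tr a = (\<Sum>i | entry a i i \<noteq> 0. entry a i i)"

lemma tr_eq: "supported N M a \<Longrightarrow> tr a = (\<Sum>i<N. entry a i i)"
  unfolding tr_def by (intro sum.mono_neutral_left) (auto simp: supported_def not_less[symmetric])

lemma tr_simps [simp]:
  "tr (a + b) = tr a + tr b" "tr (a - b) = tr a - tr b"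
  "tr (c *\<^sub>c a) = c * tr a" "tr (adj a) = cnj (tr a)" "tr 0 = 0"
proof -
  obtain N where N: "supported N N a" "supported N N b" by (rule obtain_supported2)
  then show "tr (a + b) = tr a + tr b" "tr (a - b) = tr a - tr b"
     "tr (c *\<^sub>c a) = c * tr a" "tr (adj a) = cnj (tr a)" "tr 0 = 0"
    by (simp_all add: tr_eq[of N N] supported_plus supported_minus supported_cscale supported_adj sum.distrib
        sum_subtractf sum_distrib_left)
qed

lemma tr_sum: "tr (\<Sum>i\<in>I. f i) = (\<Sum>i\<in>I. tr (f i))"
  by (induction I rule: infinite_finite_induct) auto

lemma tr_times_commute: "tr (a * b) = tr (b * a)"
proof -
  obtain N where N: "supported N N a" "supported N N b" by (rule obtain_supported2)
  then have "supported N N (a * b)" "supported N N (b * a)" using supported_times by blast+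
  then have "tr (a * b) = (\<Sum>i<N. \<Sum>k<N. entry a i k * entry b k i)"
      "tr (b * a) = (\<Sum>i<N. \<Sum>k<N. entry b i k * entry a k i)"
    using N by (simp_all add: tr_eq[of N N] entry_times[of N N])
  then show ?thesis by (subst (asm) (2) sum.swap) (simp add: mult.commute)
qed

text \<open>Linear in the first argument and conjugate linear in the second. On elements of column 0
  it is the standard complex inner product of vectors.\<close>

definition ip :: "fmat \<Rightarrow> fmat \<Rightarrow> complex" where
  "ip x y = tr (adj y * x)"

lemma ip_eq:
  assumes "supported N M x" "supported N M y"
  shows "ip x y = (\<Sum>i<N. \<Sum>j<M. entry x i j * cnj (entry y i j))"
proof -
  have "supported M M (adj y * x)" using assms supported_times supported_adj by blast
  then have "ip x y = (\<Sum>j<M. \<Sum>i<N. cnj (entry y i j) * entry x i j)"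
    unfolding ip_def using assms by (simp add: tr_eq[of M M] entry_times[of M N] supported_adj)
  then show ?thesis by (subst sum.swap) (simp add: mult.commute)
qed

lemma ip_simps:
  "ip (x + y) z = ip x z + ip y z" "ip z (x + y) = ip z x + ip z y"
  "ip (x - y) z = ip x z - ip y z" "ip z (x - y) = ip z x - ip z y"
  "ip (c *\<^sub>c x) z = c * ip x z" "ip z (c *\<^sub>c x) = cnj c * ip z x"
  "ip 0 z = 0" "ip z 0 = 0"
  by (simp_all add: ip_def distrib_left distrib_right right_diff_distrib left_diff_distrib
      cscale_times_left cscale_times_right)

lemma ip_sum_left: "ip (\<Sum>i\<in>I. f i) z = (\<Sum>i\<in>I. ip (f i) z)"
  by (induction I rule: infinite_finite_induct) (auto simp: ip_simps)

lemma ip_sum_right: "ip z (\<Sum>i\<in>I. f i) = (\<Sum>i\<in>I. ip z (f i))"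
  by (induction I rule: infinite_finite_induct) (auto simp: ip_simps)

lemma cnj_ip: "cnj (ip x y) = ip y x"
  using tr_simps(4)[of "adj y * x"] by (simp add: ip_def)

lemma ip_times_left: "ip (a * x) y = ip x (adj a * y)"
  by (simp add: ip_def mult.assoc)

lemma ip_adj: "ip (adj x) (adj y) = ip y x"
  unfolding ip_def by (simp add: tr_times_commute[of y])

lemma ip_self:
  assumes "supported N M x"
  shows "ip x x = complex_of_real (\<Sum>i<N. \<Sum>j<M. (cmod (entry x i j))\<^sup>2)"
  using assms by (simp add: ip_eq flip: complex_norm_square)

instantiation fmat :: real_inner
begin
definition "inner x y = Re (ip x y)"
definition "norm (x::fmat) = sqrt (inner x x)"
definition "dist (x::fmat) y = norm (x - y)"
definition "sgn (x::fmat) = x /\<^sub>R norm x"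
definition [code del]: "(uniformity :: (fmat \<times> fmat) filter) = (INF e\<in>{0 <..}. principal {(x, y). dist x y < e})"
definition [code del]: "open (U :: fmat set) \<longleftrightarrow> (\<forall>x\<in>U. eventually (\<lambda>(x', y). x' = x \<longrightarrow> y \<in> U) uniformity)"
instance
proof
  fix x y z :: fmat and r s :: real
  show "inner x y = inner y x"
    unfolding inner_fmat_def by (metis cnj_ip complex_cnj(1) complex.sel(1) complex.collapse)
  show "inner (x + y) z = inner x z + inner y z"
    by (simp add: inner_fmat_def ip_simps)
  show "inner (r *\<^sub>R x) y = r * inner x y"
    by (simp add: inner_fmat_def ip_simps scaleR_eq_cscale)
  obtain N where N: "supported N N x" using ex_supported by blast
  then have *: "inner x x = (\<Sum>i<N. \<Sum>j<N. (cmod (entry x i j))\<^sup>2)"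
    by (simp add: inner_fmat_def ip_self)
  show "0 \<le> inner x x" unfolding * by (intro sum_nonneg) auto
  show "inner x x = 0 \<longleftrightarrow> x = 0"
  proof
    assume "inner x x = 0"
    then have "\<forall>i<N. \<forall>j<N. entry x i j = 0"
      unfolding * by (simp add: sum_nonneg_eq_0_iff sum_nonneg)
    then show "x = 0" by (intro fmat_eqI) (metis N entry_zero not_less supported_def)
  qed (simp add: inner_fmat_def ip_simps)
qed (auto intro!: fmat_eqI simp: norm_fmat_def dist_fmat_def sgn_fmat_def
      uniformity_fmat_def open_fmat_def algebra_simps)
end

lemma norm_fmat_sq: "supported N M x \<Longrightarrow> (norm x)\<^sup>2 = (\<Sum>i<N. \<Sum>j<M. (cmod (entry x i j))\<^sup>2)"
  by (simp add: power2_norm_eq_inner inner_fmat_def ip_self)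

lemma ip_self_norm: "ip x x = complex_of_real ((norm x)\<^sup>2)"
proof -
  obtain N where "supported N N x" using ex_supported by blast
  then show ?thesis by (simp add: norm_fmat_sq ip_self)
qed

lemma norm_cscale [simp]: "norm (c *\<^sub>c (x::fmat)) = cmod c * norm x"
proof -
  obtain N where N: "supported N N x" using ex_supported by blast
  then have "(norm (c *\<^sub>c x))\<^sup>2 = (cmod c * norm x)\<^sup>2"
    by (simp add: norm_fmat_sq[of N N] supported_cscale power_mult_distrib norm_mult sum_distrib_left)
  then show ?thesis by (simp add: power2_eq_iff_nonneg)
qed

lemma norm_adj [simp]: "norm (adj x) = norm x"
proof -
  have "complex_of_real ((norm (adj x))\<^sup>2) = complex_of_real ((norm x)\<^sup>2)"
    using ip_adj[of x x] unfolding ip_self_norm .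
  then show ?thesis by (simp add: power2_eq_iff_nonneg del: of_real_power)
qed

text \<open>Cauchy-Schwarz is available for the real part \<open>inner\<close>; multiplying
  \<open>x\<close> by a unimodular number turns \<open>ip x y\<close> into its modulus.\<close>

lemma cmod_ip_le: "cmod (ip x y) \<le> norm x * norm y"
proof (cases "ip x y = 0")
  case False
  define u where "u = cnj (ip x y) / cmod (ip x y)"
  have u: "cmod u = 1" using False by (simp add: u_def norm_divide)
  have "ip (u *\<^sub>c x) y = complex_of_real (cmod (ip x y))"
    using False by (simp add: ip_simps u_def complex_norm_square[symmetric] mult.commute[of "cnj _"] power2_eq_square)
  then have "cmod (ip x y) = inner (u *\<^sub>c x) y" by (simp add: inner_fmat_def)
  also have "\<dots> \<le> norm (u *\<^sub>c x) * norm y" by (rule norm_cauchy_schwarz)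
  finally show ?thesis by (simp add: u)
qed simp

lemma norm_entry_le: "cmod (entry x i j) \<le> norm (x::fmat)"
proof -
  obtain N where N: "supported N N x" using ex_supported by blast
  show ?thesis
  proof (cases "i < N \<and> j < N")
    case True
    have "(cmod (entry x i j))\<^sup>2 \<le> (\<Sum>j<N. (cmod (entry x i j))\<^sup>2)"
      using True by (intro member_le_sum) auto
    also have "\<dots> \<le> (\<Sum>i<N. \<Sum>j<N. (cmod (entry x i j))\<^sup>2)"
      using True by (intro member_le_sum[where f = "\<lambda>i. \<Sum>j<N. (cmod (entry x i j))\<^sup>2"]) (auto intro: sum_nonneg)
    also have "\<dots> = (norm x)\<^sup>2" using N by (simp add: norm_fmat_sq)
    finally show ?thesis by (rule power2_le_imp_le) simp
  next
    case False
    then show ?thesis using N by (auto simp: supported_def not_less)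
  qed
qed

text \<open>Submultiplicativity is Cauchy-Schwarz applied to each entry of the product. The instance
  makes multiplication continuous, on which the limit of the Sylvester iteration relies.\<close>

instance fmat :: real_normed_algebra
proof
  fix a b :: fmat and r :: real
  show "(r *\<^sub>R a) * b = r *\<^sub>R (a * b)" "a * (r *\<^sub>R b) = r *\<^sub>R (a * b)"
    by (simp_all add: scaleR_eq_cscale cscale_times_left cscale_times_right)
  show "norm (a * b) \<le> norm a * norm b"
  proof -
    obtain N where N: "supported N N a" "supported N N b" by (rule obtain_supported2)
    then have NN: "supported N N (a * b)" using supported_times by blast
    have "(norm (a * b))\<^sup>2 = (\<Sum>i<N. \<Sum>j<N. (cmod (\<Sum>k<N. entry a i k * entry b k j))\<^sup>2)"
      using N NN by (simp add: norm_fmat_sq[of N N] entry_times[of N N])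
    also have "\<dots> \<le> (\<Sum>i<N. \<Sum>j<N. (\<Sum>k<N. (cmod (entry a i k))\<^sup>2) * (\<Sum>k<N. (cmod (entry b k j))\<^sup>2))"
    proof (intro sum_mono)
      fix i j
      have "(cmod (\<Sum>k<N. entry a i k * entry b k j))\<^sup>2 \<le> (\<Sum>k<N. cmod (entry a i k) * cmod (entry b k j))\<^sup>2"
        by (intro power_mono) (auto intro: order_trans[OF norm_sum] simp: norm_mult)
      also have "\<dots> \<le> (\<Sum>k<N. (cmod (entry a i k))\<^sup>2) * (\<Sum>k<N. (cmod (entry b k j))\<^sup>2)"
        by (rule Cauchy_Schwarz_ineq_sum)
      finally show "(cmod (\<Sum>k<N. entry a i k * entry b k j))\<^sup>2 \<le> \<dots>" .
    qed
    also have "\<dots> = (\<Sum>i<N. \<Sum>k<N. (cmod (entry a i k))\<^sup>2) * (\<Sum>j<N. \<Sum>k<N. (cmod (entry b k j))\<^sup>2)"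
      by (simp add: sum_product)
    also have "(\<Sum>j<N. \<Sum>k<N. (cmod (entry b k j))\<^sup>2) = (norm b)\<^sup>2"
      using N by (subst sum.swap) (simp add: norm_fmat_sq[of N N])
    also have "(\<Sum>i<N. \<Sum>k<N. (cmod (entry a i k))\<^sup>2) = (norm a)\<^sup>2"
      using N by (simp add: norm_fmat_sq[of N N])
    finally have "(norm (a * b))\<^sup>2 \<le> (norm a * norm b)\<^sup>2" by (simp add: power_mult_distrib)
    then show ?thesis by (rule power2_le_imp_le) simp
  qed
qed

section \<open>Orthonormal lists and bases with constant diagonal\<close>

lemma ip_eq_0_commute: "ip x y = 0 \<longleftrightarrow> ip y x = 0"
  by (metis cnj_ip complex_cnj_zero)

fun orthonormal :: "fmat list \<Rightarrow> bool" where
  "orthonormal [] \<longleftrightarrow> True"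
| "orthonormal (x # xs) \<longleftrightarrow> ip x x = 1 \<and> (\<forall>y\<in>set xs. ip x y = 0) \<and> orthonormal xs"

lemma orthonormal_append:
  "orthonormal (xs @ ys) \<longleftrightarrow>
     orthonormal xs \<and> orthonormal ys \<and> (\<forall>x\<in>set xs. \<forall>y\<in>set ys. ip x y = 0)"
  by (induction xs) auto

lemma orthonormal_nth:
  assumes "orthonormal xs" "i < length xs" "j < length xs"
  shows "ip (xs ! i) (xs ! j) = (if i = j then 1 else 0)"
  using assms
proof (induction xs arbitrary: i j)
  case (Cons x xs)
  then show ?case
    by (cases i; cases j) (auto simp: ip_eq_0_commute[of _ x])
qed simp

definition csubspace :: "fmat set \<Rightarrow> bool" where
  "csubspace S \<longleftrightarrow> (\<forall>x\<in>S. \<forall>y\<in>S. \<forall>\<alpha> \<beta>. \<alpha> *\<^sub>c x + \<beta> *\<^sub>c y \<in> S)"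

lemma csubspace_perp: "csubspace S \<Longrightarrow> csubspace (S \<inter> {x. ip x z = 0})"
  by (auto simp: csubspace_def ip_simps)

text \<open>With \<open>p = cos \<theta> u + \<omega> sin \<theta> v\<close>, the unimodular \<open>\<omega>\<close> is chosen such that the form at \<open>p\<close> stays
  on the line through its values at \<open>u\<close> and \<open>v\<close>; the intermediate value theorem then gives \<open>\<theta>\<close>.\<close>

lemma rotate_to_segment:
  assumes S: "csubspace S" "u \<in> S" "v \<in> S"
    and on: "ip u u = 1" "ip v v = 1" "ip u v = 0"
    and t: "0 \<le> t" "t \<le> 1"
  obtains p q where "p \<in> S" "q \<in> S" "ip p p = 1" "ip q q = 1" "ip p q = 0"
    "ip (a * p) p = (1 - of_real t) * ip (a * u) u + of_real t * ip (a * v) v"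
    "ip (a * p) p + ip (a * q) q = ip (a * u) u + ip (a * v) v"
proof -
  define A B P Q where "A = ip (a * u) u" and "B = ip (a * v) v"
    and "P = ip (a * v) u" and "Q = ip (a * u) v"
  obtain c d \<theta> :: real where cd: "c\<^sup>2 + d\<^sup>2 = 1" and \<theta>:
    "of_real ((cos \<theta>)\<^sup>2) * A + of_real ((sin \<theta>)\<^sup>2) * B
      + of_real (sin \<theta> * cos \<theta>) * (Complex c d * P + Complex c (-d) * Q) = (1 - of_real t) * A + of_real t * B"
  proof (cases "A = B")
    case True
    show ?thesis by (rule that[of 1 0 0]) (use True in \<open>simp_all add: algebra_simps\<close>)
  next
    case False
    define D where "D = B - A"
    have D: "D \<noteq> 0" "B = A + D" using False by (auto simp: D_def)
    \<comment> \<open>The cross term divided by \<open>D\<close> has imaginary part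
      \<open>c * X + d * Y\<close>, so a unit vector \<open>(c, d)\<close> orthogonal to
      \<open>(X, Y)\<close> makes it a real number \<open>r\<close>.\<close>
    define X Y where "X = Im (P / D) + Im (Q / D)" and "Y = Re (P / D) - Re (Q / D)"
    obtain c d where cd: "c\<^sup>2 + d\<^sup>2 = 1" "c * X + d * Y = 0"
    proof (cases "X = 0 \<and> Y = 0")
      case True then show ?thesis by (intro that[of 1 0]) auto
    next
      case False
      then have pos: "X\<^sup>2 + Y\<^sup>2 > 0" by (metis sum_power2_gt_zero_iff)
      have "(Y / sqrt (X\<^sup>2 + Y\<^sup>2))\<^sup>2 + (- X / sqrt (X\<^sup>2 + Y\<^sup>2))\<^sup>2 = 1"
        using pos by (auto simp: power_divide add_divide_distrib[symmetric] add.commute)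
      then show ?thesis by (rule that) simp
    qed
    define r where "r = Re (Complex c d * (P / D) + Complex c (-d) * (Q / D))"
    have "Im (Complex c d * z + Complex c (-d) * w) = c * (Im z + Im w) + d * (Re z - Re w)" for z w
      by (simp add: algebra_simps)
    then have "Im (Complex c d * (P / D) + Complex c (-d) * (Q / D)) = c * X + d * Y"
      unfolding X_def Y_def .
    then have "Complex c d * (P / D) + Complex c (-d) * (Q / D) = of_real r"
      using cd by (simp add: r_def complex_eq_iff)
    then have "(Complex c d * (P / D) + Complex c (-d) * (Q / D)) * D = of_real r * D" by simp
    then have r: "Complex c d * P + Complex c (-d) * Q = of_real r * D"
      using D by (simp add: distrib_right)
    \<comment> \<open>\<open>f \<theta>\<close> is the weight of \<open>D\<close> in the value at
      \<open>p\<close>; it runs from 0 at angle 0 to 1 at a right angle.\<close>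
    define f where "f = (\<lambda>x. (sin x)\<^sup>2 + r * sin x * cos x)"
    have "\<exists>x\<ge>0. x \<le> pi / 2 \<and> f x = t"
    proof (rule IVT')
      show "continuous_on {0..pi / 2} f" unfolding f_def by (intro continuous_intros)
    qed (use t in \<open>auto simp: f_def\<close>)
    then obtain \<theta> where \<theta>: "f \<theta> = t" by blast
    have *: "(cos \<theta>)\<^sup>2 = 1 - (sin \<theta>)\<^sup>2" by (simp add: cos_squared_eq)
    have **: "complex_of_real t = of_real ((sin \<theta>)\<^sup>2) + of_real r * of_real (sin \<theta> * cos \<theta>)"
      unfolding \<theta>[symmetric] f_def by (simp add: algebra_simps)
    show ?thesis
      by (rule that[OF cd(1), of \<theta>]) (unfold r ** * D(2), simp add: algebra_simps)
  qed
  define \<omega> where "\<omega> = Complex c d"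
  define C Z where "C = complex_of_real (cos \<theta>)" and "Z = complex_of_real (sin \<theta>)"
  have CZ: "C * C + Z * Z = 1" "cnj C = C" "cnj Z = Z"
  proof -
    have "complex_of_real ((cos \<theta>)\<^sup>2 + (sin \<theta>)\<^sup>2) = 1" by simp
    then show "C * C + Z * Z = 1" by (simp only: C_def Z_def power2_eq_square of_real_add of_real_mult)
  qed (simp_all add: C_def Z_def)
  have \<omega>: "\<omega> * cnj \<omega> = 1"
    using cd by (simp add: \<omega>_def complex_eq_iff power2_eq_square)
  have cn: "cnj \<omega> = Complex c (- d)" by (simp add: \<omega>_def complex_eq_iff)
  have on': "ip v u = 0" using on(3) by (simp add: ip_eq_0_commute)
  \<comment> \<open>\<open>q\<close> completes \<open>p\<close> to an orthonormal basis of the plane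
    of \<open>u\<close> and \<open>v\<close>, so the two diagonal values keep their sum.\<close>
  define p q where "p = C *\<^sub>c u + (\<omega> * Z) *\<^sub>c v" and "q = (- cnj \<omega> * Z) *\<^sub>c u + C *\<^sub>c v"
  have mul: "(\<omega> * x) * (cnj \<omega> * y) = x * y" "(cnj \<omega> * x) * (\<omega> * y) = x * y" for x y
  proof -
    have "(\<omega> * x) * (cnj \<omega> * y) = (\<omega> * cnj \<omega>) * (x * y)" by (simp only: mult_ac)
    then show "(\<omega> * x) * (cnj \<omega> * y) = x * y" using \<omega> by simp
    have "(cnj \<omega> * x) * (\<omega> * y) = (\<omega> * cnj \<omega>) * (x * y)" by (simp only: mult_ac)
    then show "(cnj \<omega> * x) * (\<omega> * y) = x * y" using \<omega> by simp
  qed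
  have app: "ip (a * p) p = C * C * A + Z * Z * B + Z * C * (\<omega> * P + cnj \<omega> * Q)"
  proof -
    have "ip (a * p) p = C * C * A + (\<omega> * Z) * (cnj \<omega> * Z) * B + Z * C * (\<omega> * P + cnj \<omega> * Q)"
      unfolding p_def A_def B_def P_def Q_def
      by (simp add: ip_simps distrib_left cscale_times_right CZ(2,3) algebra_simps)
    then show ?thesis by (simp only: mul)
  qed
  have aqq: "ip (a * q) q = Z * Z * A + C * C * B - Z * C * (\<omega> * P + cnj \<omega> * Q)"
  proof -
    have "ip (a * q) q = (cnj \<omega> * Z) * (\<omega> * Z) * A + C * C * B - Z * C * (\<omega> * P + cnj \<omega> * Q)"
      unfolding q_def A_def B_def P_def Q_def
      by (simp add: ip_simps distrib_left cscale_times_right cscale_simps CZ(2,3) algebra_simps)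
    then show ?thesis by (simp only: mul)
  qed
  show ?thesis
  proof (rule that[of p q])
    show "p \<in> S" "q \<in> S" using S by (auto simp: p_def q_def csubspace_def)
    have "ip p p = C * C + (\<omega> * Z) * (cnj \<omega> * Z)"
      unfolding p_def by (simp add: ip_simps on on' CZ(2,3))
    then show "ip p p = 1" by (simp only: mul CZ)
    have "ip q q = (cnj \<omega> * Z) * (\<omega> * Z) + C * C"
      unfolding q_def by (simp add: ip_simps on on' CZ(2,3))
    then show "ip q q = 1" by (simp only: mul CZ add.commute[of "Z * Z"])
    show "ip p q = 0"
      unfolding p_def q_def by (simp add: ip_simps on on' CZ(2,3))
    show "ip (a * p) p = (1 - of_real t) * ip (a * u) u + of_real t * ip (a * v) v"
      unfolding app using \<theta> by (simp add: A_def B_def C_def Z_def \<omega>_def[symmetric] cn[symmetric] power2_eq_square)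
    have "ip (a * p) p + ip (a * q) q = (C * C + Z * Z) * A + (C * C + Z * Z) * B"
      unfolding app aqq by (simp add: algebra_simps)
    then show "ip (a * p) p + ip (a * q) q = ip (a * u) u + ip (a * v) v"
      by (simp add: CZ A_def B_def)
  qed
qed

text \<open>Convexity of the numerical range, used inductively: the mean for \<open>xs\<close> is
  attained at some \<open>y\<close>, and rotating \<open>y\<close> against a new vector
  \<open>x\<close> yields the mean for \<open>x # xs\<close>. The orthogonal partner produced by the
  rotation preserves the diagonal sum.\<close>

lemma orthonormal_mean_head:
  assumes "csubspace S" "set xs \<subseteq> S" "orthonormal xs" "xs \<noteq> []"
  obtains y ys where "set (y # ys) \<subseteq> S" "orthonormal (y # ys)" "length (y # ys) = length xs"
    "of_nat (length xs) * ip (a * y) y = (\<Sum>x\<leftarrow>xs. ip (a * x) x)"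
    "(\<Sum>x\<leftarrow>y # ys. ip (a * x) x) = (\<Sum>x\<leftarrow>xs. ip (a * x) x)"
proof -
  have "\<exists>y ys. set (y # ys) \<subseteq> S \<and> orthonormal (y # ys) \<and> length (y # ys) = length xs \<and>
    of_nat (length xs) * ip (a * y) y = (\<Sum>x\<leftarrow>xs. ip (a * x) x) \<and>
    (\<Sum>x\<leftarrow>y # ys. ip (a * x) x) = (\<Sum>x\<leftarrow>xs. ip (a * x) x)"
    using assms
  proof (induction xs arbitrary: S)
    case (Cons x xs)
    show ?case
    proof (cases "xs = []")
      case True
      then show ?thesis using Cons.prems by (intro exI[of _ x] exI[of _ "[]"]) auto
    next
      case False
      have *: "set xs \<subseteq> S \<inter> {z. ip z x = 0}" using Cons.prems by (auto simp: ip_eq_0_commute[of _ x])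
      obtain y ys where y: "set (y # ys) \<subseteq> S \<inter> {z. ip z x = 0}" "orthonormal (y # ys)"
        "length (y # ys) = length xs"
        "of_nat (length xs) * ip (a * y) y = (\<Sum>x\<leftarrow>xs. ip (a * x) x)"
        "(\<Sum>x\<leftarrow>y # ys. ip (a * x) x) = (\<Sum>x\<leftarrow>xs. ip (a * x) x)"
        using Cons.IH[OF csubspace_perp[OF Cons.prems(1)] *] Cons.prems False by fastforce
      define l where "l = length xs"
      define t where "t = 1 / real (Suc l)"
      have tt: "0 \<le> t" "t \<le> 1" by (auto simp: t_def)
      \<comment> \<open>Rotating inside the complement of \<open>ys\<close> keeps the new pair
        orthogonal to the vectors left in place.\<close>
      define S' where "S' = {z \<in> S. \<forall>w\<in>set ys. ip z w = 0}"
      have S': "csubspace S'" using Cons.prems(1) by (auto simp: S'_def csubspace_def ip_simps)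
      have "y \<in> S'" "x \<in> S'" using y Cons.prems by (auto simp: S'_def ip_eq_0_commute[of x])
      moreover have "ip y y = 1" "ip x x = 1" "ip y x = 0" using y Cons.prems by auto
      ultimately obtain p q where pq: "p \<in> S'" "q \<in> S'" "ip p p = 1" "ip q q = 1" "ip p q = 0"
        "ip (a * p) p = (1 - of_real t) * ip (a * y) y + of_real t * ip (a * x) x"
        "ip (a * p) p + ip (a * q) q = ip (a * y) y + ip (a * x) x"
        by (rule rotate_to_segment[OF S' _ _ _ _ _ tt, where a = a])
      have m: "of_nat (Suc l) * ip (a * p) p = of_nat l * ip (a * y) y + ip (a * x) x"
      proof -
        have "of_nat (Suc l) * complex_of_real t = 1" by (simp add: t_def del: of_nat_Suc)
        then have 1: "of_nat (Suc l) * (1 - complex_of_real t) = of_nat l" by (simp add: algebra_simps)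
        show ?thesis unfolding pq(6) distrib_left mult.assoc[symmetric] 1
          using \<open>of_nat (Suc l) * complex_of_real t = 1\<close> by simp
      qed
      show ?thesis
      proof (intro exI[of _ p] exI[of _ "q # ys"] conjI)
        show "set (p # q # ys) \<subseteq> S" using pq y by (auto simp: S'_def)
        show "orthonormal (p # q # ys)" using pq y by (auto simp: S'_def)
        show "length (p # q # ys) = length (x # xs)" using y by simp
        show "of_nat (length (x # xs)) * ip (a * p) p = (\<Sum>x\<leftarrow>x # xs. ip (a * x) x)"
          using m y(4) by (simp add: l_def)
        show "(\<Sum>x\<leftarrow>p # q # ys. ip (a * x) x) = (\<Sum>x\<leftarrow>x # xs. ip (a * x) x)"
          using pq(7) y(5) by (simp flip: add.assoc)
      qed
    qed
  qed simp
  then show ?thesis using that by blast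
qed

text \<open>After a vector carrying the mean is removed, the others have the same mean, so the
  argument continues in its orthogonal complement. The general subspace \<open>S\<close> makes this
  recursion expressible.\<close>

lemma orthonormal_constant_diagonal:
  assumes "csubspace S" "set xs \<subseteq> S" "orthonormal xs" "(\<Sum>x\<leftarrow>xs. ip (a * x) x) = of_nat (length xs) * c"
  obtains ys where "set ys \<subseteq> S" "orthonormal ys" "length ys = length xs" "\<forall>y\<in>set ys. ip (a * y) y = c"
proof -
  have "\<exists>ys. set ys \<subseteq> S \<and> orthonormal ys \<and> length ys = length xs \<and> (\<forall>y\<in>set ys. ip (a * y) y = c)"
    using assms
  proof (induction "length xs" arbitrary: xs S)
    case 0
    then show ?case by auto
  next
    case (Suc l)
    then have "xs \<noteq> []" by auto
    then obtain y ys where y: "set (y # ys) \<subseteq> S" "orthonormal (y # ys)" "length (y # ys) = length xs"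
      "of_nat (length xs) * ip (a * y) y = (\<Sum>x\<leftarrow>xs. ip (a * x) x)"
      "(\<Sum>x\<leftarrow>y # ys. ip (a * x) x) = (\<Sum>x\<leftarrow>xs. ip (a * x) x)"
      by (rule orthonormal_mean_head[OF Suc.prems(1-3)])
    have c: "ip (a * y) y = c" using y(4) Suc.prems(4) Suc(2)[symmetric] by (simp del: of_nat_Suc)
    have "l = length ys" "set ys \<subseteq> S \<inter> {x. ip x y = 0}" "orthonormal ys"
      using y Suc(2) by (auto simp: ip_eq_0_commute[of _ y])
    moreover have "(\<Sum>x\<leftarrow>ys. ip (a * x) x) = of_nat (length ys) * c"
      using y(5) c Suc.prems(4) y(3)[symmetric] by (simp add: algebra_simps)
    ultimately have "\<exists>zs. set zs \<subseteq> S \<inter> {x. ip x y = 0} \<and> orthonormal zs \<and> length zs = length ys \<and>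
        (\<forall>z\<in>set zs. ip (a * z) z = c)"
      by (rule Suc(1)[OF _ csubspace_perp[OF Suc.prems(1)]])
    then obtain zs where "set zs \<subseteq> S \<inter> {x. ip x y = 0}" "orthonormal zs" "length zs = length ys"
      "\<forall>z\<in>set zs. ip (a * z) z = c" by blast
    then show ?case
      using y c by (intro exI[of _ "y # zs"]) (auto simp: ip_eq_0_commute[of y])
  qed
  then show ?thesis using that by blast
qed

lemma csubspace_vectors: "csubspace {x. supported m n x}"
  by (auto simp: csubspace_def intro: supported_plus supported_cscale)

section \<open>Unit vectors and the resolution of the identity\<close>

lemma ip_normalize:
  assumes "x \<noteq> 0"
  shows "ip (of_real (1 / norm x) *\<^sub>c x) (of_real (1 / norm x) *\<^sub>c x) = 1"
proof -
  have "norm (of_real (1 / norm x) *\<^sub>c x) = 1" using assms by (simp add: norm_divide)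
  then show ?thesis unfolding ip_self_norm by simp
qed

text \<open>The conjugated vectors, padded with zero rows, form a singular square matrix; a kernel
  vector is orthogonal to all of them.\<close>

lemma exists_unit_orthogonal:
  assumes "\<And>z. z \<in> set zs \<Longrightarrow> supported n 1 z" "length zs < n"
  obtains x where "supported n 1 x" "ip x x = 1" "\<And>z. z \<in> set zs \<Longrightarrow> ip x z = 0"
proof -
  define M where "M = mat n n (\<lambda>(i, j). if i < length zs then cnj (entry (zs ! i) j 0) else 0)"
  have M: "M \<in> carrier_mat n n" by (simp add: M_def)
  have "row M (length zs) = 0\<^sub>v n" using assms(2) by (auto simp: M_def)
  then have "M = mat\<^sub>r n n (\<lambda>i. if i = length zs then 0\<^sub>v n else row M i)"
    using M by (intro eq_rowI) auto
  moreover have "det \<dots> = 0" using M assms(2) by (intro det_row_0) auto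
  ultimately have "det M = 0" by simp
  then obtain v where v: "v \<in> carrier_vec n" "v \<noteq> 0\<^sub>v n" "M *\<^sub>v v = 0\<^sub>v n"
    using det_0_iff_vec_prod_zero_field[OF M] by blast
  define x where "x = Fmat (\<lambda>i j. if i < n \<and> j = 0 then v $ i else 0)"
  have ex: "entry x i j = (if i < n \<and> j = 0 then v $ i else 0)" for i j
    unfolding x_def by (subst entry_Fmat[of "Suc n"]) auto
  have sx: "supported n 1 x" by (auto simp: supported_def ex)
  have "x \<noteq> 0"
  proof
    assume "x = 0"
    then have "v $ i = 0" if "i < n" for i using ex[of i 0] that by simp
    then have "v = 0\<^sub>v n" using v(1) by (intro eq_vecI) auto
    then show False using v by blast
  qed
  have xz: "ip x z = 0" if z: "z \<in> set zs" for z
  proof -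
    obtain i where i: "i < length zs" "z = zs ! i" using z by (auto simp: in_set_conv_nth)
    have "(M *\<^sub>v v) $ i = 0" using v i assms(2) by simp
    then have "(\<Sum>j<n. cnj (entry z j 0) * v $ j) = 0"
      using i assms(2) v(1) by (simp add: M_def scalar_prod_def lessThan_atLeast0)
    then show ?thesis using sx assms(1)[OF z] by (simp add: ip_eq[of n 1] ex mult.commute)
  qed
  have "ip (of_real (1 / norm x) *\<^sub>c x) (of_real (1 / norm x) *\<^sub>c x) = 1"
    using \<open>x \<noteq> 0\<close> by (rule ip_normalize)
  then show ?thesis
    by (rule that[rotated]) (use sx xz in \<open>auto simp: ip_simps intro: supported_cscale\<close>)
qed

text \<open>The ring has no unit; this is the unit of its \<open>n\<close> by \<open>n\<close>
  corner, and the projection onto the first \<open>n\<close> coordinates.\<close>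

definition corner_one :: "nat \<Rightarrow> fmat" where
  "corner_one n = Fmat (\<lambda>i j. if i = j \<and> i < n then 1 else 0)"

lemma entry_corner_one [simp]: "entry (corner_one n) i j = (if i = j \<and> i < n then 1 else 0)"
  unfolding corner_one_def by (subst entry_Fmat[of n]) auto

lemma supported_corner_one: "supported n n (corner_one n)"
  by (auto simp: supported_def)

lemma adj_corner_one [simp]: "adj (corner_one n) = corner_one n"
  by (auto intro!: fmat_eqI)

lemma corner_one_times:
  assumes "supported n m a"
  shows "corner_one n * a = a"
proof (rule fmat_eqI)
  fix i j
  have "entry (corner_one n * a) i j = (\<Sum>k<n. if k = i then entry a i j else 0)"
    unfolding entry_times[OF disjI1[OF supported_corner_one]] by (rule sum.cong) auto
  then show "entry (corner_one n * a) i j = entry a i j"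
    using assms by (auto simp: supported_def)
qed

lemma times_corner_one:
  assumes "supported m n a" shows "a * corner_one n = a"
proof -
  have "adj (corner_one n * adj a) = adj (adj a)"
    by (rule arg_cong[OF corner_one_times]) (rule supported_adj[OF assms])
  then show ?thesis by simp
qed

text \<open>Orthonormality says that the adjoint of the matrix with columns \<open>xs\<close> is a
  left inverse. The matrix is square, so it is a right inverse as well, and that is the resolution
  of the identity.\<close>

lemma orthonormal_basis_sum:
  assumes "orthonormal xs" "\<And>x. x \<in> set xs \<Longrightarrow> supported n 1 x" "length xs = n"
  shows "(\<Sum>x\<leftarrow>xs. x * adj x) = corner_one n"
proof -
  define M where "M = mat n n (\<lambda>(i, j). entry (xs ! j) i 0)"
  define M' where "M' = mat n n (\<lambda>(i, j). cnj (entry (xs ! i) j 0))"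
  have sup: "supported n 1 (xs ! k)" if "k < n" for k using assms that by auto
  have M: "M \<in> carrier_mat n n" "M' \<in> carrier_mat n n" by (simp_all add: M_def M'_def)
  have "M' * M = 1\<^sub>m n"
  proof (rule eq_matI)
    fix i j assume ij: "i < dim_row (1\<^sub>m n :: complex mat)" "j < dim_col (1\<^sub>m n :: complex mat)"
    then have "(M' * M) $$ (i, j) = (\<Sum>k<n. cnj (entry (xs ! i) k 0) * entry (xs ! j) k 0)"
      by (simp add: M_def M'_def scalar_prod_def lessThan_atLeast0)
    also have "\<dots> = ip (xs ! j) (xs ! i)" using sup ij by (simp add: ip_eq[of n 1] mult.commute)
    finally show "(M' * M) $$ (i, j) = 1\<^sub>m n $$ (i, j)"
      using ij assms orthonormal_nth[of xs j i] by auto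
  qed (simp_all add: M_def M'_def)
  then have MM: "M * M' = 1\<^sub>m n" using mat_mult_left_right_inverse M by blast
  show ?thesis
  proof (rule fmat_eqI)
    fix i j
    have e: "entry (xs ! k * adj (xs ! k)) i j = entry (xs ! k) i 0 * cnj (entry (xs ! k) j 0)" if "k < n" for k
      using sup[OF that] by (subst entry_times[of n 1]) auto
    have "entry (\<Sum>x\<leftarrow>xs. x * adj x) i j = (\<Sum>k<n. entry (xs ! k) i 0 * cnj (entry (xs ! k) j 0))"
      using assms(3) e by (simp add: sum_list_sum_nth entry_sum lessThan_atLeast0)
    also have "\<dots> = entry (corner_one n) i j"
    proof (cases "i < n \<and> j < n")
      case True
      then have "(\<Sum>k<n. entry (xs ! k) i 0 * cnj (entry (xs ! k) j 0)) = (M * M') $$ (i, j)"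
        by (simp add: M_def M'_def scalar_prod_def lessThan_atLeast0)
      then show ?thesis using True by (simp add: MM)
    next
      case False
      then have "entry (xs ! k) i 0 * cnj (entry (xs ! k) j 0) = 0" if "k < n" for k
        using sup[OF that] by (auto simp: supported_def not_less)
      then have "(\<Sum>k<n. entry (xs ! k) i 0 * cnj (entry (xs ! k) j 0)) = 0" by (intro sum.neutral) blast
      then show ?thesis using False by auto
    qed
    finally show "entry (\<Sum>x\<leftarrow>xs. x * adj x) i j = entry (corner_one n) i j" .
  qed
qed

lemma ip_conj_eq_tr: "ip (a * x) x = tr (a * (x * adj x))"
  unfolding ip_def by (simp add: tr_times_commute[of "adj x"] mult.assoc)

lemma sum_list_ip_diag: "(\<Sum>x\<leftarrow>xs. ip (a * x) x) = tr (a * (\<Sum>x\<leftarrow>xs. x * adj x))"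
  by (induction xs) (auto simp: ip_conj_eq_tr distrib_left)

lemma orthonormal_basis_tr:
  assumes "orthonormal xs" "\<And>x. x \<in> set xs \<Longrightarrow> supported n 1 x" "length xs = n" "supported n n a"
  shows "(\<Sum>x\<leftarrow>xs. ip (a * x) x) = tr a"
  unfolding sum_list_ip_diag using orthonormal_basis_sum[OF assms(1-3)] times_corner_one[OF assms(4)] by simp

section \<open>Operator bounds\<close>

text \<open>The operator norm as an upper-bound predicate, which avoids suprema. Letting
  \<open>x\<close> be any element and not just a column gives the same notion, since left
  multiplication acts column by column.\<close>

definition bounded_by :: "fmat \<Rightarrow> real \<Rightarrow> bool" where
  "bounded_by a c \<longleftrightarrow> 0 \<le> c \<and> (\<forall>x. norm (a * x) \<le> c * norm x)"

lemma bounded_byD: "bounded_by a c \<Longrightarrow> norm (a * x) \<le> c * norm x"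
  by (simp add: bounded_by_def)

lemma bounded_by_nonneg: "bounded_by a c \<Longrightarrow> 0 \<le> c"
  by (simp add: bounded_by_def)

lemma bounded_by_mono: "bounded_by a c \<Longrightarrow> c \<le> d \<Longrightarrow> bounded_by a d"
  unfolding bounded_by_def by (meson mult_right_mono norm_ge_zero order_trans)

lemma bounded_by_zero: "0 \<le> c \<Longrightarrow> bounded_by 0 c"
  by (simp add: bounded_by_def)

lemma bounded_by_add: "bounded_by a c \<Longrightarrow> bounded_by b d \<Longrightarrow> bounded_by (a + b) (c + d)"
  unfolding bounded_by_def distrib_right by (auto intro: norm_triangle_mono)

lemma bounded_by_uminus: "bounded_by a c \<Longrightarrow> bounded_by (- a) c"
  by (simp add: bounded_by_def)

lemma bounded_by_diff: "bounded_by a c \<Longrightarrow> bounded_by b d \<Longrightarrow> bounded_by (a - b) (c + d)"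
  using bounded_by_add[OF _ bounded_by_uminus] by fastforce

lemma bounded_by_cscale: "bounded_by a c \<Longrightarrow> bounded_by (z *\<^sub>c a) (cmod z * c)"
  by (simp add: bounded_by_def cscale_times_left mult.assoc mult_left_mono)

lemma bounded_by_mult:
  assumes "bounded_by a c" "bounded_by b d"
  shows "bounded_by (a * b) (c * d)"
proof -
  have "norm (a * b * x) \<le> c * d * norm x" for x
  proof -
    have "norm (a * (b * x)) \<le> c * norm (b * x)" using assms(1) by (rule bounded_byD)
    also have "\<dots> \<le> c * (d * norm x)"
      using assms by (intro mult_left_mono bounded_byD bounded_by_nonneg)
    finally show ?thesis by (simp add: mult.assoc)
  qed
  then show ?thesis using assms by (simp add: bounded_by_def)
qed

lemma bounded_by_sum:
  "(\<And>i. i \<in> I \<Longrightarrow> bounded_by (f i) (c i)) \<Longrightarrow> bounded_by (\<Sum>i\<in>I. f i) (\<Sum>i\<in>I. c i)"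
  by (induction I rule: infinite_finite_induct) (auto intro: bounded_by_zero bounded_by_add)

lemma norm_le_from_sq: "(norm (x::fmat))\<^sup>2 \<le> norm x * c \<Longrightarrow> 0 \<le> c \<Longrightarrow> norm x \<le> c"
  by (cases "norm x = 0") (auto simp: power2_eq_square)

text \<open>The squared norm of \<open>adj a * x\<close> is \<open>ip x (a * (adj a * x))\<close> up
  to modulus; Cauchy-Schwarz leaves one factor \<open>norm (adj a * x)\<close> to cancel.\<close>

lemma bounded_by_adj:
  assumes "bounded_by a c"
  shows "bounded_by (adj a) c"
proof -
  have "norm (adj a * x) \<le> c * norm x" for x
  proof -
    have "cmod (ip (adj a * x) (adj a * x)) = cmod (ip x (a * (adj a * x)))"
      by (subst ip_times_left) simp
    also have "\<dots> \<le> norm x * norm (a * (adj a * x))" by (rule cmod_ip_le)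
    also have "\<dots> \<le> norm x * (c * norm (adj a * x))"
      by (intro mult_left_mono bounded_byD assms) simp
    finally have "(norm (adj a * x))\<^sup>2 \<le> norm (adj a * x) * (c * norm x)"
      by (simp add: ip_self_norm norm_power mult_ac)
    then show ?thesis by (rule norm_le_from_sq) (simp add: bounded_by_nonneg[OF assms])
  qed
  then show ?thesis using assms by (simp add: bounded_by_def)
qed

lemma bounded_by_projection:
  assumes "adj p = p" "p * p = p"
  shows "bounded_by p 1"
proof -
  have "norm (p * x) \<le> norm x" for x
  proof -
    have "ip (p * x) (p * x) = ip x (p * x)"
      using assms by (subst ip_times_left) (simp flip: mult.assoc)
    then have "complex_of_real ((norm (p * x))\<^sup>2) = ip x (p * x)" by (simp only: ip_self_norm)
    then have "cmod (ip x (p * x)) = (norm (p * x))\<^sup>2" by (metis abs_of_nonneg norm_of_real zero_le_power2)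
    then have "(norm (p * x))\<^sup>2 \<le> norm (p * x) * norm x"
      using cmod_ip_le[of x "p * x"] by (simp add: mult.commute)
    then show ?thesis by (rule norm_le_from_sq) simp
  qed
  then show ?thesis by (simp add: bounded_by_def)
qed

text \<open>The C*-identity controls \<open>adj t\<close> by \<open>t * adj t\<close>; passing to
  adjoints then controls \<open>t\<close>.\<close>

lemma bounded_by_partial_isometry:
  assumes "bounded_by (t * adj t) 1"
  shows "bounded_by t 1"
proof -
  have "norm (adj t * x) \<le> norm x" for x
  proof -
    have "cmod (ip (adj t * x) (adj t * x)) = cmod (ip x (t * adj t * x))"
      by (subst ip_times_left) (simp add: mult.assoc)
    also have "\<dots> \<le> norm x * norm (t * adj t * x)" by (rule cmod_ip_le)
    also have "\<dots> \<le> norm x * norm x" using bounded_byD[OF assms, of x] by (intro mult_left_mono) auto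
    finally have "(norm (adj t * x))\<^sup>2 \<le> (norm x)\<^sup>2" by (simp add: ip_self_norm norm_power norm_mult power2_eq_square)
    then show ?thesis by (rule power2_le_imp_le) simp
  qed
  then have "bounded_by (adj t) 1" by (simp add: bounded_by_def)
  then show ?thesis using bounded_by_adj by fastforce
qed

lemma norm_sum_orthogonal:
  assumes "finite I" "\<And>i j. i \<in> I \<Longrightarrow> j \<in> I \<Longrightarrow> i \<noteq> j \<Longrightarrow> ip (u i) (u j) = 0"
  shows "(norm (\<Sum>i\<in>I. u i))\<^sup>2 = (\<Sum>i\<in>I. (norm (u i))\<^sup>2)"
proof -
  have "ip (\<Sum>i\<in>I. u i) (\<Sum>i\<in>I. u i) = (\<Sum>i\<in>I. \<Sum>j\<in>I. if i = j then ip (u i) (u i) else 0)"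
    unfolding ip_sum_left ip_sum_right by (intro sum.cong) (auto simp: assms)
  also have "\<dots> = (\<Sum>i\<in>I. ip (u i) (u i))" using assms(1) by simp
  finally have "complex_of_real ((norm (\<Sum>i\<in>I. u i))\<^sup>2) = complex_of_real (\<Sum>i\<in>I. (norm (u i))\<^sup>2)"
    by (simp add: ip_self_norm)
  then show ?thesis by (simp only: of_real_eq_iff)
qed

text \<open>Pythagoras twice: the images \<open>d k * x\<close> lie in orthogonal ranges, and each
  depends only on the component \<open>p k * x\<close>. Hence no factor for the number of blocks
  appears.\<close>

lemma bounded_by_block_diagonal:
  assumes "finite K" and pp: "\<And>k l. k \<in> K \<Longrightarrow> l \<in> K \<Longrightarrow> p k * p l = (if k = l then p k else 0)"
    and adj: "\<And>k. k \<in> K \<Longrightarrow> adj (p k) = p k"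
    and q: "bounded_by (\<Sum>k\<in>K. p k) 1"
    and d: "\<And>k. k \<in> K \<Longrightarrow> p k * d k = d k" "\<And>k. k \<in> K \<Longrightarrow> d k * p k = d k"
    and b: "\<And>k. k \<in> K \<Longrightarrow> bounded_by (d k) c" and c: "0 \<le> c"
  shows "bounded_by (\<Sum>k\<in>K. d k) c"
proof -
  have "norm ((\<Sum>k\<in>K. d k) * x) \<le> c * norm x" for x
  proof -
    have orth: "ip (p k * u) (p l * w) = 0" if "k \<in> K" "l \<in> K" "k \<noteq> l" for k l u w
    proof -
      have "ip (p k * u) (p l * w) = ip u ((p k * p l) * w)"
        using adj[OF that(1)] by (subst ip_times_left) (simp add: mult.assoc)
      then show ?thesis using pp[OF that(1,2)] that(3) by (simp add: ip_simps)
    qed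
    have "(norm ((\<Sum>k\<in>K. d k) * x))\<^sup>2 = (\<Sum>k\<in>K. (norm (d k * x))\<^sup>2)"
      unfolding sum_distrib_right
    proof (rule norm_sum_orthogonal[OF assms(1)])
      fix k l assume kl: "k \<in> K" "l \<in> K" "k \<noteq> l"
      show "ip (d k * x) (d l * x) = 0"
        using orth[OF kl, of "d k * x" "d l * x"] d(1) kl by (simp add: mult.assoc[symmetric])
    qed
    also have "\<dots> \<le> (\<Sum>k\<in>K. c\<^sup>2 * (norm (p k * x))\<^sup>2)"
    proof (rule sum_mono)
      fix k assume k: "k \<in> K"
      have "norm (d k * x) \<le> c * norm (p k * x)"
        using bounded_byD[OF b[OF k], of "p k * x"] d(2)[OF k] by (simp add: mult.assoc[symmetric])
      from power_mono[OF this norm_ge_zero, of 2]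
      show "(norm (d k * x))\<^sup>2 \<le> c\<^sup>2 * (norm (p k * x))\<^sup>2" by (simp add: power_mult_distrib)
    qed
    also have "\<dots> = c\<^sup>2 * (norm ((\<Sum>k\<in>K. p k) * x))\<^sup>2"
      unfolding sum_distrib_right sum_distrib_left[symmetric]
      using norm_sum_orthogonal[OF assms(1), of "\<lambda>k. p k * x"] orth by simp
    also have "\<dots> \<le> c\<^sup>2 * (norm x)\<^sup>2"
      using bounded_byD[OF q, of x] by (intro mult_left_mono power_mono) auto
    finally have "(norm ((\<Sum>k\<in>K. d k) * x))\<^sup>2 \<le> (c * norm x)\<^sup>2" by (simp add: power_mult_distrib)
    then show ?thesis by (rule power2_le_imp_le) (simp add: c)
  qed
  then show ?thesis using c by (simp add: bounded_by_def)
qed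

section \<open>Sylvester equations and block commutators\<close>

text \<open>The whole type is not complete, but a fixed corner is finite-dimensional: telescoping
  makes each entry converge, and finitely many entrywise limits give convergence in norm.\<close>

lemma fmat_series_converges:
  fixes Y :: "nat \<Rightarrow> fmat"
  assumes sup: "\<And>k. supported n n (Y k)" and sm: "summable b" and b: "\<And>k. norm (Y (Suc k) - Y k) \<le> b k"
  obtains L where "supported n n L" "Y \<longlonglongrightarrow> L"
proof -
  have conv: "convergent (\<lambda>k. entry (Y k) i j)" for i j
  proof -
    have "summable (\<lambda>k. entry (Y (Suc k)) i j - entry (Y k) i j)" (is "summable ?d")
    proof (rule summable_comparison_test'[OF sm])
      fix k
      show "norm (entry (Y (Suc k)) i j - entry (Y k) i j) \<le> b k"
        using norm_entry_le[of "Y (Suc k) - Y k" i j] b[of k] by simp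
    qed
    then have "convergent (\<lambda>k. \<Sum>l<k. ?d l)" by (simp add: summable_iff_convergent)
    then have "convergent (\<lambda>k. entry (Y k) i j - entry (Y 0) i j)" by (simp only: sum_lessThan_telescope[of "\<lambda>k. entry (Y k) i j"])
    from convergent_add[OF this convergent_const[of "entry (Y 0) i j"]] show ?thesis by simp
  qed
  define L where "L = Fmat (\<lambda>i j. if i < n \<and> j < n then lim (\<lambda>k. entry (Y k) i j) else 0)"
  have eL: "entry L i j = (if i < n \<and> j < n then lim (\<lambda>k. entry (Y k) i j) else 0)" for i j
    unfolding L_def by (subst entry_Fmat[of n]) auto
  have sL: "supported n n L" by (auto simp: supported_def eL)
  have "(\<lambda>k. \<Sum>i<n. \<Sum>j<n. (cmod (entry (Y k - L) i j))\<^sup>2) \<longlonglongrightarrow> (\<Sum>i<n. \<Sum>j<n. (cmod 0)\<^sup>2)"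
  proof (intro tendsto_intros)
    fix i j assume "i \<in> {..<n}" "j \<in> {..<n}"
    then have "(\<lambda>k. entry (Y k) i j) \<longlonglongrightarrow> entry L i j"
      using conv[of i j] by (simp add: eL convergent_LIMSEQ_iff)
    then show "(\<lambda>k. entry (Y k - L) i j) \<longlonglongrightarrow> 0"
      by (simp add: LIM_zero)
  qed
  then have "(\<lambda>k. (norm (Y k - L))\<^sup>2) \<longlonglongrightarrow> 0"
    using sup sL by (simp add: norm_fmat_sq[of n n] supported_minus)
  then have "(\<lambda>k. sqrt ((norm (Y k - L))\<^sup>2)) \<longlonglongrightarrow> sqrt 0" by (rule tendsto_real_sqrt)
  then have "Y \<longlonglongrightarrow> L" by (simp add: tendsto_norm_zero_iff LIM_zero_iff)
  with sL show ?thesis by (rule that)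
qed

lemma bounded_by_limit:
  assumes "\<And>k. bounded_by (Y k) c" "Y \<longlonglongrightarrow> L"
  shows "bounded_by L c"
proof -
  have "norm (L * x) \<le> c * norm x" for x
  proof (rule LIMSEQ_le_const2)
    show "(\<lambda>k. norm (Y k * x)) \<longlonglongrightarrow> norm (L * x)" using assms(2) by (intro tendsto_intros)
  qed (use assms(1) bounded_byD in blast)
  then show ?thesis using assms(1)[of 0] by (simp add: bounded_by_def)
qed

lemma tendsto_cscale: "(Y \<longlonglongrightarrow> L) \<Longrightarrow> (\<lambda>k. z *\<^sub>c Y k) \<longlonglongrightarrow> z *\<^sub>c L"
  by (rule bounded_linear.tendsto[where f = "cscale z"], rule bounded_linear_intro[where K = "cmod z"])
     (auto simp: cscale_simps scaleR_eq_cscale mult.commute)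

text \<open>The equation is the fixed point equation of an affine map \<open>T\<close> that
  contracts by \<open>(r + s) / cmod z\<close>, and the solution is the limit of its iterates from
  0.\<close>

lemma sylvester_solution:
  assumes sup: "supported n n d" "supported n n e" "supported n n m"
    and d: "bounded_by d r" and e: "bounded_by e s" and m: "bounded_by m \<mu>"
    and z: "r + s < cmod z"
  obtains x where "supported n n x" "z *\<^sub>c x + d * x - x * e = m" "bounded_by x (\<mu> / (cmod z - r - s))"
proof -
  define T where "T = (\<lambda>x. (1 / z) *\<^sub>c (m - d * x + x * e))"
  define Y where "Y = (\<lambda>k. (T ^^ k) 0)"
  have Y0: "Y 0 = 0" and YS: "Y (Suc k) = T (Y k)" for k by (simp_all add: Y_def)
  have rs: "0 \<le> r" "0 \<le> s" "0 \<le> \<mu>" using d e m bounded_by_nonneg by auto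
  have z0: "cmod z > 0" "z \<noteq> 0" using z rs by auto
  define q where "q = (r + s) / cmod z"
  have q: "0 \<le> q" "q < 1" using z rs z0 by (auto simp: q_def)
  have supY: "supported n n (Y k)" for k
  proof (induction k)
    case (Suc k)
    then show ?case unfolding YS T_def
      using sup by (intro supported_cscale supported_plus supported_minus) (auto intro: supported_times)
  qed (simp add: Y0)
  \<comment> \<open>\<open>c\<close> is the fixed point of the scalar recursion for the bounds, so
    \<open>T\<close> maps elements bounded by \<open>c\<close> to elements bounded by
    \<open>c\<close>.\<close>
  define c where "c = \<mu> / (cmod z - r - s)"
  have c: "\<mu> + (r + s) * c = cmod z * c" using z by (simp add: c_def field_simps)
  have c0: "0 \<le> c" using z rs by (simp add: c_def)
  have bY: "bounded_by (Y k) c" for k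
  proof (induction k)
    case 0 then show ?case using c0 by (simp add: Y0 bounded_by_zero)
  next
    case (Suc k)
    have "bounded_by (T (Y k)) (cmod (1 / z) * (\<mu> + r * c + c * s))"
      unfolding T_def by (intro bounded_by_cscale bounded_by_add bounded_by_diff bounded_by_mult d e m Suc)
    also have "cmod (1 / z) * (\<mu> + r * c + c * s) = c"
      using c z0 by (simp add: norm_divide field_simps)
    finally show ?case by (simp add: YS)
  qed
  have dY: "norm (Y (Suc k) - Y k) \<le> norm (Y 1) * q ^ k" for k
  proof (induction k)
    case (Suc k)
    have "Y (Suc (Suc k)) - Y (Suc k) = (1 / z) *\<^sub>c ((Y (Suc k) - Y k) * e - d * (Y (Suc k) - Y k))"
      unfolding YS[of "Suc k"] YS[of k] unfolding T_def by (simp add: algebra_simps cscale_simps)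
    then have "norm (Y (Suc (Suc k)) - Y (Suc k)) = norm ((Y (Suc k) - Y k) * e - d * (Y (Suc k) - Y k)) / cmod z"
      by (simp add: norm_divide)
    also have "\<dots> \<le> (norm ((Y (Suc k) - Y k) * e) + norm (d * (Y (Suc k) - Y k))) / cmod z"
      by (intro divide_right_mono norm_triangle_ineq4) simp
    also have "\<dots> \<le> (s * norm (Y (Suc k) - Y k) + r * norm (Y (Suc k) - Y k)) / cmod z"
    proof (intro divide_right_mono add_mono)
      \<comment> \<open>\<open>bounded_by\<close> controls left multiplication; taking adjoints
        moves the right factor \<open>e\<close> to the left.\<close>
      have "norm ((Y (Suc k) - Y k) * e) = norm (adj e * adj (Y (Suc k) - Y k))"
        by (metis adj_times norm_adj)
      also have "\<dots> \<le> s * norm (adj (Y (Suc k) - Y k))" by (rule bounded_byD[OF bounded_by_adj[OF e]])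
      finally show "norm ((Y (Suc k) - Y k) * e) \<le> s * norm (Y (Suc k) - Y k)" by (simp only: norm_adj)
      show "norm (d * (Y (Suc k) - Y k)) \<le> r * norm (Y (Suc k) - Y k)" by (rule bounded_byD[OF d])
    qed simp
    also have "\<dots> = q * norm (Y (Suc k) - Y k)" by (simp add: q_def field_simps)
    also have "\<dots> \<le> q * (norm (Y 1) * q ^ k)" using Suc q by (intro mult_left_mono) auto
    finally show ?case by (simp add: mult_ac)
  qed (simp add: Y0)
  have "summable (\<lambda>k. norm (Y 1) * q ^ k)" using q by (intro summable_mult summable_geometric) auto
  then obtain L where L: "supported n n L" "Y \<longlonglongrightarrow> L"
    using fmat_series_converges[of n Y "\<lambda>k. norm (Y 1) * q ^ k"] supY dY by blast
  have "(\<lambda>k. Y (Suc k)) \<longlonglongrightarrow> L" using L(2) by (rule LIMSEQ_Suc)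
  moreover have "(\<lambda>k. Y (Suc k)) \<longlonglongrightarrow> T L"
    unfolding YS T_def using L(2) by (intro tendsto_cscale tendsto_intros)
  ultimately have "L = T L" by (rule LIMSEQ_unique)
  then have "z *\<^sub>c L = z *\<^sub>c T L" by simp
  also have "\<dots> = m - d * L + L * e" using z0 by (simp add: T_def cscale_simps)
  finally have "z *\<^sub>c L + d * L - L * e = m" by simp
  with L(1) show ?thesis using bounded_by_limit[OF bY L(2)] that unfolding c_def by blast
qed

text \<open>A scalar shift is central in its own block, so the diagonal commutators survive it; off
  the diagonal it produces a Sylvester equation, solvable by the separation \<open>sep\<close>. The
  off-diagonal bound involves \<open>\<alpha>\<close> and \<open>\<delta>\<close> but not
  \<open>\<gamma>\<close>, and only \<open>\<gamma>\<close> will depend on \<open>K\<close>.\<close>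

lemma commutator_assembly:
  fixes p d c :: "nat \<Rightarrow> fmat"
  assumes K: "finite K" and pp: "\<And>k l. k \<in> K \<Longrightarrow> l \<in> K \<Longrightarrow> p k * p l = (if k = l then p k else 0)"
    and adj: "\<And>k. k \<in> K \<Longrightarrow> adj (p k) = p k"
    and psum: "(\<Sum>k\<in>K. p k) = corner_one n" and sp: "\<And>k. k \<in> K \<Longrightarrow> supported n n (p k)"
    and comm: "\<And>k. k \<in> K \<Longrightarrow> p k * a * p k = d k * c k - c k * d k"
    and d: "\<And>k. k \<in> K \<Longrightarrow> p k * d k = d k" "\<And>k. k \<in> K \<Longrightarrow> d k * p k = d k" "\<And>k. k \<in> K \<Longrightarrow> bounded_by (d k) (\<rho> k)"
    and c: "\<And>k. k \<in> K \<Longrightarrow> p k * c k = c k" "\<And>k. k \<in> K \<Longrightarrow> c k * p k = c k" "\<And>k. k \<in> K \<Longrightarrow> bounded_by (c k) \<gamma>"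
    and sep: "\<And>k l. k \<in> K \<Longrightarrow> l \<in> K \<Longrightarrow> k \<noteq> l \<Longrightarrow> \<rho> k + \<rho> l + \<delta> \<le> cmod (z k - z l)"
    and \<delta>: "\<delta> > 0" and R: "\<And>k. k \<in> K \<Longrightarrow> \<rho> k + cmod (z k) \<le> R" "0 \<le> R" and \<gamma>: "0 \<le> \<gamma>"
    and a: "supported n n a" "bounded_by a \<alpha>"
  obtains b e where "supported n n b" "supported n n e" "a = b * e - e * b" "bounded_by b R"
    "bounded_by e (\<gamma> + (real (card K))\<^sup>2 * (\<alpha> / \<delta>))"
proof -
  have sd': "supported n n w" if "k \<in> K" "p k * w = w" "w * p k = w" for k w
  proof -
    obtain N where "supported N N w" using ex_supported by blast
    then have "supported n n (p k * (w * p k))"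
      by (rule supported_times[OF sp[OF that(1)] supported_times[OF _ sp[OF that(1)]]])
    then show ?thesis using that by simp
  qed
  have sd: "supported n n (d k)" "supported n n (c k)" if "k \<in> K" for k
    using sd' that c d by blast+
  have p1: "bounded_by (p k) 1" if "k \<in> K" for k
    using bounded_by_projection adj pp that by auto
  have \<alpha>: "0 \<le> \<alpha>" using a bounded_by_nonneg by auto
  define X where "X = (\<lambda>k l x. p k * x = x \<and> x * p l = x \<and> (z k - z l) *\<^sub>c x + d k * x - x * d l = p k * a * p l
      \<and> supported n n x \<and> bounded_by x (\<alpha> / \<delta>))"
  have ex: "\<exists>x. X k l x" if kl: "k \<in> K" "l \<in> K" "k \<noteq> l" for k l
  proof -
    have "supported n n (p k * a * p l)"
      by (rule supported_times[OF supported_times[OF sp[OF kl(1)] a(1)] sp[OF kl(2)]])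
    moreover have "bounded_by (p k * a * p l) (1 * \<alpha> * 1)" by (intro bounded_by_mult p1 kl a)
    moreover have "\<rho> k + \<rho> l < cmod (z k - z l)" using sep[OF kl] \<delta> by simp
    ultimately obtain y where y: "supported n n y" "(z k - z l) *\<^sub>c y + d k * y - y * d l = p k * a * p l"
       "bounded_by y (1 * \<alpha> * 1 / (cmod (z k - z l) - \<rho> k - \<rho> l))"
      by (rule sylvester_solution[OF sd(1)[OF kl(1)] sd(1)[OF kl(2)] _ d(3)[OF kl(1)] d(3)[OF kl(2)]])
    have pkk: "p k * p k = p k" "p l * p l = p l" using pp kl by auto
    have pk: "p k * (p k * w) = p k * w" "d k * (p k * w) = d k * w" "p k * (d k * w) = d k * w"
       "p l * (d l * w) = d l * w" "d l * (p l * w) = d l * w" "p l * (p l * w) = p l * w" for w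
      using pkk d kl by (simp_all flip: mult.assoc)
    \<comment> \<open>Cutting \<open>y\<close> down to the block preserves the equation, since
      \<open>d k\<close>, \<open>d l\<close> and the right-hand side already live there.\<close>
    define x where "x = p k * y * p l"
    have "(z k - z l) *\<^sub>c x + d k * x - x * d l = p k * ((z k - z l) *\<^sub>c y + d k * y - y * d l) * p l"
      by (simp add: x_def distrib_left distrib_right right_diff_distrib left_diff_distrib mult.assoc
          cscale_times_left cscale_times_right pk d kl)
    also have "\<dots> = p k * a * p l" unfolding y(2) by (simp add: mult.assoc pk pkk)
    finally have 1: "(z k - z l) *\<^sub>c x + d k * x - x * d l = p k * a * p l" .
    have "bounded_by x (1 * (1 * \<alpha> * 1 / (cmod (z k - z l) - \<rho> k - \<rho> l)) * 1)"
      unfolding x_def by (intro bounded_by_mult p1 kl y)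
    moreover have "1 * (1 * \<alpha> * 1 / (cmod (z k - z l) - \<rho> k - \<rho> l)) * 1 \<le> \<alpha> / \<delta>"
    proof -
      have "\<alpha> / (cmod (z k - z l) - \<rho> k - \<rho> l) \<le> \<alpha> / \<delta>"
        by (rule divide_left_mono) (use \<alpha> \<delta> sep[OF kl] in \<open>auto intro!: mult_pos_pos\<close>)
      then show ?thesis by simp
    qed
    ultimately have "bounded_by x (\<alpha> / \<delta>)" by (rule bounded_by_mono)
    moreover have "supported n n x" unfolding x_def
      by (rule supported_times[OF supported_times[OF sp[OF kl(1)] y(1)] sp[OF kl(2)]])
    moreover have "p k * x = x" "x * p l = x" by (simp_all add: x_def mult.assoc pk pkk)
    ultimately show ?thesis unfolding X_def using 1 by blast
  qed
  define x where "x = (\<lambda>k l. SOME x. X k l x)"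
  have x: "p k * x k l = x k l \<and> x k l * p l = x k l \<and>
      (z k - z l) *\<^sub>c x k l + d k * x k l - x k l * d l = p k * a * p l
      \<and> supported n n (x k l) \<and> bounded_by (x k l) (\<alpha> / \<delta>)" if "k \<in> K" "l \<in> K" "k \<noteq> l" for k l
    using someI_ex[OF ex[OF that]] unfolding x_def X_def .
  \<comment> \<open>For \<open>k = l\<close> the shifts cancel and the Sylvester equation becomes
    the commutator equation, so \<open>c k\<close> serves as its solution.\<close>
  define y where "y = (\<lambda>k l. if k = l then c k else x k l)"
  have y: "p k * y k l = y k l" "y k l * p l = y k l" "supported n n (y k l)"
     "(z k - z l) *\<^sub>c y k l + d k * y k l - y k l * d l = p k * a * p l" if "k \<in> K" "l \<in> K" for k l
  proof -
    have "p k * y k l = y k l \<and> y k l * p l = y k l \<and> supported n n (y k l) \<and>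
     (z k - z l) *\<^sub>c y k l + d k * y k l - y k l * d l = p k * a * p l"
    proof (cases "k = l")
      case True
      have "(z k - z l) *\<^sub>c c k + d k * c k - c k * d l = p k * a * p l"
        unfolding True[symmetric] comm[OF that(1)] by (simp add: cscale_simps)
      then show ?thesis unfolding y_def if_P[OF True] using c(1,2)[OF that(1)] sd(2)[OF that(1)] True by metis
    next
      case False
      show ?thesis unfolding y_def if_not_P[OF False] using x[OF that False] by (elim conjE, intro conjI)
    qed
    then show "p k * y k l = y k l" "y k l * p l = y k l" "supported n n (y k l)"
     "(z k - z l) *\<^sub>c y k l + d k * y k l - y k l * d l = p k * a * p l"
      by (rule conjunct1, rule conjunct1[OF conjunct2], rule conjunct1[OF conjunct2[OF conjunct2]],
          rule conjunct2[OF conjunct2[OF conjunct2]])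
  qed
  define B where "B = (\<lambda>k. d k + z k *\<^sub>c p k)"
  define b where "b = (\<Sum>k\<in>K. B k)"
  define e where "e = (\<Sum>k\<in>K. \<Sum>l\<in>K. y k l)"
  have B: "p k * B k = B k" "B k * p k = B k" if "k \<in> K" for k
    using d[OF that] pp[OF that that] by (simp_all add: B_def algebra_simps cscale_times_left cscale_times_right)
  have Bky: "b * y k l = B k * y k l" if "k \<in> K" "l \<in> K" for k l
  proof -
    have "B j * y k l = (if j = k then B k * y k l else 0)" if "j \<in> K" for j
    proof -
      have "B j * y k l = B j * (p j * p k) * y k l"
        using B[OF that] y(1)[OF \<open>k \<in> K\<close> \<open>l \<in> K\<close>] by (simp add: mult.assoc) (simp flip: mult.assoc)
      then show ?thesis using pp[OF that \<open>k \<in> K\<close>] by auto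
    qed
    then have "b * y k l = (\<Sum>j\<in>K. if j = k then B k * y k l else 0)"
      unfolding b_def sum_distrib_right by (rule sum.cong[OF refl])
    then show ?thesis using K that(1) by simp
  qed
  have yb: "y k l * b = y k l * B l" if "k \<in> K" "l \<in> K" for k l
  proof -
    have "y k l * B j = (if j = l then y k l * B l else 0)" if "j \<in> K" for j
    proof -
      have "y k l * B j = y k l * (p l * p j) * B j"
        using B[OF that] y(2)[OF \<open>k \<in> K\<close> \<open>l \<in> K\<close>] by (simp add: mult.assoc) (simp flip: mult.assoc)
      then show ?thesis using pp[OF \<open>l \<in> K\<close> that] by auto
    qed
    then have "y k l * b = (\<Sum>j\<in>K. if j = l then y k l * B l else 0)"
      unfolding b_def sum_distrib_left by (rule sum.cong[OF refl])
    then show ?thesis using K that(2) by simp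
  qed
  have "b * e - e * b = (\<Sum>k\<in>K. \<Sum>l\<in>K. b * y k l - y k l * b)"
    by (simp add: e_def sum_distrib_left sum_distrib_right sum_subtractf)
  also have "\<dots> = (\<Sum>k\<in>K. \<Sum>l\<in>K. p k * a * p l)"
  proof (intro sum.cong refl)
    fix k l assume kl: "k \<in> K" "l \<in> K"
    have "b * y k l - y k l * b = (z k - z l) *\<^sub>c y k l + d k * y k l - y k l * d l"
      using y(1,2)[OF kl] by (simp add: Bky yb kl B_def algebra_simps cscale_times_left cscale_times_right cscale_simps)
    then show "b * y k l - y k l * b = p k * a * p l" using y(4)[OF kl] by simp
  qed
  also have "\<dots> = (\<Sum>k\<in>K. p k) * a * (\<Sum>k\<in>K. p k)"
    by (simp add: sum_distrib_left sum_distrib_right) (rule sum.swap)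
  also have "\<dots> = a" unfolding psum using a by (simp add: corner_one_times times_corner_one)
  finally have 1: "a = b * e - e * b" by simp
  have one: "bounded_by (\<Sum>k\<in>K. p k) 1"
    unfolding psum by (rule bounded_by_projection) (simp_all add: corner_one_times[OF supported_corner_one])
  have 2: "bounded_by b R"
    unfolding b_def
  proof (rule bounded_by_block_diagonal[OF K pp adj one B])
    fix k assume k: "k \<in> K"
    have "bounded_by (B k) (\<rho> k + cmod (z k) * 1)"
      unfolding B_def by (intro bounded_by_add bounded_by_cscale d p1 k)
    then show "bounded_by (B k) R" by (rule bounded_by_mono) (use R k in simp)
  qed (use R in auto)
  have "bounded_by (\<Sum>k\<in>K. c k) \<gamma>"
    by (rule bounded_by_block_diagonal[OF K pp adj one c \<gamma>])
  \<comment> \<open>Off the diagonal a plain triangle inequality over all pairs is used; the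
    diagonal keeps its sharp bound \<open>\<gamma>\<close>.\<close>
  moreover have "bounded_by (\<Sum>k\<in>K. \<Sum>l\<in>K. if k = l then 0 else x k l) (\<Sum>k\<in>K. \<Sum>l\<in>K. \<alpha> / \<delta>)"
    using x \<alpha> \<delta> by (intro bounded_by_sum) (auto intro: bounded_by_zero)
  ultimately have "bounded_by ((\<Sum>k\<in>K. c k) + (\<Sum>k\<in>K. \<Sum>l\<in>K. if k = l then 0 else x k l)) (\<gamma> + (\<Sum>k\<in>K. \<Sum>l\<in>K. \<alpha> / \<delta>))"
    by (rule bounded_by_add)
  moreover have "(\<Sum>k\<in>K. c k) + (\<Sum>k\<in>K. \<Sum>l\<in>K. if k = l then 0 else x k l) = e"
  proof -
    have "(\<Sum>l\<in>K. y k l) = c k + (\<Sum>l\<in>K. if k = l then 0 else x k l)" if "k \<in> K" for k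
    proof -
      have "(\<Sum>l\<in>K. y k l) = (\<Sum>l\<in>K. (if k = l then c k else 0) + (if k = l then 0 else x k l))"
        by (intro sum.cong) (auto simp: y_def)
      then show ?thesis using K that by (simp add: sum.distrib)
    qed
    then show ?thesis by (simp add: e_def sum.distrib)
  qed
  moreover have "(\<Sum>k\<in>K. \<Sum>l\<in>K. \<alpha> / \<delta>) = (real (card K))\<^sup>2 * (\<alpha> / \<delta>)" by (simp add: power2_eq_square)
  ultimately have 3: "bounded_by e (\<gamma> + (real (card K))\<^sup>2 * (\<alpha> / \<delta>))" by metis
  have "supported n n b" "supported n n e"
    unfolding b_def e_def B_def using sd sp y(3)
    by (auto intro!: supported_sum supported_plus supported_cscale)
  then show ?thesis using that 1 2 3 by blast
qed

section \<open>Orthonormal families and their projections\<close>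

lemma adj_times_vectors:
  assumes "supported n 1 x" "supported n 1 y"
  shows "adj y * x = ip x y *\<^sub>c corner_one 1"
proof (rule fmat_eqI)
  fix i j
  have "supported 1 1 (adj y * x)" by (rule supported_times[OF supported_adj[OF assms(2)] assms(1)])
  then show "entry (adj y * x) i j = entry (ip x y *\<^sub>c corner_one 1) i j"
    using tr_eq[of 1 1 "adj y * x"] by (cases i; cases j) (auto simp: ip_def supported_def)
qed

lemma outer_times_outer:
  assumes "supported n 1 w" "supported n 1 x" "supported n 1 y"
  shows "w * adj y * (x * u) = ip x y *\<^sub>c (w * u)"
proof -
  have "w * adj y * (x * u) = w * (adj y * x) * u" by (simp add: mult.assoc)
  also have "\<dots> = ip x y *\<^sub>c (w * corner_one 1 * u)"
    unfolding adj_times_vectors[OF assms(2,3)] by (simp add: cscale_times_left cscale_times_right)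
  finally show ?thesis using assms(1) by (simp add: times_corner_one)
qed

text \<open>Composing through the orthonormal family \<open>w\<close> leaves only matching indices.
  With adjoints in place of \<open>u\<close> this yields both the idempotence of projections and the
  range projection of a partial isometry.\<close>

lemma family_outer_times:
  fixes m :: nat
  assumes v: "\<And>i. i < m \<Longrightarrow> supported n 1 (v i)"
    and w: "\<And>i. i < m \<Longrightarrow> supported n 1 (w i)" "\<And>i j. i < m \<Longrightarrow> j < m \<Longrightarrow> ip (w i) (w j) = (if i = j then 1 else 0)"
  shows "(\<Sum>i<m. v i * adj (w i)) * (\<Sum>i<m. w i * u i) = (\<Sum>i<m. v i * u i)"
proof -
  have "(\<Sum>i<m. v i * adj (w i)) * (\<Sum>i<m. w i * u i) = (\<Sum>i<m. \<Sum>j<m. v i * adj (w i) * (w j * u j))"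
    unfolding sum_distrib_right sum_distrib_left by (rule sum.swap)
  also have "\<dots> = (\<Sum>i<m. \<Sum>j<m. if j = i then v i * u i else 0)"
    using assms by (intro sum.cong refl) (simp add: outer_times_outer[of n] cscale_simps)
  also have "\<dots> = (\<Sum>i<m. v i * u i)" by (intro sum.cong refl) simp
  finally show ?thesis .
qed

lemma family_projection:
  fixes m :: nat
  assumes v: "\<And>i. i < m \<Longrightarrow> supported n 1 (v i)" "\<And>i j. i < m \<Longrightarrow> j < m \<Longrightarrow> ip (v i) (v j) = (if i = j then 1 else 0)"
  defines "p \<equiv> \<Sum>i<m. v i * adj (v i)"
  shows "adj p = p" "p * p = p" "supported n n p"
proof -
  show "adj p = p" by (simp add: p_def adj_sum)
  show "p * p = p" unfolding p_def by (rule family_outer_times[OF v(1) v])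
  show "supported n n p" unfolding p_def
    by (rule supported_sum) (use v(1) in \<open>auto intro: supported_times[OF _ supported_adj]\<close>)
qed

lemma family_projections_orthogonal:
  fixes m l :: nat
  assumes "\<And>i. i < m \<Longrightarrow> supported n 1 (v i)" "\<And>j. j < l \<Longrightarrow> supported n 1 (w j)"
    and "\<And>i j. i < m \<Longrightarrow> j < l \<Longrightarrow> ip (v i) (w j) = 0"
  shows "(\<Sum>i<m. v i * adj (v i)) * (\<Sum>j<l. w j * adj (w j)) = 0"
proof -
  have "v i * adj (v i) * (w j * adj (w j)) = 0" if "i < m" "j < l" for i j
  proof -
    have "ip (w j) (v i) = 0" using assms(3)[OF that] ip_eq_0_commute by blast
    then show ?thesis using outer_times_outer[OF assms(1)[OF that(1)] assms(2)[OF that(2)] assms(1)[OF that(1)]]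
      by (simp add: cscale_simps)
  qed
  then show ?thesis unfolding sum_distrib_right sum_distrib_left by (intro sum.neutral ballI) simp
qed

text \<open>The matrix with columns \<open>v i\<close> identifies the span of the family with
  \<open>m\<close>-dimensional space; through it a block of \<open>a\<close> becomes a genuine
  \<open>m\<close> by \<open>m\<close> matrix, to which the hypothesis on smaller sizes
  applies.\<close>

lemma family_isometry:
  assumes v: "\<And>i. i < m \<Longrightarrow> supported n 1 (v i)" "\<And>i j. i < m \<Longrightarrow> j < m \<Longrightarrow> ip (v i) (v j) = (if i = j then 1 else 0)"
  obtains w where "supported n m w" "adj w * w = corner_one m" "w * adj w = (\<Sum>i<m. v i * adj (v i))"
proof -
  define w where "w = Fmat (\<lambda>i j. if j < m \<and> i < n then entry (v j) i 0 else 0)"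
  have ew: "entry w i j = (if j < m \<and> i < n then entry (v j) i 0 else 0)" for i j
    unfolding w_def by (subst entry_Fmat[of "max m n"]) auto
  have sw: "supported n m w" by (auto simp: supported_def ew)
  show ?thesis
  proof (rule that[OF sw])
    show "adj w * w = corner_one m"
    proof (rule fmat_eqI)
      fix i j
      have "entry (adj w * w) i j = (\<Sum>k<n. cnj (entry w k i) * entry w k j)"
        using sw by (subst entry_times[of m n]) (auto intro: supported_adj)
      also have "\<dots> = entry (corner_one m) i j"
      proof (cases "i < m \<and> j < m")
        case True
        have "ip (v j) (v i) = (\<Sum>k<n. entry (v j) k 0 * cnj (entry (v i) k 0))"
          using v(1) True by (simp add: ip_eq[of n 1])
        then show ?thesis using True v(2)[of j i] by (auto simp: ew mult.commute)
      qed (auto simp: ew)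
      finally show "entry (adj w * w) i j = entry (corner_one m) i j" .
    qed
    show "w * adj w = (\<Sum>i<m. v i * adj (v i))"
    proof (rule fmat_eqI)
      fix i j
      have "entry (v k * adj (v k)) i j = entry (v k) i 0 * cnj (entry (v k) j 0)" if "k < m" for k
        using v(1)[OF that] by (subst entry_times[of n 1]) auto
      moreover have "entry (v k) i 0 = (if i < n then entry (v k) i 0 else 0)" if "k < m" for k i
        using v(1)[OF that] by (auto simp: supported_def)
      ultimately show "entry (w * adj w) i j = entry (\<Sum>i<m. v i * adj (v i)) i j"
        using sw unfolding entry_sum
        by (subst entry_times[of n m]) (auto simp: ew intro!: sum.cong)
    qed
  qed
qed

lemma orthonormal_append_commute: "orthonormal (xs @ ys) \<longleftrightarrow> orthonormal (ys @ xs)"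
  unfolding orthonormal_append using ip_eq_0_commute by blast

text \<open>Gram-Schmidt. That the span contains \<open>ys\<close> is stated dually, by
  orthogonality, because this is how the kernels of \<open>f\<close> and \<open>adj f\<close> are
  described later.\<close>

lemma orthonormal_extend_span:
  assumes "orthonormal qs" "\<And>q. q \<in> set qs \<Longrightarrow> supported n 1 q" "\<And>y. y \<in> set ys \<Longrightarrow> supported n 1 y"
  obtains hs where "orthonormal (qs @ hs)" "\<forall>h\<in>set hs. supported n 1 h" "length hs \<le> length ys"
    "\<forall>x. (\<forall>z\<in>set (qs @ hs). ip x z = 0) \<longrightarrow> (\<forall>y\<in>set ys. ip x y = 0)"
proof -
  have "\<exists>hs. orthonormal (hs @ qs) \<and> (\<forall>h\<in>set hs. supported n 1 h) \<and> length hs \<le> length ys \<and>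
    (\<forall>x. (\<forall>z\<in>set (hs @ qs). ip x z = 0) \<longrightarrow> (\<forall>y\<in>set ys. ip x y = 0))"
    using assms(3)
  proof (induction ys)
    case Nil
    then show ?case using assms(1) by (intro exI[of _ "[]"]) simp
  next
    case (Cons y ys)
    then obtain hs where hs: "orthonormal (hs @ qs)" "\<forall>h\<in>set hs. supported n 1 h" "length hs \<le> length ys"
      "\<And>x. (\<forall>z\<in>set (hs @ qs). ip x z = 0) \<Longrightarrow> (\<forall>y\<in>set ys. ip x y = 0)" by auto
    define zs where "zs = hs @ qs"
    define e where "e = y - (\<Sum>i<length zs. ip y (zs ! i) *\<^sub>c zs ! i)"
    have zs: "supported n 1 (zs ! i)" if "i < length zs" for i
      using nth_mem[OF that] hs(2) assms(2) by (auto simp: zs_def)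
    have se: "supported n 1 e" unfolding e_def using Cons.prems zs
      by (intro supported_minus supported_sum supported_cscale) auto
    have oe: "ip e z = 0" if z: "z \<in> set zs" for z
    proof -
      obtain j where j: "j < length zs" "z = zs ! j" using z by (auto simp: in_set_conv_nth)
      have "(\<Sum>i<length zs. ip y (zs ! i) * ip (zs ! i) (zs ! j)) = (\<Sum>i<length zs. if i = j then ip y (zs ! j) else 0)"
        using hs(1) j by (intro sum.cong) (auto simp: orthonormal_nth zs_def[symmetric])
      then show ?thesis using j by (simp add: e_def ip_simps ip_sum_left)
    qed
    have span: "ip x y = ip x e" if "\<forall>z\<in>set zs. ip x z = 0" for x
      using that by (simp add: e_def ip_simps ip_sum_right)
    show ?case
    proof (cases "e = 0")
      case True
      then have "ip x y = 0" if "\<forall>z\<in>set zs. ip x z = 0" for x using span[OF that] by (simp add: ip_simps)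
      then show ?thesis using hs zs_def by (intro exI[of _ hs]) auto
    next
      case False
      define h where "h = of_real (1 / norm e) *\<^sub>c e"
      have "ip h h = 1" unfolding h_def by (rule ip_normalize[OF False])
      moreover have "ip h z = 0" if "z \<in> set zs" for z using oe[OF that] by (simp add: h_def ip_simps)
      moreover have "supported n 1 h" unfolding h_def by (rule supported_cscale[OF se])
      moreover have "ip x y = 0" if "\<forall>z\<in>set zs. ip x z = 0" "ip x h = 0" for x
        using span[OF that(1)] that(2) False by (simp add: h_def ip_simps)
      ultimately show ?thesis using hs zs_def by (intro exI[of _ "h # hs"]) auto
    qed
  qed
  then obtain hs where hs: "orthonormal (hs @ qs)" "\<forall>h\<in>set hs. supported n 1 h" "length hs \<le> length ys"
    "\<forall>x. (\<forall>z\<in>set (hs @ qs). ip x z = 0) \<longrightarrow> (\<forall>y\<in>set ys. ip x y = 0)" by blast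
  have on: "orthonormal (qs @ hs)" using hs(1) by (simp add: orthonormal_append_commute)
  show ?thesis by (rule that[OF on]) (use hs in auto)
qed

text \<open>The vectors are chosen one at a time. Orthogonality to images under both
  \<open>a\<close> and \<open>adj a\<close> kills the matrix entries in both directions, and the
  size hypothesis bounds the number of linear conditions on each choice.\<close>

lemma orthonormal_extend_separated:
  assumes "orthonormal zs" "\<And>z. z \<in> set zs \<Longrightarrow> supported n 1 z" "set hs \<subseteq> set zs" "supported n n a"
    and "length zs + 2 * length hs + 3 * t \<le> n"
  obtains gs where "length gs = t" "orthonormal (zs @ gs)" "\<forall>g\<in>set gs. supported n 1 g"
    "\<forall>g\<in>set gs. \<forall>h\<in>set hs. ip (a * g) h = 0 \<and> ip (a * h) g = 0"
    "\<forall>i<t. \<forall>j<t. i \<noteq> j \<longrightarrow> ip (a * gs ! i) (gs ! j) = 0"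
proof -
  have "\<exists>gs. length gs = t \<and> orthonormal (gs @ zs) \<and> (\<forall>g\<in>set gs. supported n 1 g) \<and>
    (\<forall>g\<in>set gs. \<forall>h\<in>set hs. ip (a * g) h = 0 \<and> ip (a * h) g = 0) \<and>
    (\<forall>i<t. \<forall>j<t. i \<noteq> j \<longrightarrow> ip (a * gs ! i) (gs ! j) = 0)"
    using assms(5)
  proof (induction t)
    case 0
    then show ?case using assms(1) by (intro exI[of _ "[]"]) auto
  next
    case (Suc t)
    then obtain gs where gs: "length gs = t" "orthonormal (gs @ zs)" "\<forall>g\<in>set gs. supported n 1 g"
      "\<forall>g\<in>set gs. \<forall>h\<in>set hs. ip (a * g) h = 0 \<and> ip (a * h) g = 0"
      "\<forall>i<t. \<forall>j<t. i \<noteq> j \<longrightarrow> ip (a * gs ! i) (gs ! j) = 0" by auto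
    define us where "us = hs @ gs"
    \<comment> \<open>With \<open>t\<close> vectors already chosen these are
      \<open>length zs + 2 * length hs + 3 * t\<close> conditions.\<close>
    define ws where "ws = gs @ zs @ map ((*) a) us @ map ((*) (adj a)) us"
    have us: "supported n 1 u" if "u \<in> set us" for u using that gs(3) assms(2,3) by (auto simp: us_def)
    have "length ws < n" using Suc.prems gs(1) by (simp add: ws_def us_def)
    moreover have "supported n 1 w" if w: "w \<in> set ws" for w
    proof -
      consider "w \<in> set gs" | "w \<in> set zs" | u where "u \<in> set us" "w = a * u" | u where "u \<in> set us" "w = adj a * u"
        using w by (auto simp: ws_def)
      then show ?thesis
      proof cases
        case 3
        then show ?thesis using supported_times[OF assms(4) us] by simp
      next
        case 4
        then show ?thesis using supported_times[OF supported_adj[OF assms(4)] us] by simp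
      qed (use gs(3) assms(2) in auto)
    qed
    ultimately obtain g where g: "supported n 1 g" "ip g g = 1" "\<And>w. w \<in> set ws \<Longrightarrow> ip g w = 0"
      using exists_unit_orthogonal[of ws n] by metis
    have gu: "ip (a * g) u = 0 \<and> ip (a * u) g = 0" if "u \<in> set us" for u
    proof -
      have "ip g (a * u) = 0" "ip g (adj a * u) = 0" using that by (auto intro!: g(3) simp: ws_def)
      then show ?thesis using ip_eq_0_commute ip_times_left by metis
    qed
    show ?case
    proof (intro exI[of _ "g # gs"] conjI)
      show "orthonormal ((g # gs) @ zs)" using gs(2) g by (auto simp: ws_def)
      show "\<forall>i<Suc t. \<forall>j<Suc t. i \<noteq> j \<longrightarrow> ip (a * (g # gs) ! i) ((g # gs) ! j) = 0"
      proof (intro allI impI)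
        fix i j assume ij: "i < Suc t" "j < Suc t" "i \<noteq> j"
        then show "ip (a * (g # gs) ! i) ((g # gs) ! j) = 0"
          using gs(1,5) gu by (cases i; cases j) (auto simp: us_def)
      qed
    qed (use gs g gu in \<open>auto simp: us_def\<close>)
  qed
  then obtain gs where gs: "length gs = t" "orthonormal (gs @ zs)" "\<forall>g\<in>set gs. supported n 1 g"
    "\<forall>g\<in>set gs. \<forall>h\<in>set hs. ip (a * g) h = 0 \<and> ip (a * h) g = 0"
    "\<forall>i<t. \<forall>j<t. i \<noteq> j \<longrightarrow> ip (a * gs ! i) (gs ! j) = 0" by blast
  have on: "orthonormal (zs @ gs)" using gs(2) by (simp add: orthonormal_append_commute)
  show ?thesis by (rule that[OF gs(1) on]) (use gs in auto)
qed

lemma orthonormal_complete: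
  assumes "orthonormal zs" "\<And>z. z \<in> set zs \<Longrightarrow> supported n 1 z" "length zs \<le> n"
  obtains rs where "orthonormal (zs @ rs)" "\<forall>r\<in>set rs. supported n 1 r" "length (zs @ rs) = n"
proof -
  have "\<exists>rs. orthonormal (rs @ zs) \<and> (\<forall>r\<in>set rs. supported n 1 r) \<and> length rs = t" if "length zs + t \<le> n" for t
    using that
  proof (induction t)
    case 0
    then show ?case using assms(1) by auto
  next
    case (Suc t)
    then obtain rs where rs: "orthonormal (rs @ zs)" "\<forall>r\<in>set rs. supported n 1 r" "length rs = t" by auto
    have "length (rs @ zs) < n" using Suc.prems rs by simp
    then obtain x where x: "supported n 1 x" "ip x x = 1" "\<And>z. z \<in> set (rs @ zs) \<Longrightarrow> ip x z = 0"
      using exists_unit_orthogonal[of "rs @ zs" n] rs(2) assms(2) by auto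
    then show ?case using rs by (intro exI[of _ "x # rs"]) auto
  qed
  from this[of "n - length zs"] assms(3) obtain rs where
    rs: "orthonormal (rs @ zs)" "\<forall>r\<in>set rs. supported n 1 r" "length rs = n - length zs" by auto
  have on: "orthonormal (zs @ rs)" using rs(1) by (simp add: orthonormal_append_commute)
  show ?thesis by (rule that[OF on]) (use rs assms(3) in auto)
qed

section \<open>Decomposition into four traceless blocks\<close>

lemma sum_lessThan_add_split: "(\<Sum>i<s + (t::nat). g i) = (\<Sum>i<s. g i) + (\<Sum>i<t. (g (s + i) :: 'a::comm_monoid_add))"
  by (induction t) (auto simp: add.assoc)

lemma sum_lessThan_mult_split: "(\<Sum>i<L * (s::nat). g i) = (\<Sum>l<L. \<Sum>i<s. (g (l * s + i) :: 'a::comm_monoid_add))"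
  by (induction L) (auto simp: sum_lessThan_add_split add.commute[of s])

lemma sum_list_nth_lessThan: "sum_list (map g xs) = (\<Sum>i<length xs. g (xs ! i) :: 'a::comm_monoid_add)"
  by (simp add: sum_list_sum_nth lessThan_atLeast0)

text \<open>A Hadamard matrix of order 4. Its constant first column will multiply the vectors
  \<open>h\<close>, so every block contains them with the same sign; entries of modulus 1 will give
  all blocks the same diagonal values.\<close>

definition hadamard :: "nat \<Rightarrow> nat \<Rightarrow> complex" where
  "hadamard k l = [[1, 1, 1, 1], [1, -1, 1, -1], [1, 1, -1, -1], [1, -1, -1, 1]] ! k ! l"

lemma less_4_cases: "(k::nat) < 4 \<Longrightarrow> (k = 0 \<Longrightarrow> P) \<Longrightarrow> (k = 1 \<Longrightarrow> P) \<Longrightarrow> (k = 2 \<Longrightarrow> P) \<Longrightarrow> (k = 3 \<Longrightarrow> P) \<Longrightarrow> P"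
  by linarith

lemma sum_lessThan_4: "(\<Sum>l<4. g (l::nat)) = g 0 + g 1 + g 2 + (g 3 :: 'a::comm_monoid_add)"
  by (simp add: eval_nat_numeral add.assoc)

lemma hadamard_first: "k < 4 \<Longrightarrow> hadamard k 0 = 1"
  by (erule less_4_cases) (simp_all add: hadamard_def)

lemma hadamard_square: "k < 4 \<Longrightarrow> l < 4 \<Longrightarrow> hadamard k l * cnj (hadamard k l) = 1"
  by (erule less_4_cases; erule less_4_cases) (simp_all add: hadamard_def eval_nat_numeral)

lemma hadamard_rows:
  "k < 4 \<Longrightarrow> k' < 4 \<Longrightarrow> (\<Sum>l<4. hadamard k l * cnj (hadamard k' l)) = (if k = k' then 4 else 0)"
  unfolding sum_lessThan_4
  by (erule less_4_cases; erule less_4_cases) (simp_all add: hadamard_def eval_nat_numeral)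

lemma hadamard_columns:
  "l < 4 \<Longrightarrow> l' < 4 \<Longrightarrow> (\<Sum>k<4. hadamard k l * cnj (hadamard k l')) = (if l = l' then 4 else 0)"
  unfolding sum_lessThan_4
  by (erule less_4_cases; erule less_4_cases) (simp_all add: hadamard_def eval_nat_numeral)

lemma ip_lincomb:
  "ip (\<Sum>l\<in>L. c l *\<^sub>c x l) (\<Sum>m\<in>M. d m *\<^sub>c y m) = (\<Sum>l\<in>L. \<Sum>m\<in>M. c l * cnj (d m) * ip (x l) (y m))"
  unfolding ip_sum_left by (simp add: ip_sum_right ip_simps sum_distrib_left mult_ac)

lemma outer_lincomb:
  "(\<Sum>l\<in>L. c l *\<^sub>c x l) * adj (\<Sum>m\<in>M. d m *\<^sub>c y m) = (\<Sum>l\<in>L. \<Sum>m\<in>M. (c l * cnj (d m)) *\<^sub>c (x l * adj (y m)))"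
  unfolding sum_distrib_right
  by (simp add: adj_sum sum_distrib_left cscale_times_left cscale_times_right cscale_sum cscale_simps mult.commute)

text \<open>Row 0 of \<open>X\<close> will hold the vectors \<open>h\<close>, rows 1 to 3 their
  companions \<open>g\<close>. The factor 1/2 makes the mixing unitary.\<close>

definition quad :: "(nat \<Rightarrow> nat \<Rightarrow> fmat) \<Rightarrow> nat \<Rightarrow> nat \<Rightarrow> fmat" where
  "quad X k i = (1 / 2) *\<^sub>c (\<Sum>l<4. hadamard k l *\<^sub>c X l i)"

lemma quad_orthonormal:
  assumes X: "\<And>l l'. l < 4 \<Longrightarrow> l' < 4 \<Longrightarrow> ip (X l i) (X l' i') = (if l = l' \<and> i = i' then 1 else 0)"
    and k: "k < 4" "k' < 4"
  shows "ip (quad X k i) (quad X k' i') = (if k = k' \<and> i = i' then 1 else 0)"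
proof -
  have "ip (quad X k i) (quad X k' i') =
     1 / 4 * (\<Sum>l<4. \<Sum>m<4. hadamard k l * cnj (hadamard k' m) * ip (X l i) (X m i'))"
    unfolding quad_def ip_simps(5,6) ip_lincomb by simp
  also have "(\<Sum>l<4. \<Sum>m<4. hadamard k l * cnj (hadamard k' m) * ip (X l i) (X m i')) =
     (\<Sum>l<4. \<Sum>m<4. if m = l then (if i = i' then hadamard k l * cnj (hadamard k' l) else 0) else 0)"
    by (intro sum.cong refl) (auto simp: X)
  also have "\<dots> = (if i = i' then (if k = k' then 4 else 0) else 0)"
    using hadamard_rows[OF k] by simp
  finally show ?thesis by (cases "i = i'"; cases "k = k'") simp_all
qed

text \<open>Separation removes the cross terms, and unimodular coefficients make the remaining
  average independent of \<open>k\<close>.\<close>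

lemma quad_diagonal:
  assumes X: "\<And>l l'. l < 4 \<Longrightarrow> l' < 4 \<Longrightarrow> l \<noteq> l' \<Longrightarrow> ip (a * X l i) (X l' i) = 0"
    and k: "k < 4"
  shows "ip (a * quad X k i) (quad X k i) = 1 / 4 * (\<Sum>l<4. ip (a * X l i) (X l i))"
proof -
  have a: "a * (\<Sum>l<4. hadamard k l *\<^sub>c X l i) = (\<Sum>l<4. hadamard k l *\<^sub>c (a * X l i))"
    by (simp add: sum_distrib_left cscale_times_right)
  have "ip (a * quad X k i) (quad X k i) =
     1 / 4 * (\<Sum>l<4. \<Sum>m<4. hadamard k l * cnj (hadamard k m) * ip (a * X l i) (X m i))"
    unfolding quad_def cscale_times_right ip_simps(5,6) a ip_lincomb by simp
  also have "(\<Sum>l<4. \<Sum>m<4. hadamard k l * cnj (hadamard k m) * ip (a * X l i) (X m i)) =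
     (\<Sum>l<4. \<Sum>m<4. if m = l then ip (a * X l i) (X l i) else 0)"
    using hadamard_square[OF k] by (intro sum.cong refl) (auto simp: X)
  finally show ?thesis by simp
qed

text \<open>The columns of the Hadamard matrix are orthogonal too, so mixing does not change the
  projection onto the span.\<close>

lemma quad_outer_sum:
  "(\<Sum>k<4. quad X k i * adj (quad X k i)) = (\<Sum>l<4. X l i * adj (X l i))"
proof -
  have "(\<Sum>k<4. quad X k i * adj (quad X k i)) =
    (1 / 4) *\<^sub>c (\<Sum>k<4. \<Sum>l<4. \<Sum>m<4. (hadamard k l * cnj (hadamard k m)) *\<^sub>c (X l i * adj (X m i)))"
    unfolding quad_def adj_simps(4) cscale_times_left cscale_times_right outer_lincomb
    by (simp add: cscale_simps cscale_sum)
  also have "(\<Sum>k<4. \<Sum>l<4. \<Sum>m<4. (hadamard k l * cnj (hadamard k m)) *\<^sub>c (X l i * adj (X m i))) =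
     (\<Sum>l<4. \<Sum>k<4. \<Sum>m<4. (hadamard k l * cnj (hadamard k m)) *\<^sub>c (X l i * adj (X m i)))"
    by (rule sum.swap)
  also have "\<dots> = (\<Sum>l<4. \<Sum>m<4. \<Sum>k<4. (hadamard k l * cnj (hadamard k m)) *\<^sub>c (X l i * adj (X m i)))"
    by (intro sum.cong[OF refl] sum.swap)
  also have "\<dots> = (\<Sum>l<4. \<Sum>m<4. (\<Sum>k<4. hadamard k l * cnj (hadamard k m)) *\<^sub>c (X l i * adj (X m i)))"
  proof (intro sum.cong refl)
    fix l m
    show "(\<Sum>k<4. (hadamard k l * cnj (hadamard k m)) *\<^sub>c (X l i * adj (X m i))) =
        (\<Sum>k<4. hadamard k l * cnj (hadamard k m)) *\<^sub>c (X l i * adj (X m i))"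
      by (simp add: sum_lessThan_4 cscale_simps)
  qed
  also have "\<dots> = (\<Sum>l<4. \<Sum>m<4. if m = l then 4 *\<^sub>c (X l i * adj (X l i)) else 0)"
    by (intro sum.cong refl) (auto simp: hadamard_columns cscale_simps)
  also have "(1 / 4) *\<^sub>c \<dots> = (\<Sum>l<4. X l i * adj (X l i))"
    by (simp add: cscale_sum cscale_simps)
  finally show ?thesis .
qed

lemma quad_perp: "(\<And>l. l < 4 \<Longrightarrow> ip (X l i) z = 0) \<Longrightarrow> ip (quad X k i) z = 0"
  by (simp add: quad_def ip_simps ip_sum_left)

lemma supported_quad: "(\<And>l. l < 4 \<Longrightarrow> supported n m (X l i)) \<Longrightarrow> supported n m (quad X k i)"
  unfolding quad_def by (intro supported_cscale supported_sum) auto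

lemma times_quad:
  assumes "\<And>l. 0 < l \<Longrightarrow> l < 4 \<Longrightarrow> f * X l i = 0" "k < 4"
  shows "f * quad X k i = (1 / 2) *\<^sub>c (f * X 0 i)"
proof -
  have "f * quad X k i = (1 / 2) *\<^sub>c (\<Sum>l<4. hadamard k l *\<^sub>c (f * X l i))"
    by (simp add: quad_def cscale_times_right sum_distrib_left)
  also have "(\<Sum>l<4. hadamard k l *\<^sub>c (f * X l i)) = f * X 0 i"
    using assms by (simp add: sum_lessThan_4 cscale_simps hadamard_first)
  finally show ?thesis .
qed

text \<open>If \<open>f\<close> acts on the first \<open>s\<close> vectors of a family as half of its action on orthonormal
  vectors \<open>h\<close>, and kills the others, then the compression of \<open>f\<close> is \<open>T f T\<^sup>* / 4\<close> for the
  partial isometry \<open>T\<close> mapping \<open>h i\<close> to \<open>v i\<close>.\<close>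

lemma compression_quarter:
  fixes s m :: nat
  assumes v: "\<And>i. i < m \<Longrightarrow> supported n 1 (v i)" "\<And>i j. i < m \<Longrightarrow> j < m \<Longrightarrow> ip (v i) (v j) = (if i = j then 1 else 0)"
    and h: "\<And>i. i < s \<Longrightarrow> supported n 1 (h i)" "\<And>i j. i < s \<Longrightarrow> j < s \<Longrightarrow> ip (h i) (h j) = (if i = j then 1 else 0)"
    and sm: "s \<le> m"
    and f: "\<And>i. i < s \<Longrightarrow> f * v i = (1 / 2) *\<^sub>c (f * h i)" "\<And>i. i < s \<Longrightarrow> adj f * v i = (1 / 2) *\<^sub>c (adj f * h i)"
    and f0: "\<And>i. s \<le> i \<Longrightarrow> i < m \<Longrightarrow> f * v i = 0" "\<And>i. s \<le> i \<Longrightarrow> i < m \<Longrightarrow> adj f * v i = 0"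
    and b: "bounded_by f \<phi>"
  shows "bounded_by ((\<Sum>i<m. v i * adj (v i)) * f * (\<Sum>i<m. v i * adj (v i))) (\<phi> / 4)"
proof -
  define p where "p = (\<Sum>i<m. v i * adj (v i))"
  define T where "T = (\<Sum>i<s. v i * adj (h i))"
  have mst: "m = s + (m - s)" using sm by simp
  have half: "g * p = (1 / 2) *\<^sub>c (g * adj T)"
    if g: "\<And>i. i < s \<Longrightarrow> g * v i = (1 / 2) *\<^sub>c (g * h i)" "\<And>i. s \<le> i \<Longrightarrow> i < m \<Longrightarrow> g * v i = 0" for g
  proof -
    have "g * p = (\<Sum>i<s + (m - s). g * v i * adj (v i))"
      unfolding p_def sum_distrib_left using sm by (simp add: mult.assoc)
    also have "\<dots> = (\<Sum>i<s. (1 / 2) *\<^sub>c (g * h i * adj (v i)))"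
      unfolding sum_lessThan_add_split using g by (simp add: cscale_times_left)
    also have "\<dots> = (1 / 2) *\<^sub>c (g * adj T)"
      by (simp add: T_def adj_sum sum_distrib_left cscale_sum mult.assoc)
    finally show ?thesis .
  qed
  have fp: "f * p = (1 / 2) *\<^sub>c (f * adj T)" using half f f0 by blast
  have "adj (adj f * p) = adj ((1 / 2) *\<^sub>c (adj f * adj T))" using half f f0 by metis
  moreover have "adj p = p" by (simp add: p_def adj_sum)
  ultimately have pf: "p * f = (1 / 2) *\<^sub>c (T * f)" by simp
  have "p * f * p = (1 / 2) *\<^sub>c (p * f * adj T)" using fp by (simp add: mult.assoc cscale_times_right)
  then have eq: "p * f * p = (1 / 4) *\<^sub>c (T * f * adj T)" unfolding pf by (simp add: cscale_times_left cscale_simps)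
  have TT: "T * adj T = (\<Sum>i<s. v i * adj (v i))"
    unfolding T_def adj_sum adj_times adj_simps by (rule family_outer_times[where n = n]) (use v h sm in auto)
  have vs: "\<And>i. i < s \<Longrightarrow> supported n 1 (v i)" "\<And>i j. i < s \<Longrightarrow> j < s \<Longrightarrow> ip (v i) (v j) = (if i = j then 1 else 0)"
    using v sm by auto
  have "bounded_by (T * adj T) 1"
    unfolding TT by (rule bounded_by_projection) (rule family_projection[OF vs], assumption+)+
  then have T: "bounded_by T 1" by (rule bounded_by_partial_isometry)
  have "bounded_by ((1 / 4) *\<^sub>c (T * f * adj T)) (cmod (1 / 4) * (1 * \<phi> * 1))"
    by (intro bounded_by_cscale bounded_by_mult T b bounded_by_adj)
  then show ?thesis unfolding p_def[symmetric] eq by simp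
qed

section \<open>Arrangement of an orthonormal basis into seven blocks\<close>

lemma grid_index_eq:
  fixes s :: nat
  assumes "i < s" "i' < s"
  shows "l * s + i = l' * s + i' \<longleftrightarrow> l = l' \<and> i = i'"
proof
  assume e: "l * s + i = l' * s + i'"
  have "l = (l * s + i) div s" "l' = (l' * s + i') div s" "i = (l * s + i) mod s" "i' = (l' * s + i') mod s"
    using assms by auto
  then show "l = l' \<and> i = i'" using e by metis
qed auto

lemma grid_index_less:
  fixes s :: nat
  assumes "i < s" "l < L"
  shows "l * s + i < L * s"
proof -
  have "l * s + i < Suc l * s" using assms by simp
  also have "\<dots> \<le> L * s" using assms by (intro mult_le_mono1) simp
  finally show ?thesis .
qed

text \<open>Every orthonormal basis has diagonal sum \<open>tr a\<close>, here 0, which can be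
  spread evenly. The first few of these vectors become the one-dimensional traceless blocks that
  absorb \<open>n mod 4\<close>.\<close>

lemma zero_diagonal_basis:
  assumes "supported n n a" "tr a = 0"
  obtains zs where "orthonormal zs" "\<forall>z\<in>set zs. supported n 1 z" "length zs = n"
    "\<forall>z\<in>set zs. ip (a * z) z = 0"
proof -
  obtain es where es: "orthonormal ([] @ es)" "\<forall>z\<in>set es. supported n 1 z" "length ([] @ es) = n"
    by (rule orthonormal_complete[of "[]" n]) auto
  have on: "set es \<subseteq> {x. supported n 1 x}" "orthonormal es" using es by auto
  have "(\<Sum>x\<leftarrow>es. ip (a * x) x) = of_nat (length es) * 0"
    using orthonormal_basis_tr[of es n a] es assms by simp
  then obtain zs where zs: "set zs \<subseteq> {x. supported n 1 x}" "orthonormal zs" "length zs = length es"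
     "\<forall>z\<in>set zs. ip (a * z) z = 0"
    by (rule orthonormal_constant_diagonal[OF csubspace_vectors on])
  show ?thesis by (rule that[OF zs(2)]) (use zs es(3) in auto)
qed

text \<open>Blocks 0 to 3 are traceless because \<open>a\<close> has the same trace on each and
  total trace 0; blocks 4 to 6 hold at most one vector each. In the size hypothesis 3 pays for the
  split-off vectors \<open>qs\<close>, and 12 is 1 for \<open>hs\<close>, 2 for its images under
  \<open>a\<close> and \<open>adj a\<close>, and 9 for three companions with three conditions
  each.\<close>

lemma block_decomposition:
  assumes a: "supported n n a" "tr a = 0" and b: "bounded_by f \<phi>"
    and ys: "\<And>y. y \<in> set ys \<Longrightarrow> supported n 1 y"
    and kill: "\<And>x. supported n 1 x \<Longrightarrow> (\<And>y. y \<in> set ys \<Longrightarrow> ip x y = 0) \<Longrightarrow> f * x = 0 \<and> adj f * x = 0"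
    and n: "12 * length ys + 3 \<le> n"
  obtains m :: "nat \<Rightarrow> nat" and v :: "nat \<Rightarrow> nat \<Rightarrow> fmat" where
    "\<And>k i. k < 7 \<Longrightarrow> i < m k \<Longrightarrow> supported n 1 (v k i)"
    "\<And>k l i j. k < 7 \<Longrightarrow> l < 7 \<Longrightarrow> i < m k \<Longrightarrow> j < m l \<Longrightarrow> ip (v k i) (v l j) = (if k = l \<and> i = j then 1 else 0)"
    "(\<Sum>k<7. \<Sum>i<m k. v k i * adj (v k i)) = corner_one n"
    "\<And>k. k < 7 \<Longrightarrow> (\<Sum>i<m k. ip (a * v k i) (v k i)) = 0"
    "\<And>k. k < 7 \<Longrightarrow> m k < n"
    "\<And>k. k < 4 \<Longrightarrow> bounded_by ((\<Sum>i<m k. v k i * adj (v k i)) * f * (\<Sum>i<m k. v k i * adj (v k i))) (\<phi> / 4)"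
    "\<And>k. 4 \<le> k \<Longrightarrow> m k \<le> 1"
proof -
  define j where "j = n mod 4"
  define n4 where "n4 = n div 4"
  have nj: "n = 4 * n4 + j" "j < 4" by (simp_all add: j_def n4_def)
  obtain zs where zs: "orthonormal zs" "\<forall>z\<in>set zs. supported n 1 z" "length zs = n"
    "\<forall>z\<in>set zs. ip (a * z) z = 0"
    by (rule zero_diagonal_basis[OF a])
  define qs where "qs = take j zs"
  have "orthonormal (take j zs @ drop j zs)" using zs(1) by simp
  then have qs: "orthonormal qs" unfolding orthonormal_append qs_def by blast
  have qs: "orthonormal qs" "\<And>z. z \<in> set qs \<Longrightarrow> supported n 1 z" "length qs = j"
    "\<And>z. z \<in> set qs \<Longrightarrow> ip (a * z) z = 0"
    using qs zs nj by (auto simp: qs_def dest: in_set_takeD)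
  obtain hs where hs0: "orthonormal (qs @ hs)" "\<forall>h\<in>set hs. supported n 1 h" "length hs \<le> length ys"
    "\<forall>x. (\<forall>z\<in>set (qs @ hs). ip x z = 0) \<longrightarrow> (\<forall>y\<in>set ys. ip x y = 0)"
    by (rule orthonormal_extend_span[OF qs(1,2) ys])
  note hs = hs0(1) hs0(2)[rule_format] hs0(3) hs0(4)[rule_format]
  define s where "s = length hs"
  have sn: "12 * s + 3 \<le> n" using hs(3) n by (simp add: s_def)
  have len: "length (qs @ hs) + 2 * length hs + 3 * (3 * s) \<le> n" using sn nj qs(3) by (simp add: s_def)
  have qhsup: "\<And>z. z \<in> set (qs @ hs) \<Longrightarrow> supported n 1 z" using qs(2) hs(2) by auto
  have hsub: "set hs \<subseteq> set (qs @ hs)" by auto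
  obtain gs where gs0: "length gs = 3 * s" "orthonormal ((qs @ hs) @ gs)" "\<forall>g\<in>set gs. supported n 1 g"
    "\<forall>g\<in>set gs. \<forall>h\<in>set hs. ip (a * g) h = 0 \<and> ip (a * h) g = 0"
    "\<forall>i<3 * s. \<forall>j<3 * s. i \<noteq> j \<longrightarrow> ip (a * gs ! i) (gs ! j) = 0"
    by (rule orthonormal_extend_separated[OF hs(1) qhsup hsub a(1) len])
  have gs: "length gs = 3 * s" "orthonormal ((qs @ hs) @ gs)" "\<And>g. g \<in> set gs \<Longrightarrow> supported n 1 g"
    "\<And>g h. g \<in> set gs \<Longrightarrow> h \<in> set hs \<Longrightarrow> ip (a * g) h = 0 \<and> ip (a * h) g = 0"
    "\<And>i j. i < 3 * s \<Longrightarrow> j < 3 * s \<Longrightarrow> i \<noteq> j \<Longrightarrow> ip (a * gs ! i) (gs ! j) = 0"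
    using gs0 by auto
  define xs where "xs = hs @ gs"
  have xs: "length xs = 4 * s" "\<And>x. x \<in> set xs \<Longrightarrow> supported n 1 x" "orthonormal (qs @ xs)"
    using hs gs by (auto simp: xs_def s_def)
  \<comment> \<open>Each of the first four blocks receives \<open>s\<close> Hadamard combinations
    and \<open>t\<close> vectors of the remaining space.\<close>
  define t where "t = n4 - s"
  have sn4: "s \<le> n4" "n4 = s + t" using sn nj by (auto simp: t_def)
  have qxsup: "\<And>z. z \<in> set (qs @ xs) \<Longrightarrow> supported n 1 z" using qs(2) xs(2) by auto
  have lqx: "length (qs @ xs) \<le> n" using nj sn4 qs(3) xs(1) by simp
  obtain rs0 where rs0: "orthonormal ((qs @ xs) @ rs0)" "\<forall>r\<in>set rs0. supported n 1 r"
      "length ((qs @ xs) @ rs0) = n"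
    by (rule orthonormal_complete[OF xs(3) qxsup lqx])
  have lrs0: "length rs0 = 4 * t" using rs0(3) nj sn4 qs(3) xs(1) by simp
  define S where "S = {x. supported n 1 x \<and> (\<forall>z\<in>set (qs @ xs). ip x z = 0)}"
  have S: "csubspace S"
    by (auto simp: csubspace_def S_def ip_simps intro!: supported_plus supported_cscale)
  \<comment> \<open>The mean of the diagonal; if no vectors remain, division by zero gives 0 and the
    equation for the sum still holds.\<close>
  define c where "c = (\<Sum>x\<leftarrow>rs0. ip (a * x) x) / of_nat (length rs0)"
  have rs0S: "set rs0 \<subseteq> S" "orthonormal rs0"
    using rs0(1,2) ip_eq_0_commute unfolding S_def orthonormal_append by blast+
  have rc: "(\<Sum>x\<leftarrow>rs0. ip (a * x) x) = of_nat (length rs0) * c" by (cases "rs0 = []") (auto simp: c_def)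
  obtain rs where rs': "set rs \<subseteq> S" "orthonormal rs" "length rs = length rs0" "\<forall>y\<in>set rs. ip (a * y) y = c"
    by (rule orthonormal_constant_diagonal[OF S rs0S rc])
  note rs = rs'(1-3) rs'(4)[rule_format]
  have lrs: "length rs = 4 * t" using rs lrs0 by simp
  have rsup: "\<And>r. r \<in> set rs \<Longrightarrow> supported n 1 r" using rs(1) by (auto simp: S_def)
  have rperp: "ip r z = 0 \<and> ip z r = 0" if "r \<in> set rs" "z \<in> set (qs @ xs)" for r z
    using that rs(1) ip_eq_0_commute[of r z] by (auto simp: S_def)
  have all1: "orthonormal ((qs @ xs) @ rs)"
    unfolding orthonormal_append[of "qs @ xs" rs] using rs(2) xs(3) rperp by blast
  have all: "length ((qs @ xs) @ rs) = n" "\<And>z. z \<in> set ((qs @ xs) @ rs) \<Longrightarrow> supported n 1 z"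
    using rs(3) rs0(3) rsup qxsup by auto
  have qxperp: "ip q x = 0 \<and> ip x q = 0" if "q \<in> set qs" "x \<in> set xs" for q x
    using xs(3) that ip_eq_0_commute[of q x] by (auto simp: orthonormal_append)

  define X where "X = (\<lambda>l i. xs ! (l * s + i))"
  have Xin: "X l i \<in> set xs" if "l < 4" "i < s" for l i
    using grid_index_less[OF that(2,1)] xs(1) by (simp add: X_def)
  have Xsup: "supported n 1 (X l i)" if "l < 4" "i < s" for l i
    by (rule xs(2)[OF Xin[OF that]])
  have onxs: "orthonormal xs" using xs(3) by (simp add: orthonormal_append)
  have Xon: "ip (X l i) (X l' i') = (if l = l' \<and> i = i' then 1 else 0)" if "l < 4" "l' < 4" "i < s" "i' < s" for l l' i i'
    unfolding X_def using that grid_index_less[of i s l 4] grid_index_less[of i' s l' 4] xs(1)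
    by (simp add: orthonormal_nth[OF onxs] grid_index_eq)
  have Xh: "X 0 i = hs ! i" if "i < s" for i using that by (simp add: X_def xs_def s_def nth_append)
  have Xg: "X l i = gs ! ((l - 1) * s + i) \<and> (l - 1) * s + i < 3 * s" if "0 < l" "l < 4" "i < s" for l i
  proof -
    have "l * s + i = s + ((l - 1) * s + i)" using that by (cases l) auto
    then have "X l i = gs ! ((l - 1) * s + i)" by (simp add: X_def xs_def s_def nth_append)
    moreover have "(l - 1) * s + i < 3 * s" using that by (intro grid_index_less) auto
    ultimately show ?thesis by simp
  qed
  have Xgin: "X l i \<in> set gs" if "0 < l" "l < 4" "i < s" for l i
    using Xg[OF that] gs(1) by auto
  have Xhin: "X 0 i \<in> set hs" if "i < s" for i using Xh[OF that] that by (simp add: s_def)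
  have Xsep: "ip (a * X l i) (X l' i) = 0" if "l < 4" "l' < 4" "l \<noteq> l'" "i < s" for l l' i
  proof (cases "l = 0 \<or> l' = 0")
    case True
    then show ?thesis using gs(4) Xgin Xhin that by (metis gr0I)
  next
    case False
    then have "(l - 1) * s + i \<noteq> (l' - 1) * s + i" using that grid_index_eq[of i s i "l - 1" "l' - 1"] by auto
    then show ?thesis using False gs(5) Xg that by simp
  qed
  \<comment> \<open>The companions are orthogonal to \<open>qs\<close> and \<open>hs\<close>, hence
    to \<open>ys\<close>.\<close>
  have gkill: "f * X l i = 0 \<and> adj f * X l i = 0" if "0 < l" "l < 4" "i < s" for l i
  proof (rule kill)
    show "supported n 1 (X l i)" using gs(3) Xgin that by blast
    fix y assume "y \<in> set ys"
    then show "ip (X l i) y = 0"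
    proof (rule hs(4)[rotated])
      fix z assume "z \<in> set (qs @ hs)"
      then show "ip (X l i) z = 0"
        using gs(2) Xgin[OF that] ip_eq_0_commute[of z] unfolding orthonormal_append[of "qs @ hs" gs] by blast
    qed
  qed
  have rkill: "f * r = 0 \<and> adj f * r = 0" if "r \<in> set rs" for r
  proof (rule kill[OF rsup[OF that]])
    fix y assume "y \<in> set ys"
    then show "ip r y = 0"
      by (rule hs(4)[rotated]) (use rperp[OF that] in \<open>auto simp: xs_def\<close>)
  qed

  \<comment> \<open>In blocks 0 to 3 the Hadamard combinations come first, then a run of
    \<open>t\<close> vectors from \<open>rs\<close>; the later blocks consist of single vectors of
    \<open>qs\<close>.\<close>
  define v where "v = (\<lambda>k i. if k < 4 then (if i < s then quad X k i else rs ! (k * t + (i - s))) else qs ! (k - 4))"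
  define m where "m = (\<lambda>k. if k < 4 then n4 else if k - 4 < j then 1 else 0)"
  have vq: "v k i \<in> set qs \<and> v k i = qs ! (k - 4) \<and> i = 0 \<and> k - 4 < j" if "4 \<le> k" "i < m k" for k i
    using that qs(3) by (auto simp: v_def m_def split: if_splits)
  have vr: "v k i \<in> set rs \<and> v k i = rs ! (k * t + (i - s)) \<and> i - s < t \<and> k * t + (i - s) < 4 * t"
    if "k < 4" "i < m k" "s \<le> i" for k i
  proof -
    have "i - s < t" using that sn4 by (auto simp: m_def)
    then have "k * t + (i - s) < 4 * t" using that by (intro grid_index_less)
    then show ?thesis using that lrs \<open>i - s < t\<close> by (auto simp: v_def)
  qed
  have vx: "v k i = quad X k i" if "k < 4" "i < s" for k i using that by (simp add: v_def)
  have qperp: "ip (quad X k i) z = 0 \<and> ip z (quad X k i) = 0" if "i < s" "z \<in> set qs \<union> set rs" for k i z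
  proof -
    have "ip (X l i) z = 0" if "l < 4" for l
      using qxperp rperp Xin[OF that \<open>i < s\<close>] \<open>z \<in> _\<close> by auto
    then have "ip (quad X k i) z = 0" by (rule quad_perp)
    then show ?thesis using ip_eq_0_commute by blast
  qed
  have qrperp: "ip q r = 0 \<and> ip r q = 0" if "q \<in> set qs" "r \<in> set rs" for q r using rperp that by auto
  have onqs: "orthonormal qs" and onrs: "orthonormal rs" using qs(1) rs(2) .
  have sup: "supported n 1 (v k i)" if "k < 7" "i < m k" for k i
  proof (cases "k < 4")
    case True
    then show ?thesis
      using rsup vr[OF True that(2)] vx[OF True] supported_quad[of n 1 X i k] Xsup by (cases "i < s") auto
  next
    case False
    then show ?thesis using vq[of k i] that qs(2) by auto
  qed
  have on: "ip (v k i) (v l i') = (if k = l \<and> i = i' then 1 else 0)" if "k < 7" "l < 7" "i < m k" "i' < m l" for k l i i'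
  proof -
    consider "k < 4" "l < 4" "i < s" "i' < s" | "k < 4" "l < 4" "i < s" "s \<le> i'"
      | "k < 4" "l < 4" "s \<le> i" "i' < s" | "k < 4" "l < 4" "s \<le> i" "s \<le> i'"
      | "k < 4" "4 \<le> l" | "4 \<le> k" "l < 4" | "4 \<le> k" "4 \<le> l" by linarith
    then show ?thesis
    proof cases
      case 1
      then show ?thesis using quad_orthonormal[of X i i' k l] Xon vx by simp
    next
      case 2
      then show ?thesis using vx[of k i] vr[of l i'] that qperp[of i "v l i'" k] by auto
    next
      case 3
      then show ?thesis using vx[of l i'] vr[of k i] that qperp[of i' "v k i" l] by auto
    next
      case 4
      then show ?thesis using vr[of k i] vr[of l i'] that lrs orthonormal_nth[OF onrs] grid_index_eq[of "i - s" t "i' - s" k l] by auto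
    next
      case 5
      then show ?thesis using vq[of l i'] vr[of k i] vx[of k i] that qperp[of i "v l i'" k] qrperp by (cases "i < s") auto
    next
      case 6
      then show ?thesis using vq[of k i] vr[of l i'] vx[of l i'] that qperp[of i' "v k i" l] qrperp by (cases "i' < s") auto
    next
      case 7
      then show ?thesis using vq[of k i] vq[of l i'] that qs(3) orthonormal_nth[OF onqs] by auto
    qed
  qed
  have split4: "(\<Sum>i<n4. g (v k i)) = (\<Sum>i<s. g (quad X k i)) + (\<Sum>i<t. g (rs ! (k * t + i)))" if "k < 4" for k and g :: "fmat \<Rightarrow> 'z::comm_monoid_add"
    unfolding sn4(2) sum_lessThan_add_split using that by (simp add: v_def)
  have sumxs: "sum_list (map g xs) = (\<Sum>i<s. \<Sum>l<4. g (X l i))" for g :: "fmat \<Rightarrow> 'z::comm_monoid_add"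
    unfolding sum_list_nth_lessThan xs(1) sum_lessThan_mult_split X_def by (rule sum.swap)
  have sumrs: "sum_list (map g rs) = (\<Sum>k<4. \<Sum>i<t. g (rs ! (k * t + i)))" for g :: "fmat \<Rightarrow> 'z::comm_monoid_add"
    unfolding sum_list_nth_lessThan lrs sum_lessThan_mult_split ..
  have complete: "(\<Sum>k<7. \<Sum>i<m k. v k i * adj (v k i)) = corner_one n"
  proof -
    define G where "G = (\<lambda>x. x * adj x)"
    have "(\<Sum>k<4 + 3. \<Sum>i<m k. G (v k i)) = (\<Sum>k<4. \<Sum>i<n4. G (v k i)) + (\<Sum>k<3. \<Sum>i<(if k < j then 1 else 0 :: nat). G (qs ! k))"
      unfolding sum_lessThan_add_split by (simp add: m_def v_def)
    also have "(\<Sum>k<3. \<Sum>i<(if k < j then 1 else 0 :: nat). G (qs ! k)) = (\<Sum>k<3. if k < j then G (qs ! k) else 0)"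
      by (intro sum.cong) auto
    also have "\<dots> = (\<Sum>k<j. G (qs ! k))"
      using nj(2) by (intro sum.mono_neutral_cong_right) auto
    also have "\<dots> = sum_list (map G qs)" by (simp add: sum_list_nth_lessThan qs(3))
    also have "(\<Sum>k<4. \<Sum>i<n4. G (v k i)) = (\<Sum>k<4. \<Sum>i<s. G (quad X k i)) + sum_list (map G rs)"
      by (simp add: split4 sum.distrib sumrs)
    also have "(\<Sum>k<4. \<Sum>i<s. G (quad X k i)) = (\<Sum>i<s. \<Sum>k<4. G (quad X k i))" by (rule sum.swap)
    also have "\<dots> = sum_list (map G xs)" unfolding sumxs by (simp add: G_def quad_outer_sum)
    also have "sum_list (map G xs) + sum_list (map G rs) + sum_list (map G qs) = sum_list (map G ((qs @ xs) @ rs))"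
      by (simp add: add_ac)
    also have "\<dots> = corner_one n"
      unfolding G_def by (rule orthonormal_basis_sum[OF all1 all(2) all(1)])
    finally show ?thesis by (simp add: G_def)
  qed
  \<comment> \<open>The total trace and the diagonal on \<open>qs\<close> vanish, so the
    contributions of \<open>xs\<close> and \<open>rs\<close> cancel; each of the first four blocks
    carries a quarter of both.\<close>
  define d where "d = (\<lambda>x. ip (a * x) x)"
  have "sum_list (map d ((qs @ xs) @ rs)) = 0"
    unfolding d_def using orthonormal_basis_tr[OF all1 all(2) all(1) a(1)] a(2) by simp
  moreover have "sum_list (map d qs) = 0"
    using qs(4) by (auto simp: d_def sum_list_nth_lessThan intro!: sum.neutral)
  ultimately have dsum: "sum_list (map d xs) + sum_list (map d rs) = 0" by simp
  have drs: "sum_list (map d rs) = of_nat (4 * t) * c"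
    using rs(4) lrs by (simp add: d_def sum_list_nth_lessThan)
  have trace: "(\<Sum>i<m k. ip (a * v k i) (v k i)) = 0" if "k < 7" for k
  proof (cases "k < 4")
    case True
    have "(\<Sum>i<n4. d (v k i)) = (\<Sum>i<s. 1 / 4 * (\<Sum>l<4. d (X l i))) + (\<Sum>i<t. c)"
    proof -
      have "d (quad X k i) = 1 / 4 * (\<Sum>l<4. d (X l i))" if "i < s" for i
        unfolding d_def using Xsep that True by (intro quad_diagonal) auto
      moreover have "d (rs ! (k * t + i)) = c" if "i < t" for i
        unfolding d_def using grid_index_less[OF that True] lrs by (intro rs(4)) simp
      ultimately show ?thesis unfolding split4[OF True] by (intro arg_cong2[where f = "(+)"] sum.cong refl) auto
    qed
    also have "\<dots> = 1 / 4 * (sum_list (map d xs) + sum_list (map d rs))"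
      unfolding sumxs drs by (simp add: sum_distrib_left algebra_simps)
    finally show ?thesis using True dsum by (simp add: d_def m_def)
  next
    case False
    then have "ip (a * v k i) (v k i) = 0" if "i < m k" for i
      using conjunct1[OF vq[OF _ that]] by (intro qs(4)) simp
    then show ?thesis by (intro sum.neutral) auto
  qed
  have comp: "bounded_by ((\<Sum>i<m k. v k i * adj (v k i)) * f * (\<Sum>i<m k. v k i * adj (v k i))) (\<phi> / 4)" if k: "k < 4" for k
  proof (rule compression_quarter[where h = "X 0" and s = s])
    show "supported n 1 (v k i)" if "i < m k" for i using sup[of k i] k that by simp
    show "ip (v k i) (v k i') = (if i = i' then 1 else 0)" if "i < m k" "i' < m k" for i i'
      using on[of k k i i'] k that by simp
    show "supported n 1 (X 0 i)" if "i < s" for i using Xsup that by simp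
    show "ip (X 0 i) (X 0 i') = (if i = i' then 1 else 0)" if "i < s" "i' < s" for i i' using Xon that by simp
    show "s \<le> m k" using k sn4 by (simp add: m_def)
    show "f * v k i = (1 / 2) *\<^sub>c (f * X 0 i)" if "i < s" for i
      unfolding vx[OF k that] by (rule times_quad) (use gkill that k in auto)
    show "adj f * v k i = (1 / 2) *\<^sub>c (adj f * X 0 i)" if "i < s" for i
      unfolding vx[OF k that] by (rule times_quad) (use gkill that k in auto)
    show "f * v k i = 0" if "s \<le> i" "i < m k" for i using rkill[OF conjunct1[OF vr[OF k that(2,1)]]] by blast
    show "adj f * v k i = 0" if "s \<le> i" "i < m k" for i using rkill[OF conjunct1[OF vr[OF k that(2,1)]]] by blast
  qed (rule b)
  show ?thesis
  proof (rule that[of m v, OF sup on complete trace _ comp])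
    \<comment> \<open>Strict inequality is what gives access to the hypothesis on smaller
      matrices.\<close>
    show "m k < n" for k using nj sn by (auto simp: m_def)
    show "m k \<le> 1" if "4 \<le> k" for k using that by (auto simp: m_def)
  qed
qed

section \<open>Transfer to matrices with explicit dimensions\<close>

definition of_mat :: "complex mat \<Rightarrow> fmat" where
  "of_mat A = Fmat (\<lambda>i j. if i < dim_row A \<and> j < dim_col A then A $$ (i, j) else 0)"

definition to_mat :: "nat \<Rightarrow> fmat \<Rightarrow> complex mat" where
  "to_mat n a = mat n n (\<lambda>(i, j). entry a i j)"

definition of_vec :: "complex vec \<Rightarrow> fmat" where
  "of_vec v = Fmat (\<lambda>i j. if i < dim_vec v \<and> j = 0 then v $ i else 0)"

lemma entry_of_mat: "entry (of_mat A) i j = (if i < dim_row A \<and> j < dim_col A then A $$ (i, j) else 0)"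
  unfolding of_mat_def by (subst entry_Fmat[of "max (dim_row A) (dim_col A)"]) auto

lemma entry_of_vec: "entry (of_vec v) i j = (if i < dim_vec v \<and> j = 0 then v $ i else 0)"
  unfolding of_vec_def by (subst entry_Fmat[of "Suc (dim_vec v)"]) auto

lemma supported_of_mat: "A \<in> carrier_mat m n \<Longrightarrow> supported m n (of_mat A)"
  by (auto simp: supported_def entry_of_mat)

lemma supported_of_vec: "v \<in> carrier_vec n \<Longrightarrow> supported n 1 (of_vec v)"
  by (auto simp: supported_def entry_of_vec)

lemma of_mat_minus: "A \<in> carrier_mat m n \<Longrightarrow> B \<in> carrier_mat m n \<Longrightarrow> of_mat (A - B) = of_mat A - of_mat B"
  by (rule fmat_eqI) (auto simp: entry_of_mat)

lemma of_mat_mult: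
  assumes "A \<in> carrier_mat m n" "B \<in> carrier_mat n p"
  shows "of_mat (A * B) = of_mat A * of_mat B"
proof (rule fmat_eqI)
  fix i j
  show "entry (of_mat (A * B)) i j = entry (of_mat A * of_mat B) i j"
    using assms supported_of_mat[OF assms(1)]
    by (subst entry_times[of m n]) (auto simp: entry_of_mat scalar_prod_def lessThan_atLeast0 intro!: sum.cong)
qed

lemma of_mat_mult_vec:
  assumes "A \<in> carrier_mat m n" "v \<in> carrier_vec n"
  shows "of_vec (A *\<^sub>v v) = of_mat A * of_vec v"
proof (rule fmat_eqI)
  fix i j
  show "entry (of_vec (A *\<^sub>v v)) i j = entry (of_mat A * of_vec v) i j"
    using assms supported_of_mat[OF assms(1)]
    by (subst entry_times[of m n]) (auto simp: entry_of_mat entry_of_vec scalar_prod_def lessThan_atLeast0 intro!: sum.cong)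
qed

lemma of_mat_to_mat: "supported n n a \<Longrightarrow> of_mat (to_mat n a) = a"
  by (rule fmat_eqI) (auto simp: entry_of_mat to_mat_def supported_def)

lemma of_mat_inject: "A \<in> carrier_mat m n \<Longrightarrow> B \<in> carrier_mat m n \<Longrightarrow> of_mat A = of_mat B \<Longrightarrow> A = B"
  by (rule eq_matI) (use entry_of_mat in \<open>metis carrier_matD\<close>, auto)

lemma to_mat_carrier [simp]: "to_mat n a \<in> carrier_mat n n"
  by (simp add: to_mat_def)

lemma tr_of_mat: "A \<in> carrier_mat n n \<Longrightarrow> tr (of_mat A) = mat_trace A"
  by (auto simp: tr_eq[OF supported_of_mat] mat_trace_def entry_of_mat intro!: sum.cong)

lemma norm_of_vec: "norm (of_vec v) = vec_l2_norm v"
proof -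
  have "(norm (of_vec v))\<^sup>2 = (\<Sum>i<dim_vec v. (cmod (v $ i))\<^sup>2)"
    by (subst norm_fmat_sq[of "dim_vec v" 1]) (auto simp: supported_def entry_of_vec intro!: sum.cong)
  then have "norm (of_vec v) = sqrt (\<Sum>i<dim_vec v. (cmod (v $ i))\<^sup>2)"
    by (metis norm_ge_zero real_sqrt_unique)
  then show ?thesis by (simp add: vec_l2_norm_def L2_set_def)
qed

lemma of_vec_vec: "supported n 1 x \<Longrightarrow> of_vec (vec n (\<lambda>i. entry x i 0)) = x"
  by (rule fmat_eqI) (auto simp: entry_of_vec supported_def)

lemma hs_norm_eq:
  assumes "A \<in> carrier_mat n n"
  shows "hs_norm A = norm (of_mat A)"
proof -
  have adj: "of_mat (mat_adjoint A) = adj (of_mat A)"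
    using assms by (intro fmat_eqI) (auto simp: entry_of_mat mat_adjoint_def mat_of_rows_def)
  have "mat_adjoint A \<in> carrier_mat n n"
    using assms by (auto simp: mat_adjoint_def)
  then have "mat_trace (mat_adjoint A * A) = tr (adj (of_mat A) * of_mat A)"
    using assms tr_of_mat[of "mat_adjoint A * A" n] of_mat_mult[of "mat_adjoint A" n n A n] adj by auto
  then have "mat_trace (mat_adjoint A * A) = complex_of_real ((norm (of_mat A))\<^sup>2)"
    using ip_self_norm[of "of_mat A"] by (simp add: ip_def)
  then show ?thesis by (simp add: hs_norm_def)
qed

text \<open>Squared norms add over columns, so testing on single columns suffices; the rows of
  \<open>x\<close> beyond \<open>n\<close> are first cut off by \<open>corner_one n\<close>.\<close>

lemma bounded_by_vectors:
  assumes a: "supported n n a" and c: "0 \<le> c"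
    and v: "\<And>x. supported n 1 x \<Longrightarrow> norm (a * x) \<le> c * norm x"
  shows "bounded_by a c"
proof -
  have "norm (a * x) \<le> c * norm x" for x
  proof -
    define y where "y = corner_one n * x"
    obtain M where M: "supported M M x" using ex_supported by blast
    have y: "supported n M y" unfolding y_def by (rule supported_times[OF supported_corner_one M])
    have ay: "a * y = a * x" unfolding y_def mult.assoc[symmetric] times_corner_one[OF a] ..
    have say: "supported n M (a * y)" by (rule supported_times[OF a y])
    define col where "col = (\<lambda>j. Fmat (\<lambda>i k. if i < n \<and> k = 0 then entry y i j else 0))"
    have ecol: "entry (col j) i k = (if i < n \<and> k = 0 then entry y i j else 0)" for i j k
      unfolding col_def by (subst entry_Fmat[of "Suc n"]) auto
    have scol: "supported n 1 (col j)" for j by (auto simp: supported_def ecol)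
    have sacol: "supported n 1 (a * col j)" for j by (rule supported_times[OF a scol])
    have eacol: "entry (a * col j) i 0 = entry (a * y) i j" for i j
      by (simp add: entry_times[OF disjI1[OF a]] ecol)
    have "(norm (a * y))\<^sup>2 = (\<Sum>j<M. (norm (a * col j))\<^sup>2)"
      unfolding norm_fmat_sq[OF say] norm_fmat_sq[OF sacol] by (subst sum.swap) (simp add: eacol)
    also have "\<dots> \<le> (\<Sum>j<M. c\<^sup>2 * (norm (col j))\<^sup>2)"
    proof (rule sum_mono)
      fix j
      from power_mono[OF v[OF scol[of j]] norm_ge_zero, of 2]
      show "(norm (a * col j))\<^sup>2 \<le> c\<^sup>2 * (norm (col j))\<^sup>2" by (simp add: power_mult_distrib)
    qed
    also have "\<dots> = c\<^sup>2 * (norm y)\<^sup>2"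
      unfolding norm_fmat_sq[OF y] norm_fmat_sq[OF scol] sum_distrib_left[symmetric]
      by (subst sum.swap) (simp add: ecol)
    finally have "(norm (a * y))\<^sup>2 \<le> (c * norm y)\<^sup>2" by (simp add: power_mult_distrib)
    then have "norm (a * y) \<le> c * norm y" by (rule power2_le_imp_le) (simp add: c)
    also have "norm y \<le> 1 * norm x"
      unfolding y_def by (rule bounded_byD[OF bounded_by_projection]) (simp_all add: corner_one_times[OF supported_corner_one])
    finally show ?thesis using c by (simp add: ay mult_left_mono)
  qed
  then show ?thesis using c by (simp add: bounded_by_def)
qed

section \<open>Operator norm and commutator cost in terms of operator bounds\<close>

lemma op_norm_upper:
  assumes A: "A \<in> carrier_mat n n" and v: "v \<in> carrier_vec n" "vec_l2_norm v \<le> 1"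
  shows "vec_l2_norm (A *\<^sub>v v) \<le> op_norm A"
  unfolding op_norm_def
proof (rule cSUP_upper)
  show "v \<in> {v \<in> carrier_vec (dim_col A). vec_l2_norm v \<le> 1}" using A v by simp
  \<comment> \<open>A real supremum is meaningful only over a bounded set; the Hilbert-Schmidt norm
    supplies the bound.\<close>
  show "bdd_above ((\<lambda>v. vec_l2_norm (A *\<^sub>v v)) ` {v \<in> carrier_vec (dim_col A). vec_l2_norm v \<le> 1})"
  proof (rule bdd_aboveI2)
    fix w assume "w \<in> {v \<in> carrier_vec (dim_col A). vec_l2_norm v \<le> 1}"
    then have w: "w \<in> carrier_vec n" "norm (of_vec w) \<le> 1" using A by (auto simp: norm_of_vec)
    have "vec_l2_norm (A *\<^sub>v w) \<le> norm (of_mat A) * norm (of_vec w)"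
      using norm_mult_ineq[of "of_mat A" "of_vec w"] of_mat_mult_vec[OF A w(1)] by (simp add: norm_of_vec[symmetric])
    also have "\<dots> \<le> norm (of_mat A)" using w(2) by (simp add: mult_left_le)
    finally show "vec_l2_norm (A *\<^sub>v w) \<le> norm (of_mat A)" .
  qed
qed

lemma vec_l2_norm_zero: "vec_l2_norm (0\<^sub>v n) = 0"
  by (simp add: vec_l2_norm_def L2_set_def)

lemma op_norm_nonneg: "A \<in> carrier_mat n n \<Longrightarrow> 0 \<le> op_norm A"
  using op_norm_upper[of A n "0\<^sub>v n"] by (simp add: vec_l2_norm_zero) (smt (verit) L2_set_nonneg vec_l2_norm_def)

lemma bounded_by_op_norm:
  assumes A: "A \<in> carrier_mat n n"
  shows "bounded_by (of_mat A) (op_norm A)"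
proof (rule bounded_by_vectors[OF supported_of_mat[OF A] op_norm_nonneg[OF A]])
  fix x assume x: "supported n 1 x"
  show "norm (of_mat A * x) \<le> op_norm A * norm x"
  proof (cases "x = 0")
    case False
    define y where "y = complex_of_real (1 / norm x) *\<^sub>c x"
    define v where "v = vec n (\<lambda>i. entry y i 0)"
    have sy: "supported n 1 y" unfolding y_def by (rule supported_cscale[OF x])
    have v: "v \<in> carrier_vec n" "of_vec v = y" unfolding v_def by (rule vec_carrier, rule of_vec_vec[OF sy])
    have "norm y = 1" using False by (simp add: y_def norm_divide)
    then have "vec_l2_norm (A *\<^sub>v v) \<le> op_norm A" using v by (intro op_norm_upper[OF A]) (auto simp: norm_of_vec[symmetric])
    then have "norm (of_mat A * y) \<le> op_norm A" by (simp add: norm_of_vec[symmetric] of_mat_mult_vec[OF A v(1)] v(2))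
    then show ?thesis using False by (simp add: y_def cscale_times_right norm_divide field_simps)
  qed simp
qed

lemma op_norm_le:
  assumes A: "A \<in> carrier_mat n n" and b: "bounded_by (of_mat A) c"
  shows "op_norm A \<le> c"
  unfolding op_norm_def
proof (rule cSUP_least)
  have "0\<^sub>v n \<in> {v \<in> carrier_vec (dim_col A). vec_l2_norm v \<le> 1}" using A by (simp add: vec_l2_norm_zero)
  then show "{v \<in> carrier_vec (dim_col A). vec_l2_norm v \<le> 1} \<noteq> {}" by blast
next
  fix v assume "v \<in> {v \<in> carrier_vec (dim_col A). vec_l2_norm v \<le> 1}"
  then have v: "v \<in> carrier_vec n" "norm (of_vec v) \<le> 1" using A by (auto simp: norm_of_vec)
  have "vec_l2_norm (A *\<^sub>v v) = norm (of_mat A * of_vec v)" by (simp add: norm_of_vec[symmetric] of_mat_mult_vec[OF A v(1)])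
  also have "\<dots> \<le> c * norm (of_vec v)" by (rule bounded_byD[OF b])
  also have "\<dots> \<le> c" using v(2) bounded_by_nonneg[OF b] by (simp add: mult_left_le)
  finally show "vec_l2_norm (A *\<^sub>v v) \<le> c" .
qed

lemma commutator_cost_le:
  assumes A: "A \<in> carrier_mat n n" and bc: "supported n n b" "supported n n c" "of_mat A = b * c - c * b"
    and r: "bounded_by b r" "bounded_by c s"
  shows "commutator_cost A \<le> ereal (r * s)"
proof -
  define B C where "B = to_mat n b" and "C = to_mat n c"
  have BC: "B \<in> carrier_mat n n" "C \<in> carrier_mat n n" "of_mat B = b" "of_mat C = c"
    using bc by (auto simp: B_def C_def of_mat_to_mat)
  have car: "B * C - C * B \<in> carrier_mat n n" using BC by auto
  have "of_mat (B * C - C * B) = b * c - c * b"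
    using of_mat_minus[of "B * C" n n "C * B"] of_mat_mult[of B n n C n] of_mat_mult[of C n n B n] BC by auto
  then have "A = B * C - C * B" using of_mat_inject[OF A car] bc by simp
  then have "commutator_cost A \<le> ereal (op_norm B * op_norm C)"
    unfolding commutator_cost_def using A BC by (intro Inf_lower) auto
  also have "op_norm B * op_norm C \<le> r * s"
    using op_norm_le[OF BC(1)] op_norm_le[OF BC(2)] BC r op_norm_nonneg[OF BC(2)] bounded_by_nonneg[OF r(1)]
    by (intro mult_mono) auto
  finally show ?thesis by simp
qed

text \<open>A number strictly above the infimum is beaten by an actual pair, whether or not the
  infimum is attained. Scaling the factors inversely leaves the commutator alone and normalises
  \<open>b\<close>, as the packing of unit discs demands.\<close>

lemma commutator_cost_obtain:
  assumes D: "D \<in> carrier_mat m m" and "commutator_cost D < ereal q" and "0 \<le> q"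
  obtains b c where "supported m m b" "supported m m c" "of_mat D = b * c - c * b" "bounded_by b 1" "bounded_by c q"
proof -
  obtain B C where BC: "B \<in> carrier_mat m m" "C \<in> carrier_mat m m" "D = B * C - C * B" "op_norm B * op_norm C < q"
    using assms(2) D unfolding commutator_cost_def Inf_less_iff by auto
  define b c where "b = of_mat B" and "c = of_mat C"
  have bc: "supported m m b" "supported m m c" "bounded_by b (op_norm B)" "bounded_by c (op_norm C)"
    using BC by (auto simp: b_def c_def supported_of_mat bounded_by_op_norm)
  have d: "of_mat D = b * c - c * b"
    using of_mat_minus[of "B * C" m m "C * B"] of_mat_mult[of B m m C m] of_mat_mult[of C m m B m] BC
    by (auto simp: b_def c_def)
  show ?thesis
  proof (cases "op_norm B = 0")
    \<comment> \<open>A factor of norm 0 cannot be normalised, but then \<open>D\<close> is zero and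
      the zero pair serves.\<close>
    case True
    obtain N where "supported N N b" using ex_supported by blast
    then have "norm b = norm (b * corner_one N)" by (simp add: times_corner_one)
    also have "\<dots> \<le> 0" using bounded_byD[OF bc(3), of "corner_one N"] True by simp
    finally have "b = 0" by simp
    then show ?thesis using d assms(3) by (intro that[of 0 0]) (auto intro: bounded_by_zero)
  next
    case False
    define \<beta> where "\<beta> = op_norm B"
    have \<beta>: "\<beta> > 0" using False op_norm_nonneg[OF BC(1)] by (simp add: \<beta>_def)
    show ?thesis
    proof (rule that[of "complex_of_real (1 / \<beta>) *\<^sub>c b" "complex_of_real \<beta> *\<^sub>c c"])
      show "of_mat D = (complex_of_real (1 / \<beta>) *\<^sub>c b) * (complex_of_real \<beta> *\<^sub>c c) - (complex_of_real \<beta> *\<^sub>c c) * (complex_of_real (1 / \<beta>) *\<^sub>c b)"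
        using d \<beta> by (simp add: cscale_times_left cscale_times_right cscale_simps)
      show "bounded_by (complex_of_real (1 / \<beta>) *\<^sub>c b) 1"
        using bounded_by_cscale[OF bc(3), of "complex_of_real (1 / \<beta>)"] \<beta> by (simp add: \<beta>_def norm_divide)
      have "bounded_by (complex_of_real \<beta> *\<^sub>c c) (\<beta> * op_norm C)"
        using bounded_by_cscale[OF bc(4), of "complex_of_real \<beta>"] \<beta> by simp
      then show "bounded_by (complex_of_real \<beta> *\<^sub>c c) q" by (rule bounded_by_mono) (use BC(4) in \<open>simp add: \<beta>_def\<close>)
    qed (use bc in \<open>auto intro: supported_cscale\<close>)
  qed
qed

section \<open>The cost of a matrix close to low rank\<close>

text \<open>\<open>w\<close> has the \<open>v i\<close> as columns, and
  \<open>b = adj w * a * w\<close> is the block in these coordinates. Bounds pass in both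
  directions, and the trace of \<open>b\<close> is the diagonal sum over the family.\<close>

lemma compression:
  fixes m :: nat
  assumes v: "\<And>i. i < m \<Longrightarrow> supported n 1 (v i)" "\<And>i j. i < m \<Longrightarrow> j < m \<Longrightarrow> ip (v i) (v j) = (if i = j then 1 else 0)"
    and a: "supported n n a" "(\<Sum>i<m. ip (a * v i) (v i)) = 0"
  defines "p \<equiv> \<Sum>i<m. v i * adj (v i)"
  obtains w b where "supported n m w" "adj w * w = corner_one m" "bounded_by w 1" "bounded_by (adj w) 1" "p * w = w"
    "supported m m b" "tr b = 0" "b = adj w * (p * a * p) * w" "p * a * p = w * b * adj w"
proof -
  obtain w where w: "supported n m w" "adj w * w = corner_one m" "w * adj w = p"
    unfolding p_def by (rule family_isometry[OF v])
  have p: "adj p = p" "p * p = p" unfolding p_def by (rule family_projection[OF v]; assumption)+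
  have pw: "p * w = w" unfolding w(3)[symmetric] mult.assoc w(2) by (rule times_corner_one[OF w(1)])
  have wp: "adj w * p = adj w" using arg_cong[OF pw, of adj] p by simp
  have bp: "bounded_by p 1" by (rule bounded_by_projection[OF p])
  have bw: "bounded_by w 1" by (rule bounded_by_partial_isometry) (simp add: w bp)
  define b where "b = adj w * a * w"
  have sb: "supported m m b" unfolding b_def
    by (rule supported_times[OF supported_times[OF supported_adj[OF w(1)] a(1)] w(1)])
  have "tr b = tr (a * (w * adj w))"
    unfolding b_def by (simp add: mult.assoc tr_times_commute[of "adj w"])
  also have "\<dots> = (\<Sum>i<m. ip (a * v i) (v i))"
    unfolding w(3) p_def sum_distrib_left tr_sum ip_conj_eq_tr ..
  finally have tb: "tr b = 0" using a(2) by simp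
  have "adj w * (p * a * p) * w = (adj w * p) * a * (p * w)" by (simp add: mult.assoc)
  then have "b = adj w * (p * a * p) * w" unfolding b_def wp pw by simp
  moreover have "p * a * p = w * b * adj w" unfolding b_def w(3)[symmetric] by (simp add: mult.assoc)
  ultimately show ?thesis using that[OF w(1,2) bw bounded_by_adj[OF bw] pw sb tb] by blast
qed

text \<open>In coordinates the block is a traceless matrix of size at most one. Being zero, it is a
  commutator of zeros, so its disc may have radius 0.\<close>

lemma compression_small:
  fixes m :: nat
  assumes v: "\<And>i. i < m \<Longrightarrow> supported n 1 (v i)" "\<And>i j. i < m \<Longrightarrow> j < m \<Longrightarrow> ip (v i) (v j) = (if i = j then 1 else 0)"
    and a: "supported n n a" "(\<Sum>i<m. ip (a * v i) (v i)) = 0" and m: "m \<le> 1"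
  shows "(\<Sum>i<m. v i * adj (v i)) * a * (\<Sum>i<m. v i * adj (v i)) = 0"
proof -
  obtain w b where b: "supported n m w" "adj w * w = corner_one m" "bounded_by w 1" "bounded_by (adj w) 1"
    "(\<Sum>i<m. v i * adj (v i)) * w = w" "supported m m b" "tr b = 0"
    "b = adj w * ((\<Sum>i<m. v i * adj (v i)) * a * (\<Sum>i<m. v i * adj (v i))) * w"
    "(\<Sum>i<m. v i * adj (v i)) * a * (\<Sum>i<m. v i * adj (v i)) = w * b * adj w"
    by (rule compression[OF v a])
  have "supported 1 1 b" using supported_mono[OF b(6) m m] .
  then have "b = 0" using b(7) tr_eq[of 1 1 b] 
    by (intro fmat_eqI) (simp add: supported_def, metis One_nat_def Suc_leI gr0I)
  then show ?thesis using b(9) by simp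
qed

text \<open>The hypothesis factorizes the block in coordinates, and conjugation by \<open>w\<close>
  carries the factors back. The slack \<open>\<eta>\<close> makes the bound on the infimum strict,
  so that an actual pair realises it.\<close>

lemma compression_commutator:
  fixes m :: nat
  assumes v: "\<And>i. i < m \<Longrightarrow> supported n 1 (v i)" "\<And>i j. i < m \<Longrightarrow> j < m \<Longrightarrow> ip (v i) (v j) = (if i = j then 1 else 0)"
    and a: "supported n n a" "(\<Sum>i<m. ip (a * v i) (v i)) = 0"
    and \<beta>: "bounded_by ((\<Sum>i<m. v i * adj (v i)) * a * (\<Sum>i<m. v i * adj (v i))) \<beta>"
    and hyp: "\<And>D. D \<in> carrier_mat m m \<Longrightarrow> 1 \<le> m \<Longrightarrow> mat_trace D = 0 \<Longrightarrow> commutator_cost D \<le> ereal (K * op_norm D)"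
    and K: "0 \<le> K" and \<eta>: "0 < \<eta>"
  defines "p \<equiv> \<Sum>i<m. v i * adj (v i)"
  shows "\<exists>d c. p * a * p = d * c - c * d \<and> p * d = d \<and> d * p = d \<and> p * c = c \<and> c * p = c \<and>
    bounded_by d 1 \<and> bounded_by c (K * \<beta> + \<eta>)"
proof -
  obtain w b where w: "supported n m w" "adj w * w = corner_one m" "bounded_by w 1" "bounded_by (adj w) 1" "p * w = w"
    and b: "supported m m b" "tr b = 0" "b = adj w * (p * a * p) * w" "p * a * p = w * b * adj w"
    unfolding p_def by (rule compression[OF v a])
  have "bounded_by b (1 * \<beta> * 1)"
    unfolding b(3) p_def by (intro bounded_by_mult w \<beta>)
  then have bb: "bounded_by b \<beta>" by simp
  have "0 \<le> \<beta>" using bb by (rule bounded_by_nonneg)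
  obtain e g where eg: "supported m m e" "supported m m g" "b = e * g - g * e" "bounded_by e 1" "bounded_by g (K * \<beta> + \<eta>)"
  proof (cases "m = 0")
    \<comment> \<open>An empty block lies outside the scope of \<open>hyp\<close>, and is
      zero.\<close>
    case True
    then have "b = 0" using b(1) by (intro fmat_eqI) (auto simp: supported_def)
    then show ?thesis using K \<open>0 \<le> \<beta>\<close> \<eta> by (intro that[of 0 0]) (auto intro: bounded_by_zero)
  next
    case False
    define D where "D = to_mat m b"
    have D: "D \<in> carrier_mat m m" "of_mat D = b" using b(1) by (auto simp: D_def of_mat_to_mat)
    have "mat_trace D = 0" using tr_of_mat[OF D(1)] D(2) b(2) by simp
    then have "commutator_cost D \<le> ereal (K * op_norm D)" using hyp[OF D(1)] False by simp
    also have "K * op_norm D \<le> K * \<beta>" using op_norm_le[OF D(1)] D(2) bb K by (intro mult_left_mono) auto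
    then have "ereal (K * op_norm D) \<le> ereal (K * \<beta>)" by simp
    also have "ereal (K * \<beta>) < ereal (K * \<beta> + \<eta>)" using \<eta> by simp
    finally have lt: "commutator_cost D < ereal (K * \<beta> + \<eta>)" .
    have "0 \<le> K * \<beta> + \<eta>" using K \<open>0 \<le> \<beta>\<close> \<eta> by simp
    then show ?thesis using commutator_cost_obtain[OF D(1) lt, unfolded D(2)] that by blast
  qed
  define d c where "d = w * e * adj w" and "c = w * g * adj w"
  have wp: "adj w * p = adj w"
  proof -
    have "adj p = p" by (simp add: p_def adj_sum)
    then show ?thesis using arg_cong[OF w(5), of adj] by simp
  qed
  have prod: "(w * x * adj w) * (w * y * adj w) = w * (x * y) * adj w" if "supported m m x" for x y
  proof -
    have "(w * x * adj w) * (w * y * adj w) = w * (x * (adj w * w)) * y * adj w" by (simp add: mult.assoc)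
    then show ?thesis unfolding w(2) times_corner_one[OF that] by (simp add: mult.assoc)
  qed
  have "d * c - c * d = w * (e * g - g * e) * adj w"
    unfolding d_def c_def prod[OF eg(1)] prod[OF eg(2)] by (simp add: algebra_simps)
  then have "p * a * p = d * c - c * d" unfolding b(4) eg(3) by simp
  moreover have "p * d = d" "p * c = c" unfolding d_def c_def mult.assoc[symmetric] w(5) by simp_all
  moreover have "d * p = d" "c * p = c" unfolding d_def c_def mult.assoc wp by simp_all
  moreover have "bounded_by d (1 * 1 * 1)" "bounded_by c (1 * (K * \<beta> + \<eta>) * 1)"
    unfolding d_def c_def by (intro bounded_by_mult w eg)+
  ultimately show ?thesis by (intro exI[of _ d] exI[of _ c]) simp
qed

text \<open>Centres of the discs containing the spectra of the seven shifted diagonal blocks; the last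
  three blocks are zero of size at most one, so their discs are points.\<close>

definition shift :: "nat \<Rightarrow> complex" where
  "shift k = [Complex 1.1 1.1, Complex 1.1 (-1.1), Complex (-1.1) 1.1, Complex (-1.1) (-1.1), 0,
     Complex 0 2.2, Complex 0 (-2.2)] ! k"

definition radius :: "nat \<Rightarrow> real" where
  "radius k = (if k < 4 then 1 else 0)"

lemma less_7_cases: "(k::nat) < 7 \<Longrightarrow> (k = 0 \<Longrightarrow> P) \<Longrightarrow> (k = 1 \<Longrightarrow> P) \<Longrightarrow> (k = 2 \<Longrightarrow> P) \<Longrightarrow> (k = 3 \<Longrightarrow> P)
  \<Longrightarrow> (k = 4 \<Longrightarrow> P) \<Longrightarrow> (k = 5 \<Longrightarrow> P) \<Longrightarrow> (k = 6 \<Longrightarrow> P) \<Longrightarrow> P"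
  by linarith

text \<open>The tightest pairs are adjacent unit discs, with centres 2.2 apart; the three isolated
  points have distance 1.1 sqrt 2 from the nearest centres of discs. Comparing squares keeps the
  arithmetic rational.\<close>

lemma shift_separated:
  assumes "k < 7" "l < 7" "k \<noteq> l"
  shows "radius k + radius l + 1/10 \<le> cmod (shift k - shift l)"
proof -
  have *: "c \<le> cmod z" if "c\<^sup>2 \<le> (Re z)\<^sup>2 + (Im z)\<^sup>2" for z c
    using that by (simp add: cmod_def real_le_rsqrt)
  show ?thesis
    by (rule less_7_cases[OF assms(1)]; rule less_7_cases[OF assms(2)]; rule *)
       (use assms(3) in \<open>simp_all add: shift_def radius_def eval_nat_numeral power2_eq_square\<close>)
qed

text \<open>The extreme value is 1 + 1.1 sqrt 2, about 2.5556, at the four unit discs.\<close>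

lemma shift_bound: "k < 7 \<Longrightarrow> radius k + cmod (shift k) \<le> 2.56"
proof -
  have *: "cmod z \<le> c" if "(Re z)\<^sup>2 + (Im z)\<^sup>2 \<le> c\<^sup>2" "0 \<le> c" for z c
    using that by (simp add: cmod_def real_le_lsqrt)
  have "cmod (shift k) \<le> 2.56 - radius k" if "k < 7"
    by (rule less_7_cases[OF that]; rule *) (simp_all add: shift_def radius_def eval_nat_numeral power2_eq_square)
  then show "k < 7 \<Longrightarrow> radius k + cmod (shift k) \<le> 2.56" by linarith
qed

lemma low_rank_commutator_cost:
  assumes A: "A \<in> carrier_mat n n" "mat_trace A = 0" and pos: "0 < op_norm A" and K: "20000 \<le> K"
    and hyp: "\<And>m D. 1 \<le> m \<Longrightarrow> m < n \<Longrightarrow> D \<in> carrier_mat m m \<Longrightarrow> mat_trace D = 0 \<Longrightarrow> commutator_cost D \<le> ereal (K * op_norm D)"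
    and f: "bounded_by (of_mat A - f) (op_norm A / 100)"
    and ys: "\<And>y. y \<in> set ys \<Longrightarrow> supported n 1 y"
    and kill: "\<And>x. supported n 1 x \<Longrightarrow> (\<And>y. y \<in> set ys \<Longrightarrow> ip x y = 0) \<Longrightarrow> f * x = 0 \<and> adj f * x = 0"
    and n: "12 * length ys + 3 \<le> n"
  shows "commutator_cost A \<le> ereal (3 / 4 * K * op_norm A)"
proof -
  define a \<alpha> where "a = of_mat A" and "\<alpha> = op_norm A"
  have a: "supported n n a" "tr a = 0" "bounded_by a \<alpha>"
    using A by (simp_all add: a_def \<alpha>_def supported_of_mat tr_of_mat bounded_by_op_norm)
  have "bounded_by (a - (a - f)) (\<alpha> + \<alpha> / 100)" using f a(3) unfolding a_def \<alpha>_def by (intro bounded_by_diff)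
  then have bf: "bounded_by f (\<alpha> + \<alpha> / 100)" by simp
  show ?thesis
  proof (rule block_decomposition[OF a(1,2) bf ys kill n])
  fix m :: "nat \<Rightarrow> nat" and v :: "nat \<Rightarrow> nat \<Rightarrow> fmat"
  assume
    sup: "\<And>k i. k < 7 \<Longrightarrow> i < m k \<Longrightarrow> supported n 1 (v k i)" and
    on: "\<And>k l i j. k < 7 \<Longrightarrow> l < 7 \<Longrightarrow> i < m k \<Longrightarrow> j < m l \<Longrightarrow> ip (v k i) (v l j) = (if k = l \<and> i = j then 1 else 0)" and
    complete: "(\<Sum>k<7. \<Sum>i<m k. v k i * adj (v k i)) = corner_one n" and
    tr0: "\<And>k. k < 7 \<Longrightarrow> (\<Sum>i<m k. ip (a * v k i) (v k i)) = 0" and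
    mn: "\<And>k. k < 7 \<Longrightarrow> m k < n" and
    comp: "\<And>k. k < 4 \<Longrightarrow> bounded_by ((\<Sum>i<m k. v k i * adj (v k i)) * f * (\<Sum>i<m k. v k i * adj (v k i))) ((\<alpha> + \<alpha> / 100) / 4)" and
    m1: "\<And>k. 4 \<le> k \<Longrightarrow> m k \<le> 1"
  define p where "p = (\<lambda>k. \<Sum>i<m k. v k i * adj (v k i))"
  have on1: "ip (v k i) (v k j) = (if i = j then 1 else 0)" if "k < 7" "i < m k" "j < m k" for k i j
    using on[OF that(1,1,2,3)] by simp
  have p: "adj (p k) = p k" "p k * p k = p k" "supported n n (p k)" if "k < 7" for k
    unfolding p_def by (rule family_projection[OF sup on1]; simp add: that)+
  have pp: "p k * p l = (if k = l then p k else 0)" if "k \<in> {..<7}" "l \<in> {..<7}" for k l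
  proof (cases "k = l")
    case False
    then have "p k * p l = 0" unfolding p_def
      by (intro family_projections_orthogonal[of _ n]) (use sup on that in auto)
    then show ?thesis using False by simp
  qed (use p that in auto)
  have bp: "bounded_by (p k) 1" if "k < 7" for k by (rule bounded_by_projection[OF p(1,2)[OF that]])
  \<comment> \<open>The low-rank part contributes (1 + 1/100) / 4 and the remainder 1/100, together
    0.2625. The summand \<open>\<alpha>\<close> in \<open>\<gamma>\<close> is the slack
    \<open>\<eta>\<close> of \<open>compression_commutator\<close>.\<close>
  define \<beta> \<gamma> where "\<beta> = 0.2625 * \<alpha>" and "\<gamma> = K * \<beta> + \<alpha>"
  have pap: "bounded_by (p k * a * p k) \<beta>" if "k < 4" for k
  proof -
    have k7: "k < 7" using that by simp
    have "bounded_by (p k * f * p k + p k * (a - f) * p k) ((\<alpha> + \<alpha> / 100) / 4 + 1 * (\<alpha> / 100) * 1)"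
    proof (intro bounded_by_add bounded_by_mult bp k7)
      show "bounded_by (p k * f * p k) ((\<alpha> + \<alpha> / 100) / 4)" unfolding p_def by (rule comp[OF that])
      show "bounded_by (a - f) (\<alpha> / 100)" unfolding a_def \<alpha>_def by (rule f)
    qed
    moreover have "p k * f * p k + p k * (a - f) * p k = p k * a * p k" by (simp add: algebra_simps)
    moreover have "(\<alpha> + \<alpha> / 100) / 4 + 1 * (\<alpha> / 100) * 1 = \<beta>" by (simp add: \<beta>_def)
    ultimately show ?thesis by metis
  qed
  have K0: "0 \<le> K" "0 < \<alpha>" using K pos by (simp_all add: \<alpha>_def)
  have \<gamma>: "0 \<le> \<gamma>" using K0 by (simp add: \<gamma>_def \<beta>_def)
  have "\<exists>d c. p k * a * p k = d * c - c * d \<and> p k * d = d \<and> d * p k = d \<and> p k * c = c \<and> c * p k = c \<and>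
    bounded_by d (radius k) \<and> bounded_by c \<gamma>" if k: "k < 7" for k
  proof (cases "k < 4")
    case True
    have r: "radius k = 1" using True by (simp add: radius_def)
    show ?thesis unfolding r p_def \<gamma>_def
    proof (rule compression_commutator[OF sup[OF k] on1[OF k] a(1) tr0[OF k] pap[OF True, unfolded p_def] _ K0])
      fix D assume "D \<in> carrier_mat (m k) (m k)" "1 \<le> m k" "mat_trace D = 0"
      then show "commutator_cost D \<le> ereal (K * op_norm D)" using hyp mn[OF k] by blast
    qed
  next
    case False
    have "p k * a * p k = 0"
      unfolding p_def by (rule compression_small[OF sup[OF k] on1[OF k] a(1) tr0[OF k]]) (use m1 False in auto)
    then show ?thesis using False \<gamma> by (intro exI[of _ 0]) (auto simp: radius_def intro: bounded_by_zero)
  qed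
  then obtain d c where dc: "\<And>k. k < 7 \<Longrightarrow> p k * a * p k = d k * c k - c k * d k \<and> p k * d k = d k \<and> d k * p k = d k \<and>
     p k * c k = c k \<and> c k * p k = c k \<and> bounded_by (d k) (radius k) \<and> bounded_by (c k) \<gamma>"
    by metis
  obtain b e where be: "supported n n b" "supported n n e" "a = b * e - e * b" "bounded_by b 2.56"
    "bounded_by e (\<gamma> + (real (card {..<7::nat}))\<^sup>2 * (\<alpha> / (1/10)))"
  proof (rule commutator_assembly[of "{..<7}" p n a d c radius \<gamma> "1/10" shift "2.56" \<alpha>])
    show "finite {..<7::nat}" by simp
    show "p k * p l = (if k = l then p k else 0)" if "k \<in> {..<7}" "l \<in> {..<7}" for k l by (rule pp[OF that])
    show "adj (p k) = p k" "supported n n (p k)" if "k \<in> {..<7}" for k using p that by auto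
    show "(\<Sum>k<7. p k) = corner_one n" unfolding p_def by (rule complete)
    show "p k * a * p k = d k * c k - c k * d k" "p k * d k = d k" "d k * p k = d k" "bounded_by (d k) (radius k)"
      "p k * c k = c k" "c k * p k = c k" "bounded_by (c k) \<gamma>" if "k \<in> {..<7}" for k
      using dc that by auto
    show "radius k + radius l + 1/10 \<le> cmod (shift k - shift l)" if "k \<in> {..<7}" "l \<in> {..<7}" "k \<noteq> l" for k l
      using shift_separated that by auto
    show "radius k + cmod (shift k) \<le> 2.56" if "k \<in> {..<7}" for k using shift_bound that by auto
  qed (use \<gamma> a(1,3) in simp_all)
  have "commutator_cost A \<le> ereal (2.56 * (\<gamma> + (real (card {..<7::nat}))\<^sup>2 * (\<alpha> / (1/10))))"
    using commutator_cost_le[OF A(1) be(1,2) _ be(4,5)] be(3) by (simp add: a_def)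
  also have "2.56 * (\<gamma> + (real (card {..<7::nat}))\<^sup>2 * (\<alpha> / (1/10))) \<le> 3 / 4 * K * \<alpha>"
  proof -
    have le: "20000 * \<alpha> \<le> K * \<alpha>" using K K0 by (intro mult_right_mono) auto
    \<comment> \<open>Here 84/125 is 2.56 times 0.2625, and 31424/25 is 2.56 times 491, from 49
      pairs of blocks with gap 1/10 plus the slack. The margin 3/4 - 84/125 is 0.078, and 0.078
      times 20000 is 1560, above 31424/25.\<close>
    have eq: "2.56 * (\<gamma> + (real (card {..<7::nat}))\<^sup>2 * (\<alpha> / (1/10))) = 84/125 * (K * \<alpha>) + 31424/25 * \<alpha>"
      by (simp add: \<gamma>_def \<beta>_def algebra_simps)
    show ?thesis unfolding eq mult.assoc[of "3/4"] using le K0(2) by linarith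
  qed
  finally show "commutator_cost A \<le> ereal (3 / 4 * K * op_norm A)" by (simp add: \<alpha>_def)
  qed
qed

section \<open>Rank\<close>

text \<open>A maximal independent set \<open>S\<close> of columns expresses every column, and
  \<open>g\<close> collects the coefficients.\<close>

lemma rank_factorization:
  fixes F :: "complex mat"
  assumes F: "F \<in> carrier_mat n n"
  obtains S g where "finite S" "card S = vec_space.rank n F" "S \<subseteq> carrier_vec n"
    "\<forall>i<n. \<forall>j<n. F $$ (i, j) = (\<Sum>s\<in>S. g j s * s $ i)"
proof -
  interpret vec_space "TYPE(complex)" n .
  have C: "set (cols F) \<subseteq> carrier_vec n" using F cols_dim by blast
  obtain S where S: "maximal S (\<lambda>T. T \<subseteq> set (cols F) \<and> lin_indpt T)" "finite S"
    using maximal_exists_superset[of "set (cols F)" "\<lambda>T. T \<subseteq> set (cols F) \<and> lin_indpt T" "{}"]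
    by (auto simp: lin_dep_def)
  have SC: "S \<subseteq> set (cols F)" "lin_indpt S" and max: "\<And>B. S \<subseteq> B \<Longrightarrow> B \<subseteq> set (cols F) \<Longrightarrow> lin_indpt B \<Longrightarrow> B = S"
    using S(1) unfolding maximal_def by auto
  have Scar: "S \<subseteq> carrier_vec n" using SC(1) C by blast
  have span: "c \<in> span S" if c: "c \<in> set (cols F)" for c
  proof (cases "c \<in> S")
    case True
    then show ?thesis using in_own_span[of S] Scar by auto
  next
    case False
    then have "lin_dep (S \<union> {c})" using max[of "S \<union> {c}"] SC(1) c by auto
    then show ?thesis using lin_dep_iff_in_span[of S c] Scar SC(2) c C False by auto
  qed
  have "\<exists>h. \<forall>i<n. F $$ (i, j) = (\<Sum>s\<in>S. h s * s $ i)" if j: "j < n" for j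
  proof -
    have "col F j \<in> set (cols F)" using F j by (metis carrier_matD(2) cols_length cols_nth nth_mem)
    then obtain h where h: "lincomb h S = col F j" using finite_in_span[OF S(2) _ span] Scar by auto
    have "F $$ (i, j) = (\<Sum>s\<in>S. h s * s $ i)" if "i < n" for i
      using lincomb_index[OF that Scar, of h] h F j that by simp
    then show ?thesis by blast
  qed
  then obtain g where "\<forall>j<n. \<forall>i<n. F $$ (i, j) = (\<Sum>s\<in>S. g j s * s $ i)" by metis
  then show ?thesis using that[OF S(2) _ Scar] rank_card_indpt[OF F S(1)] by auto
qed

text \<open>In a rank factorization the matrix tests a vector only against the coefficient rows, and
  its adjoint only against the columns in \<open>S\<close>; two vectors per unit of rank therefore
  detect both.\<close>

lemma rank_annihilator:
  assumes F: "F \<in> carrier_mat n n"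
  obtains ys where "length ys = 2 * mat_rank F" "\<forall>y\<in>set ys. supported n 1 y"
    "\<forall>x. supported n 1 x \<longrightarrow> (\<forall>y\<in>set ys. ip x y = 0) \<longrightarrow> of_mat F * x = 0 \<and> adj (of_mat F) * x = 0"
proof -
  obtain S g where S: "finite S" "card S = vec_space.rank n F" "S \<subseteq> carrier_vec n"
    "\<forall>i<n. \<forall>j<n. F $$ (i, j) = (\<Sum>s\<in>S. g j s * s $ i)"
    by (rule rank_factorization[OF F])
  obtain ss where ss: "set ss = S" "distinct ss" using finite_distinct_list[OF S(1)] by blast
  have len: "length ss = mat_rank F" using ss S(2) F distinct_card[OF ss(2)] by simp
  \<comment> \<open>Conjugated because \<open>ip\<close> is conjugate linear in its second
    argument.\<close>
  define row where "row = (\<lambda>s. of_vec (vec n (\<lambda>j. cnj (g j s))))"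
  define ys where "ys = map of_vec ss @ map row ss"
  have sr: "supported n 1 (row s)" for s unfolding row_def by (rule supported_of_vec) simp
  have sv: "supported n 1 (of_vec s)" if "s \<in> S" for s using S(3) that by (intro supported_of_vec) auto
  have dS: "dim_vec s = n" if "s \<in> S" for s using S(3) that by auto
  have eF: "entry (of_mat F) i j = (\<Sum>s\<in>S. g j s * s $ i)" if "i < n" "j < n" for i j
    using F S(4) that by (auto simp: entry_of_mat)
  note sF = supported_of_mat[OF F]
  have "of_mat F * x = 0 \<and> adj (of_mat F) * x = 0" if x: "supported n 1 x" and perp: "\<forall>y\<in>set ys. ip x y = 0" for x
  proof
    have ip0: "(\<Sum>j<n. entry x j 0 * g j s) = 0" "(\<Sum>i<n. entry x i 0 * cnj (s $ i)) = 0" if s: "s \<in> S" for s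
    proof -
      have "ip x (row s) = 0" "ip x (of_vec s) = 0" using perp s ss by (auto simp: ys_def)
      then show "(\<Sum>j<n. entry x j 0 * g j s) = 0" "(\<Sum>i<n. entry x i 0 * cnj (s $ i)) = 0"
        using ip_eq[OF x sr] ip_eq[OF x sv[OF s]] dS[OF s] by (simp_all add: row_def entry_of_vec)
    qed
    show "of_mat F * x = 0"
    proof (rule fmat_eqI)
      fix i k
      show "entry (of_mat F * x) i k = entry 0 i k"
      proof (cases "i < n \<and> k = 0")
        case True
        have "entry (of_mat F * x) i 0 = (\<Sum>j<n. \<Sum>s\<in>S. g j s * s $ i * entry x j 0)"
          using True by (simp add: entry_times[OF disjI1[OF sF]] eF sum_distrib_right)
        also have "\<dots> = (\<Sum>s\<in>S. \<Sum>j<n. g j s * s $ i * entry x j 0)" by (rule sum.swap)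
        also have "\<dots> = (\<Sum>s\<in>S. s $ i * (\<Sum>j<n. entry x j 0 * g j s))"
          by (simp add: sum_distrib_left mult_ac)
        also have "\<dots> = 0" using ip0(1) by simp
        finally show ?thesis using True by simp
      next
        case False
        then show ?thesis using supported_times[OF sF x] by (auto simp: supported_def not_less)
      qed
    qed
    show "adj (of_mat F) * x = 0"
    proof (rule fmat_eqI)
      fix j k
      show "entry (adj (of_mat F) * x) j k = entry 0 j k"
      proof (cases "j < n \<and> k = 0")
        case True
        have "entry (adj (of_mat F) * x) j 0 = (\<Sum>i<n. \<Sum>s\<in>S. cnj (g j s) * cnj (s $ i) * entry x i 0)"
          using True by (simp add: entry_times[OF disjI1[OF supported_adj[OF sF]]] eF sum_distrib_right)
        also have "\<dots> = (\<Sum>s\<in>S. \<Sum>i<n. cnj (g j s) * cnj (s $ i) * entry x i 0)" by (rule sum.swap)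
        also have "\<dots> = (\<Sum>s\<in>S. cnj (g j s) * (\<Sum>i<n. entry x i 0 * cnj (s $ i)))"
          by (simp add: sum_distrib_left mult_ac)
        also have "\<dots> = 0" using ip0(2) by simp
        finally show ?thesis using True by simp
      next
        case False
        then show ?thesis using supported_times[OF supported_adj[OF sF] x] by (auto simp: supported_def not_less)
      qed
    qed
  qed
  moreover have "length ys = 2 * mat_rank F" using len by (simp add: ys_def)
  moreover have "\<forall>y\<in>set ys. supported n 1 y" using sr sv ss by (auto simp: ys_def)
  ultimately show ?thesis by (intro that[of ys]) auto
qed

section \<open>Low-rank truncation against the Hilbert-Schmidt norm\<close>

lemma rank_sum_of_products:
  fixes f g :: "nat \<Rightarrow> nat \<Rightarrow> complex"
  shows "vec_space.rank n (mat n n (\<lambda>(i, j). \<Sum>l<k. f l i * g l j)) \<le> k"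
proof (induction k)
  case 0
  have eq: "mat n n (\<lambda>(i, j). \<Sum>l<0. f l i * g l j) = 0\<^sub>m n n" by (rule eq_matI) auto
  show ?case unfolding eq using vec_space.rank_0I[where 'a = complex, of n n] by simp
next
  case (Suc k)
  have 1: "vec_space.rank n (mat n n (\<lambda>(i, j). f k i * g k j)) \<le> 1"
    by (rule vec_space.rank_le_1_product_entries[where f = "f k" and g = "g k" and nc = n]) auto
  have "mat n n (\<lambda>(i, j). \<Sum>l<Suc k. f l i * g l j) =
     mat n n (\<lambda>(i, j). \<Sum>l<k. f l i * g l j) + mat n n (\<lambda>(i, j). f k i * g k j)"
    by (rule eq_matI) auto
  then show ?case
    using vec_space.rank_subadditive[of "mat n n (\<lambda>(i, j). \<Sum>l<k. f l i * g l j)" n n "mat n n (\<lambda>(i, j). f k i * g k j)"] Suc 1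
    by simp
qed

text \<open>The sum is the squared Hilbert-Schmidt norm of \<open>a * p\<close> for the projection
  \<open>p\<close> onto the family; its adjoint \<open>p * adj a\<close> is no longer than
  \<open>adj a\<close>.\<close>

lemma bessel_hs:
  fixes k :: nat
  assumes v: "\<And>i. i < k \<Longrightarrow> supported n 1 (v i)" "\<And>i j. i < k \<Longrightarrow> j < k \<Longrightarrow> ip (v i) (v j) = (if i = j then 1 else 0)"
  shows "(\<Sum>i<k. (norm (a * v i))\<^sup>2) \<le> (norm a)\<^sup>2"
proof -
  define p where "p = (\<Sum>i<k. v i * adj (v i))"
  have p: "adj p = p" "p * p = p" unfolding p_def by (rule family_projection[OF v]; assumption)+
  have "ip (a * p) (a * p) = tr (p * (adj a * a * p))" unfolding ip_def using p by (simp add: mult.assoc)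
  also have "\<dots> = tr (adj a * a * p)" by (subst tr_times_commute) (simp add: mult.assoc p)
  also have "\<dots> = (\<Sum>i<k. tr (adj a * a * (v i * adj (v i))))" by (simp add: p_def sum_distrib_left tr_sum)
  also have "\<dots> = (\<Sum>i<k. ip (a * v i) (a * v i))"
    using ip_conj_eq_tr[of "adj a * a"] ip_times_left[of "adj a" "a * _"]
    by (intro sum.cong refl) (metis adj_simps(5) mult.assoc)
  finally have "complex_of_real ((norm (a * p))\<^sup>2) = complex_of_real (\<Sum>i<k. (norm (a * v i))\<^sup>2)"
    by (simp add: ip_self_norm)
  then have "(\<Sum>i<k. (norm (a * v i))\<^sup>2) = (norm (a * p))\<^sup>2" by (simp only: of_real_eq_iff)
  also have "norm (a * p) = norm (p * adj a)" using norm_adj[of "a * p"] p by simp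
  also have "(norm (p * adj a))\<^sup>2 \<le> (norm a)\<^sup>2"
    using bounded_byD[OF bounded_by_projection[OF p], of "adj a"] by (intro power_mono) auto
  finally show ?thesis .
qed

text \<open>A maximal orthonormal family on which \<open>A\<close> is larger than \<open>\<epsilon>\<close> splits off a low-rank part:
  on its orthogonal complement \<open>A\<close> is at most \<open>\<epsilon>\<close>.\<close>

lemma greedy_low_rank:
  assumes A: "A \<in> carrier_mat n n" and \<epsilon>: "0 < \<epsilon>"
  obtains F where "F \<in> carrier_mat n n" "op_norm (A - F) \<le> \<epsilon>" "real (mat_rank F) * \<epsilon>\<^sup>2 \<le> (norm (of_mat A))\<^sup>2"
proof -
  define a where "a = of_mat A"
  have sa: "supported n n a" unfolding a_def by (rule supported_of_mat[OF A])
  define P where "P = (\<lambda>xs. orthonormal xs \<and> (\<forall>x\<in>set xs. supported n 1 x \<and> norm (a * x) > \<epsilon>))"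
  have Pb: "real (length xs) * \<epsilon>\<^sup>2 \<le> (norm a)\<^sup>2" if "P xs" for xs
  proof -
    have "real (length xs) * \<epsilon>\<^sup>2 = (\<Sum>i<length xs. \<epsilon>\<^sup>2)" by simp
    also have "\<dots> \<le> (\<Sum>i<length xs. (norm (a * xs ! i))\<^sup>2)"
      using that \<epsilon> by (intro sum_mono power_mono) (auto simp: P_def intro: less_imp_le)
    also have "\<dots> \<le> (norm a)\<^sup>2"
      using that orthonormal_nth by (intro bessel_hs[of _ n]) (auto simp: P_def)
    finally show ?thesis .
  qed
  \<comment> \<open>The Bessel bound limits the length of admissible families, so a longest one
    exists.\<close>
  have "length xs < nat \<lceil>(norm a)\<^sup>2 / \<epsilon>\<^sup>2\<rceil> + 1" if "P xs" for xs
  proof -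
    have "real (length xs) \<le> (norm a)\<^sup>2 / \<epsilon>\<^sup>2" using Pb[OF that] \<epsilon> by (simp add: pos_le_divide_eq)
    then show ?thesis by linarith
  qed
  moreover have "P []" by (simp add: P_def)
  ultimately obtain xs where xs: "P xs" "\<forall>ys. P ys \<longrightarrow> length ys \<le> length xs"
    using ex_has_greatest_nat[of P "[]" length] by blast
  define k v where "k = length xs" and "v = (\<lambda>i. xs ! i)"
  have v: "supported n 1 (v i)" "ip (v i) (v j) = (if i = j then 1 else 0)" if "i < k" "j < k" for i j
    using xs(1) that orthonormal_nth by (auto simp: P_def k_def v_def)
  have v1: "supported n 1 (v i)" if "i < k" for i using v(1)[OF that that] .
  define p where "p = (\<Sum>i<k. v i * adj (v i))"
  have p: "adj p = p" "p * p = p" "supported n n p" unfolding p_def by (rule family_projection[OF v1 v(2)]; assumption)+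
  define q where "q = corner_one n - p"
  have q: "adj q = q" "q * q = q" "supported n n q"
    using p corner_one_times[OF supported_corner_one[of n]]
    by (simp_all add: q_def algebra_simps corner_one_times times_corner_one supported_minus supported_corner_one)
  have vc: "v i * corner_one (Suc 0) = v i" if "i < k" for i
    using times_corner_one[OF v1[OF that]] by simp
  have pv: "p * v i = v i" if "i < k" for i
  proof -
    have "p * v i = (\<Sum>l<k. v l * (adj (v l) * v i))" unfolding p_def sum_distrib_right by (simp add: mult.assoc)
    also have "\<dots> = (\<Sum>l<k. if l = i then v i else 0)"
      using v that by (intro sum.cong refl)
        (auto simp: adj_times_vectors[of n] cscale_simps cscale_times_right vc)
    finally show ?thesis using that by simp
  qed
  \<comment> \<open>Otherwise the normalised \<open>y\<close> would extend the longest
    family.\<close>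
  have small: "norm (a * y) \<le> \<epsilon> * norm y" if y: "supported n 1 y" "\<forall>i<k. ip y (v i) = 0" for y
  proof (rule ccontr)
    assume neg: "\<not> norm (a * y) \<le> \<epsilon> * norm y"
    then have y0: "y \<noteq> 0" by auto
    define u where "u = complex_of_real (1 / norm y) *\<^sub>c y"
    have "norm (a * u) > \<epsilon>" using neg y0 by (simp add: u_def cscale_times_right norm_divide field_simps)
    moreover have "ip u u = 1" unfolding u_def by (rule ip_normalize[OF y0])
    moreover have "supported n 1 u" unfolding u_def by (rule supported_cscale[OF y(1)])
    moreover have "ip u x = 0" if "x \<in> set xs" for x
      using that y(2) by (auto simp: u_def ip_simps in_set_conv_nth k_def v_def)
    ultimately have "P (u # xs)" using xs(1) by (simp add: P_def)
    then show False using xs(2) by fastforce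
  qed
  \<comment> \<open>\<open>a * p\<close> agrees with \<open>a\<close> on the family, and the
    remainder \<open>a * q\<close> acts through the complement, where \<open>small\<close>
    applies.\<close>
  define F where "F = to_mat n (a * p)"
  have sap: "supported n n (a * p)" by (rule supported_times[OF sa p(3)])
  have F: "F \<in> carrier_mat n n" "of_mat F = a * p" unfolding F_def by (simp_all add: of_mat_to_mat[OF sap])
  have AF: "of_mat (A - F) = a * q"
    using of_mat_minus[OF A F(1)] F(2) times_corner_one[OF sa] by (simp add: a_def q_def right_diff_distrib)
  have "bounded_by (a * q) \<epsilon>"
  proof (rule bounded_by_vectors)
    show "supported n n (a * q)" by (rule supported_times[OF sa q(3)])
    fix x assume x: "supported n 1 x"
    have "supported n 1 (q * x)" by (rule supported_times[OF q(3) x])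
    moreover have "ip (q * x) (v i) = 0" if "i < k" for i
    proof -
      have "q * v i = 0" using pv[OF that] v1[OF that] by (simp add: q_def left_diff_distrib corner_one_times)
      then show ?thesis by (simp add: ip_times_left q ip_simps)
    qed
    ultimately have "norm (a * (q * x)) \<le> \<epsilon> * norm (q * x)" by (intro small) auto
    also have "\<dots> \<le> \<epsilon> * norm x" using bounded_byD[OF bounded_by_projection[OF q(1,2)], of x] \<epsilon> by simp
    finally show "norm (a * q * x) \<le> \<epsilon> * norm x" by (simp add: mult.assoc)
  qed (use \<epsilon> in simp)
  then have 1: "op_norm (A - F) \<le> \<epsilon>" using A F by (intro op_norm_le[of _ n]) (auto simp: AF)
  have "F = mat n n (\<lambda>(i, j). \<Sum>l<k. entry (a * v l) i 0 * cnj (entry (v l) j 0))"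
  proof -
    have "entry (a * p) i j = (\<Sum>l<k. entry (a * v l) i 0 * cnj (entry (v l) j 0))" for i j
    proof -
      have "a * p = (\<Sum>l<k. (a * v l) * adj (v l))" unfolding p_def sum_distrib_left by (simp add: mult.assoc)
      moreover have "entry ((a * v l) * adj (v l)) i j = entry (a * v l) i 0 * cnj (entry (v l) j 0)" if "l < k" for l
        using entry_times[OF disjI1[OF supported_times[OF sa v1[OF that]]], of "adj (v l)" i j] by simp
      ultimately show ?thesis by (simp add: entry_sum)
    qed
    then show ?thesis by (simp add: F_def to_mat_def)
  qed
  then have "mat_rank F \<le> k" using rank_sum_of_products F(1) by simp
  then have "real (mat_rank F) * \<epsilon>\<^sup>2 \<le> real k * \<epsilon>\<^sup>2" by (intro mult_right_mono) auto
  also have "\<dots> \<le> (norm a)\<^sup>2" unfolding k_def by (rule Pb[OF xs(1)])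
  finally show ?thesis using that[OF F(1) 1] by (simp add: a_def)
qed

text \<open>The zero matrix is a commutator of zeros and has cost 0. In the theorem this turns the
  strict cost hypothesis into \<open>A\<close> being nonzero.\<close>

lemma op_norm_pos:
  assumes A: "A \<in> carrier_mat n n" and c: "commutator_cost A > 0"
  shows "op_norm A > 0"
proof (rule ccontr)
  assume "\<not> op_norm A > 0"
  then have "op_norm A = 0" using op_norm_nonneg[OF A] by simp
  then have "norm (of_mat A) \<le> 0"
    using bounded_byD[OF bounded_by_op_norm[OF A], of "corner_one n"] by (simp add: times_corner_one[OF supported_of_mat[OF A]])
  then have "of_mat A = 0 * 0 - 0 * 0" by simp
  then have "commutator_cost A \<le> ereal (0 * 0)"
    by (rule commutator_cost_le[OF A supported_zero supported_zero]) (auto intro: bounded_by_zero)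
  then show False using c by (simp add: zero_ereal_def)
qed

text \<open>\<open>A\<close> itself is a competitor, so the minimum is taken over a nonempty
  set.\<close>

lemma approx_rank_attained:
  assumes A: "A \<in> carrier_mat n n" and \<epsilon>: "0 \<le> \<epsilon>"
  obtains F where "F \<in> carrier_mat n n" "op_norm (A - F) \<le> \<epsilon> * op_norm A" "mat_rank F = approx_rank \<epsilon> A"
proof -
  have "op_norm (A - A) \<le> \<epsilon> * op_norm A"
  proof -
    have "bounded_by (of_mat (A - A)) 0" using of_mat_minus[OF A A] by (simp add: bounded_by_zero)
    then have "op_norm (A - A) \<le> 0" using A by (intro op_norm_le[of _ n]) auto
    also have "\<dots> \<le> \<epsilon> * op_norm A" using \<epsilon> op_norm_nonneg[OF A] by simp
    finally show ?thesis .
  qed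
  then have "\<exists>r. \<exists>F\<in>carrier_mat (dim_row A) (dim_col A). op_norm (A - F) \<le> \<epsilon> * op_norm A \<and> mat_rank F = r"
    using A by (intro exI[of _ "mat_rank A"] bexI[of _ A] conjI) auto
  from LeastI_ex[OF this] show ?thesis unfolding approx_rank_def[symmetric] using that A by auto
qed

lemma approx_rank_le:
  "F \<in> carrier_mat (dim_row A) (dim_col A) \<Longrightarrow> op_norm (A - F) \<le> \<epsilon> * op_norm A \<Longrightarrow> approx_rank \<epsilon> A \<le> mat_rank F"
  unfolding approx_rank_def by (rule Least_le) blast

text \<open>An approximation of rank at most \<open>n / 100\<close> would leave enough room for the
  block decomposition, whose cost estimate contradicts \<open>cost\<close>.\<close>

lemma approx_rank_lower_bound:
  assumes A: "A \<in> carrier_mat n n" "mat_trace A = 0" and K: "20000 \<le> K"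
    and hyp: "\<And>m D. 1 \<le> m \<Longrightarrow> m < n \<Longrightarrow> D \<in> carrier_mat m m \<Longrightarrow> mat_trace D = 0 \<Longrightarrow> commutator_cost D \<le> ereal (K * op_norm D)"
    and cost: "commutator_cost A > ereal (3 / 4 * K * op_norm A)"
  shows "real n < 100 * real (approx_rank (1/100) A)"
proof (rule ccontr)
  assume neg: "\<not> real n < 100 * real (approx_rank (1/100) A)"
  have "0 \<le> ereal (3 / 4 * K * op_norm A)" using K op_norm_nonneg[OF A(1)] by simp
  then have pos: "0 < op_norm A" using op_norm_pos[OF A(1)] cost by (metis order_le_less_trans)
  obtain F where F: "F \<in> carrier_mat n n" "op_norm (A - F) \<le> 1/100 * op_norm A" "mat_rank F = approx_rank (1/100) A"
    by (rule approx_rank_attained[OF A(1), of "1/100"]) auto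
  define r where "r = mat_rank F"
  obtain ys where ys: "length ys = 2 * mat_rank F" "\<forall>y\<in>set ys. supported n 1 y"
    "\<forall>x. supported n 1 x \<longrightarrow> (\<forall>y\<in>set ys. ip x y = 0) \<longrightarrow> of_mat F * x = 0 \<and> adj (of_mat F) * x = 0"
    by (rule rank_annihilator[OF F(1)])
  have bAF: "bounded_by (of_mat A - of_mat F) (op_norm A / 100)"
  proof -
    have "A - F \<in> carrier_mat n n" using A(1) F(1) by auto
    from bounded_by_op_norm[OF this] have "bounded_by (of_mat (A - F)) (op_norm A / 100)"
      by (rule bounded_by_mono) (use F(2) in simp)
    then show ?thesis using of_mat_minus[OF A(1) F(1)] by simp
  qed
  \<comment> \<open>Rank 0 would make the norm of \<open>A\<close> at most a hundredth of itself.
    Once \<open>r\<close> is at least 1, the required 24 \<open>r\<close> + 3 is at most 100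
    \<open>r\<close>, hence at most \<open>n\<close>.\<close>
  have "r \<noteq> 0"
  proof
    assume "r = 0"
    then have "ys = []" using ys(1) by (simp add: r_def)
    then have kill: "of_mat F * x = 0" if "supported n 1 x" for x using ys(3) that by auto
    have "bounded_by (of_mat A) (op_norm A / 100)"
    proof (rule bounded_by_vectors[OF supported_of_mat[OF A(1)]])
      fix x assume x: "supported n 1 x"
      show "norm (of_mat A * x) \<le> op_norm A / 100 * norm x"
        using bounded_byD[OF bAF, of x] kill[OF x] by (simp add: left_diff_distrib)
    qed (use pos in simp)
    then have "op_norm A \<le> op_norm A / 100" by (rule op_norm_le[OF A(1)])
    then show False using pos by simp
  qed
  moreover have "100 * r \<le> n" using neg F(3) by (simp add: r_def)
  ultimately have n: "12 * length ys + 3 \<le> n" using ys(1) by (simp add: r_def)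
  have "commutator_cost A \<le> ereal (3 / 4 * K * op_norm A)"
  proof (rule low_rank_commutator_cost[OF A pos K hyp bAF _ _ n])
    show "supported n 1 y" if "y \<in> set ys" for y using ys(2) that by blast
    show "of_mat F * x = 0 \<and> adj (of_mat F) * x = 0" if "supported n 1 x" "\<And>y. y \<in> set ys \<Longrightarrow> ip x y = 0" for x
      using ys(3) that by blast
  qed
  then show False using cost by simp
qed

text \<open>The greedy truncation at threshold \<open>\<epsilon> * op_norm A\<close> competes in the
  definition of \<open>approx_rank\<close>, and the Hilbert-Schmidt norm pays for its rank.\<close>

lemma hs_norm_lower_bound:
  assumes A: "A \<in> carrier_mat n n" and pos: "0 < op_norm A" and \<epsilon>: "0 < \<epsilon>"
  shows "real (approx_rank \<epsilon> A) * (\<epsilon> * op_norm A)\<^sup>2 \<le> (hs_norm A)\<^sup>2"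
proof -
  have "0 < \<epsilon> * op_norm A" using pos \<epsilon> by simp
  then obtain F where F: "F \<in> carrier_mat n n" "op_norm (A - F) \<le> \<epsilon> * op_norm A"
     "real (mat_rank F) * (\<epsilon> * op_norm A)\<^sup>2 \<le> (norm (of_mat A))\<^sup>2"
    using greedy_low_rank[OF A] by blast
  have "approx_rank \<epsilon> A \<le> mat_rank F" using F A by (intro approx_rank_le) auto
  then have "real (approx_rank \<epsilon> A) * (\<epsilon> * op_norm A)\<^sup>2 \<le> real (mat_rank F) * (\<epsilon> * op_norm A)\<^sup>2"
    by (intro mult_right_mono) auto
  also have "\<dots> \<le> (hs_norm A)\<^sup>2" using F(3) hs_norm_eq[OF A] by simp
  finally show ?thesis .
qed

theorem theorem5p1:
  shows "\<exists>\<epsilon>\<^sub>0 \<delta>\<^sub>0 K\<^sub>0 :: real. \<epsilon>\<^sub>0 > 0 \<and> \<delta>\<^sub>0 > 0 \<and> K\<^sub>0 > 0 \<and>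
    (\<forall>K \<ge> K\<^sub>0. \<forall>n \<ge> 1. \<forall>A \<in> carrier_mat n n.
       mat_trace A = 0 \<longrightarrow>
       (\<forall>m D. 1 \<le> m \<and> m < n \<and> D \<in> carrier_mat m m \<and> mat_trace D = 0 \<longrightarrow>
          commutator_cost D \<le> ereal (K * op_norm D)) \<longrightarrow>
       commutator_cost A > ereal (3 / 4 * K * op_norm A) \<longrightarrow>
       real (approx_rank \<epsilon>\<^sub>0 A) > \<delta>\<^sub>0 * real n \<and>
       (hs_norm A)\<^sup>2 \<ge> (1 / 2 * \<delta>\<^sub>0 * \<epsilon>\<^sub>0\<^sup>2) * real n * (op_norm A)\<^sup>2)"
proof (intro exI conjI allI ballI impI)
  \<comment> \<open>The decomposition works with
    \<open>\<epsilon>\<^sub>0 = \<delta>\<^sub>0 = 1/100\<close>, and the comparison of constants in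
    \<open>low_rank_commutator_cost\<close> gives \<open>K\<^sub>0 = 20000\<close>.\<close>
  show "(0::real) < 1/100" "(0::real) < 1/100" "(0::real) < 20000" by simp_all
  fix K :: real and n :: nat and A :: "complex mat"
  assume K: "20000 \<le> K" and n: "1 \<le> n" and A: "A \<in> carrier_mat n n" "mat_trace A = 0"
    and hyp: "\<forall>m D. 1 \<le> m \<and> m < n \<and> D \<in> carrier_mat m m \<and> mat_trace D = 0 \<longrightarrow>
          commutator_cost D \<le> ereal (K * op_norm D)"
    and cost: "commutator_cost A > ereal (3 / 4 * K * op_norm A)"
  have rank: "real n < 100 * real (approx_rank (1/100) A)"
    by (rule approx_rank_lower_bound[OF A K _ cost]) (use hyp in blast)
  then show "1/100 * real n < real (approx_rank (1/100) A)" by simp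
  have "0 \<le> ereal (3 / 4 * K * op_norm A)" using K op_norm_nonneg[OF A(1)] by simp
  then have pos: "0 < op_norm A" using op_norm_pos[OF A(1)] cost by (metis order_le_less_trans)
  \<comment> \<open>The rank bound and the greedy bound together give this without the factor 1/2,
    which is given away.\<close>
  have "1 / 2 * (1/100) * (1/100)\<^sup>2 * real n * (op_norm A)\<^sup>2 = 1/2 * (1/100 * real n) * (1/100 * op_norm A)\<^sup>2"
    by (simp add: power2_eq_square)
  also have "\<dots> \<le> real (approx_rank (1/100) A) * (1/100 * op_norm A)\<^sup>2"
    using rank by (intro mult_right_mono) auto
  also have "\<dots> \<le> (hs_norm A)\<^sup>2" by (rule hs_norm_lower_bound[OF A(1) pos]) simp
  finally show "1 / 2 * (1/100) * (1/100)\<^sup>2 * real n * (op_norm A)\<^sup>2 \<le> (hs_norm A)\<^sup>2" .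
qed

end
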